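(* Let $G$ be a finite group and let $\{U_g\}_{g\in G}$ be a unitary projective representation of $G$ on a nonzero finite-dimensional complex Hilbert space $H_Q$, with all prior probabilities equal to $1/|G|$. Let $\sigma$ run over the (equivalence classes of) irreducible unitary projective representations of $G$ with the same factor set, let $d_\sigma$ be the dimension of $\sigma$ and $m_\sigma$ its multiplicity in $\{U_g\}$. Then for error margin $m=0$ (unambiguous discrimination), the following hold. (i) Without an ancilla, the maximum success probability $P_{\max}(0)$ of discriminating $\{U_g\}_{g\in G}$ is either $0$ or $1$: it is $1$ if $m_\sigma\ge d_\sigma$ for all $\sigma$, and $0$ otherwise. (ii) If $m_\sigma=0$ for some $\sigma$, then for every nonzero finite-dimensional ancilla space $H_R$ the maximum success probability $P_{\max}(0)$ of discriminating $\{U_g\otimes1_R\}_{g\in G}$ on $H_Q\otimes H_R$ is $0$. (iii) If $m_\sigma\ge1$ for all $\sigma$ but $m_\sigma<d_\sigma$ for some $\sigma$, then $P_{\max}(0)=0$ without an ancilla, whereas for every ancilla space $H_R$ of sufficiently large finite dimension the maximum success probability $P_{\max}(0)$ of discriminating $\{U_g\otimes1_R\}_{g\in G}$ on $H_Q\otimes H_R$ is $1$.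
   Context: A unitary projective representation of a finite group $G$ on $H$ is a family of unitary operators $\{U_g\}_{g\in G}$ on $H$ with $U_gU_h=c_{g,h}U_{gh}$ for all $g,h\in G$, where the $c_{g,h}$ are complex numbers with $|c_{g,h}|=1$; $\{c_{g,h}\}$ is called the factor set. For a fixed factor set, equivalence, irreducibility and decomposition into irreducibles (with multiplicities) are defined as for ordinary representations. Discrimination with error margin and equal priors, for a family $\{V_g\}_{g\in G}$ of unitaries on a finite-dimensional space $H$: a strategy consists of a density operator $\rho$ on $H$ (input state) and a POVM $\{E_0\}\cup\{E_g\}_{g\in G}$ on $H$ (positive semidefinite operators with $E_0+\sum_{g\in G}E_g=1$; outcome $g$ means "guess $V_g$", and $E_0$ gives the inconclusive result). The success and mean error probabilities are $$P_\circ=\frac1{|G|}\sum_{g\in G}\mathrm{tr}(E_gV_g\rho V_g^\dagger),\qquad P_\times=\frac1{|G|}\sum_{g\ne h}\mathrm{tr}(E_gV_h\rho V_h^\dagger).$$ For $m\in[0,1]$, $P_{\max}(m)$ is the maximum of $P_\circ$ over all strategies with $P_\times\le m$. *)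

theory Defs
  imports
    "HOL-Algebra.Group"
    "Jordan_Normal_Form.Schur_Decomposition"
    "Jordan_Normal_Form.VS_Connect"
begin

text \<open>
  A nonzero finite-dimensional Hilbert space is taken, after a choice of orthonormal basis, to be
  the space of complex column vectors of length \<open>n > 0\<close>; operators are \<open>n \<times> n\<close> matrices. Families
  indexed by a group are functions of which only the values on the carrier matter.
\<close>

section \<open>Matrices\<close>

definition unitary_mat :: "nat \<Rightarrow> complex mat \<Rightarrow> bool" where
  "unitary_mat n A \<longleftrightarrow>
     A \<in> carrier_mat n n \<and> A * mat_adjoint A = 1\<^sub>m n \<and> mat_adjoint A * A = 1\<^sub>m n"

text \<open>The order on \<^typ>\<open>complex\<close> makes \<open>0 \<le> z\<close> mean that \<open>z\<close> is real and nonnegative, so a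
  matrix that is positive semidefinite in this sense is automatically Hermitian.\<close>

definition psd_mat :: "nat \<Rightarrow> complex mat \<Rightarrow> bool" where
  "psd_mat n A \<longleftrightarrow> A \<in> carrier_mat n n \<and> (\<forall>v \<in> carrier_vec n. 0 \<le> (A *\<^sub>v v) \<bullet>c v)"

definition mat_trace :: "complex mat \<Rightarrow> complex" where
  "mat_trace A = (\<Sum>i<dim_row A. A $$ (i, i))"

definition mat_sum :: "nat \<Rightarrow> ('i \<Rightarrow> complex mat) \<Rightarrow> 'i set \<Rightarrow> complex mat" where
  "mat_sum n F I = mat n n (\<lambda>ij. \<Sum>x\<in>I. F x $$ ij)"

text \<open>The matrix of the tensor product of two operators, in the product basis ordered
  lexicographically.\<close>

definition kronecker :: "complex mat \<Rightarrow> complex mat \<Rightarrow> complex mat" where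
  "kronecker A B = mat (dim_row A * dim_row B) (dim_col A * dim_col B)
     (\<lambda>(i, j). A $$ (i div dim_row B, j div dim_col B) * B $$ (i mod dim_row B, j mod dim_col B))"

section \<open>Unitary projective representations\<close>

definition factor_set :: "('g, 'x) monoid_scheme \<Rightarrow> ('g \<Rightarrow> 'g \<Rightarrow> complex) \<Rightarrow> bool" where
  "factor_set G c \<longleftrightarrow> (\<forall>g \<in> carrier G. \<forall>h \<in> carrier G. cmod (c g h) = 1)"

definition proj_rep ::
  "('g, 'x) monoid_scheme \<Rightarrow> ('g \<Rightarrow> 'g \<Rightarrow> complex) \<Rightarrow> nat \<Rightarrow> ('g \<Rightarrow> complex mat) \<Rightarrow> bool" where
  "proj_rep G c n U \<longleftrightarrow>
     factor_set G c \<and>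
     (\<forall>g \<in> carrier G. unitary_mat n (U g)) \<and>
     (\<forall>g \<in> carrier G. \<forall>h \<in> carrier G. U g * U h = c g h \<cdot>\<^sub>m U (g \<otimes>\<^bsub>G\<^esub> h))"

definition irreducible_rep ::
  "('g, 'x) monoid_scheme \<Rightarrow> ('g \<Rightarrow> 'g \<Rightarrow> complex) \<Rightarrow> nat \<Rightarrow> ('g \<Rightarrow> complex mat) \<Rightarrow> bool" where
  "irreducible_rep G c n U \<longleftrightarrow>
     proj_rep G c n U \<and> n > 0 \<and>
     (\<forall>W. VectorSpace.subspace class_ring W (module_vec TYPE(complex) n) \<and>
          (\<forall>g \<in> carrier G. \<forall>v \<in> W. U g *\<^sub>v v \<in> W)
        \<longrightarrow> W = {0\<^sub>v n} \<or> W = carrier_vec n)"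

text \<open>Equivalence of unitary representations is unitary equivalence. The dimensions are part of the
  condition: representations of different dimensions are never related.\<close>

definition equivalent_rep ::
  "('g, 'x) monoid_scheme \<Rightarrow> nat \<Rightarrow> ('g \<Rightarrow> complex mat) \<Rightarrow> ('g \<Rightarrow> complex mat) \<Rightarrow> bool" where
  "equivalent_rep G n S T \<longleftrightarrow>
     (\<forall>g \<in> carrier G. S g \<in> carrier_mat n n \<and> T g \<in> carrier_mat n n) \<and>
     (\<exists>W. unitary_mat n W \<and> (\<forall>g \<in> carrier G. W * S g = T g * W))"

definition direct_sum_rep :: "('g \<Rightarrow> complex mat) list \<Rightarrow> 'g \<Rightarrow> complex mat" where
  "direct_sum_rep Ss g = diag_block_mat (map (\<lambda>S. S g) Ss)"

definition irreducible_decomposition ::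
  "('g, 'x) monoid_scheme \<Rightarrow> ('g \<Rightarrow> 'g \<Rightarrow> complex) \<Rightarrow> nat \<Rightarrow> ('g \<Rightarrow> complex mat)
     \<Rightarrow> ('g \<Rightarrow> complex mat) list \<Rightarrow> bool" where
  "irreducible_decomposition G c n U Ss \<longleftrightarrow>
     (\<forall>S \<in> set Ss. \<exists>d. irreducible_rep G c d S) \<and> equivalent_rep G n (direct_sum_rep Ss) U"

text \<open>\<open>multiplicity_rep G c n U d S\<close> is the multiplicity in the \<open>n\<close>-dimensional representation \<open>U\<close>
  of the irreducible \<open>d\<close>-dimensional representation \<open>S\<close>; the number does not depend on the
  decomposition, which is why the definite description is used.\<close>

definition multiplicity_rep ::
  "('g, 'x) monoid_scheme \<Rightarrow> ('g \<Rightarrow> 'g \<Rightarrow> complex) \<Rightarrow> nat \<Rightarrow> ('g \<Rightarrow> complex mat)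
     \<Rightarrow> nat \<Rightarrow> ('g \<Rightarrow> complex mat) \<Rightarrow> nat" where
  "multiplicity_rep G c n U d S =
     (THE k. \<exists>Ss. irreducible_decomposition G c n U Ss \<and>
                  k = length (filter (equivalent_rep G d S) Ss))"

section \<open>Discrimination with an error margin\<close>

definition density_mat :: "nat \<Rightarrow> complex mat \<Rightarrow> bool" where
  "density_mat n \<rho> \<longleftrightarrow> psd_mat n \<rho> \<and> mat_trace \<rho> = 1"

text \<open>The element \<open>E0\<close> belongs to the inconclusive outcome, \<open>E g\<close> to the guess \<open>g\<close>.\<close>

definition povm :: "('g, 'x) monoid_scheme \<Rightarrow> nat \<Rightarrow> complex mat \<Rightarrow> ('g \<Rightarrow> complex mat) \<Rightarrow> bool" where
  "povm G n E0 E \<longleftrightarrow>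
     psd_mat n E0 \<and> (\<forall>g \<in> carrier G. psd_mat n (E g)) \<and> E0 + mat_sum n E (carrier G) = 1\<^sub>m n"

text \<open>The traces below are real for positive semidefinite \<open>\<rho>\<close> and \<open>E g\<close>.\<close>

definition P_success ::
  "('g, 'x) monoid_scheme \<Rightarrow> ('g \<Rightarrow> complex mat) \<Rightarrow> complex mat \<Rightarrow> ('g \<Rightarrow> complex mat) \<Rightarrow> real" where
  "P_success G V \<rho> E =
     (\<Sum>g \<in> carrier G. Re (mat_trace (E g * (V g * \<rho> * mat_adjoint (V g))))) / real (card (carrier G))"

definition P_error ::
  "('g, 'x) monoid_scheme \<Rightarrow> ('g \<Rightarrow> complex mat) \<Rightarrow> complex mat \<Rightarrow> ('g \<Rightarrow> complex mat) \<Rightarrow> real" where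
  "P_error G V \<rho> E =
     (\<Sum>g \<in> carrier G. \<Sum>h \<in> carrier G - {g}.
        Re (mat_trace (E g * (V h * \<rho> * mat_adjoint (V h))))) / real (card (carrier G))"

definition admissible ::
  "('g, 'x) monoid_scheme \<Rightarrow> nat \<Rightarrow> ('g \<Rightarrow> complex mat) \<Rightarrow> real
     \<Rightarrow> complex mat \<Rightarrow> complex mat \<Rightarrow> ('g \<Rightarrow> complex mat) \<Rightarrow> bool" where
  "admissible G n V m \<rho> E0 E \<longleftrightarrow> density_mat n \<rho> \<and> povm G n E0 E \<and> P_error G V \<rho> E \<le> m"

text \<open>\<open>is_P_max G n V m p\<close> states that the maximum success probability with error margin \<open>m\<close>
  exists, i.e. is attained by a strategy, and equals \<open>p\<close>.\<close>

definition is_P_max ::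
  "('g, 'x) monoid_scheme \<Rightarrow> nat \<Rightarrow> ('g \<Rightarrow> complex mat) \<Rightarrow> real \<Rightarrow> real \<Rightarrow> bool" where
  "is_P_max G n V m p \<longleftrightarrow>
     (\<exists>\<rho> E0 E. admissible G n V m \<rho> E0 E \<and> P_success G V \<rho> E = p) \<and>
     (\<forall>\<rho> E0 E. admissible G n V m \<rho> E0 E \<longrightarrow> P_success G V \<rho> E \<le> p)"

definition with_ancilla :: "nat \<Rightarrow> ('g \<Rightarrow> complex mat) \<Rightarrow> 'g \<Rightarrow> complex mat" where
  "with_ancilla r U g = kronecker (U g) (1\<^sub>m r)"

end

theory Submission
  imports Defs "Jordan_Normal_Form.Spectral_Radius"
begin

text \<open>
  If some strategy succeeds with positive probability and never errs, then for some vector \<open>\<phi>\<close> in the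
  range of the input state one of the vectors \<open>V g * \<phi>\<close> can be told apart with certainty from all the
  others. Averaging rank-one maps built from \<open>\<phi>\<close> over the group then produces a \<open>d\<close>-dimensional space
  of intertwiners from each irreducible \<open>S\<close> of dimension \<open>d\<close> into \<open>V\<close>, so the multiplicity of \<open>S\<close> is at
  least \<open>d\<close>. Conversely, \<open>S\<close> occurs at most \<open>d\<close> times in the twisted regular representation, so if all
  multiplicities in \<open>V\<close> are large enough then the regular representation embeds isometrically in \<open>V\<close>;
  the image of the basis vector of the unit of the group has an orthonormal orbit and is therefore
  discriminated perfectly. An ancilla of dimension \<open>r\<close> multiplies all multiplicities by \<open>r\<close>, which
  makes them large exactly when none of them is zero.
\<close>

section \<open>Adjoints, isometries and subspaces\<close>

text \<open>The number \<open>multiplicity_rep\<close> is a definite description over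
  decompositions, so it says nothing until decompositions exist and agree in their counts.
  Everything is therefore reduced to the dimension of the space of intertwiners from
  \<open>S\<close>: by Schur's lemma a summand equivalent to \<open>S\<close> contributes one
  dimension and any other summand none. Between different representations only inequalities of such
  dimensions are compared, so neither characters nor orthogonality relations appear. For the regular
  representation an upper bound suffices: an intertwiner into it is fixed by a single row of length
  \<open>d\<close>. The input may be mixed and the POVM arbitrary. What turns zero error into linear
  algebra is that two positive semidefinite matrices whose product has trace zero have product zero.
  The averaged maps are intertwiners because the phases of \<open>V\<close> and \<open>S\<close>
  cancel, which is where the common factor set enters. The cocycle identity needed for the regular
  representation is read off from \<open>U\<close>, which has positive dimension.\<close>

notation mat_adjoint ("_\<^sup>\<dagger>" [1000] 999)

lemma dim_mat_adjoint [simp]: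
  "dim_row (A\<^sup>\<dagger>) = dim_col A" "dim_col (A\<^sup>\<dagger>) = dim_row A"
  by (auto simp: mat_adjoint_def)

lemma index_mat_adjoint [simp]:
  "i < dim_col A \<Longrightarrow> j < dim_row A \<Longrightarrow> A\<^sup>\<dagger> $$ (i, j) = conjugate (A $$ (j, i))"
  by (auto simp: mat_adjoint_def mat_of_rows_def)

lemma mat_adjoint_carrier [simp]: "A \<in> carrier_mat n m \<Longrightarrow> A\<^sup>\<dagger> \<in> carrier_mat m n"
  by auto

lemma mat_adjoint_adjoint [simp]: "(A\<^sup>\<dagger>)\<^sup>\<dagger> = (A :: complex mat)"
  by (rule eq_matI) auto

lemma mat_adjoint_mult [simp]:
  "dim_col A = dim_row B \<Longrightarrow> (A * B)\<^sup>\<dagger> = B\<^sup>\<dagger> * (A :: complex mat)\<^sup>\<dagger>"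
  by (rule eq_matI) (auto simp: scalar_prod_def intro!: sum.cong)

lemma mat_adjoint_add [simp]:
  "dim_row A = dim_row B \<Longrightarrow> dim_col A = dim_col B \<Longrightarrow> (A + B)\<^sup>\<dagger> = A\<^sup>\<dagger> + (B :: complex mat)\<^sup>\<dagger>"
  by (rule eq_matI) auto

lemma mat_adjoint_smult [simp]: "(k \<cdot>\<^sub>m A)\<^sup>\<dagger> = cnj k \<cdot>\<^sub>m (A :: complex mat)\<^sup>\<dagger>"
  by (rule eq_matI) auto

lemma mat_adjoint_one [simp]: "(1\<^sub>m n)\<^sup>\<dagger> = (1\<^sub>m n :: complex mat)"
  by (rule eq_matI) auto

lemma mat_adjoint_zero [simp]: "(0\<^sub>m n k)\<^sup>\<dagger> = (0\<^sub>m k n :: complex mat)"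
  by (rule eq_matI) auto

text \<open>The ring laws with equations between dimensions as side conditions, which the simplifier can
  discharge without guessing.\<close>

lemma mat_mult_assoc_dim:
  "dim_col A = dim_row B \<Longrightarrow> dim_col B = dim_row C \<Longrightarrow> A * B * C = A * (B * (C :: 'a :: semiring_0 mat))"
  by (rule assoc_mult_mat) auto

lemma mat_distrib_left_dim:
  "dim_col A = dim_row B \<Longrightarrow> dim_row B = dim_row C \<Longrightarrow> dim_col B = dim_col C
    \<Longrightarrow> A * (B + C) = A * B + A * (C :: 'a :: semiring_0 mat)"
  by (rule mult_add_distrib_mat) auto

lemma mat_distrib_right_dim:
  "dim_row A = dim_row B \<Longrightarrow> dim_col A = dim_col B \<Longrightarrow> dim_col B = dim_row C
    \<Longrightarrow> (A + B) * C = A * C + B * (C :: 'a :: semiring_0 mat)"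
  by (rule add_mult_distrib_mat) auto

lemma mat_smult_left_dim:
  "dim_col A = dim_row B \<Longrightarrow> (k \<cdot>\<^sub>m A) * B = k \<cdot>\<^sub>m (A * (B :: 'a :: comm_ring_1 mat))"
  by (rule mult_smult_assoc_mat) auto

lemma mat_smult_right_dim:
  "dim_col A = dim_row B \<Longrightarrow> A * (k \<cdot>\<^sub>m B) = k \<cdot>\<^sub>m (A * (B :: 'a :: comm_ring_1 mat))"
  by (rule mult_smult_distrib) auto

lemma mat_mult_one_dim:
  "dim_row A = n \<Longrightarrow> 1\<^sub>m n * A = (A :: 'a :: semiring_1 mat)"
  "dim_col A = n \<Longrightarrow> A * 1\<^sub>m n = (A :: 'a :: semiring_1 mat)"
  by auto

lemma mat_mult_zero_dim:
  "dim_row A = n \<Longrightarrow> 0\<^sub>m m n * A = (0\<^sub>m m (dim_col A) :: 'a :: semiring_0 mat)"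
  "dim_col A = n \<Longrightarrow> A * 0\<^sub>m n m = (0\<^sub>m (dim_row A) m :: 'a :: semiring_0 mat)"
  by auto

lemma mat_add_zero_dim:
  "dim_row A = n \<Longrightarrow> dim_col A = m \<Longrightarrow> 0\<^sub>m n m + A = (A :: 'a :: monoid_add mat)"
  "dim_row A = n \<Longrightarrow> dim_col A = m \<Longrightarrow> A + 0\<^sub>m n m = (A :: 'a :: monoid_add mat)"
  by (auto intro!: eq_matI)

lemma mat_smult_zero [simp]: "k \<cdot>\<^sub>m 0\<^sub>m n m = (0\<^sub>m n m :: 'a :: mult_zero mat)"
  by (auto intro!: eq_matI)

lemma mat_smult_smult [simp]: "k \<cdot>\<^sub>m (l \<cdot>\<^sub>m A) = (k * l) \<cdot>\<^sub>m (A :: complex mat)"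
  by (auto intro!: eq_matI simp: mult_ac)

lemma mat_smult_one [simp]: "1 \<cdot>\<^sub>m A = (A :: complex mat)"
  by (auto intro!: eq_matI)

lemma mat_zero_smult: "0 \<cdot>\<^sub>m A = (0\<^sub>m (dim_row A) (dim_col A) :: complex mat)"
  by (auto intro!: eq_matI)

lemma mat_smult_eq_zero: "k \<cdot>\<^sub>m A = 0\<^sub>m n m \<Longrightarrow> k \<noteq> 0 \<Longrightarrow> (A :: complex mat) = 0\<^sub>m n m"
  by (rule eq_matI) (auto simp: mat_eq_iff)

lemmas mat_dim_simps = mat_mult_assoc_dim mat_distrib_left_dim mat_distrib_right_dim
  mat_smult_left_dim mat_smult_right_dim mat_mult_one_dim mat_mult_zero_dim mat_add_zero_dim

text \<open>Products are normalised to the right, so a known product \<open>A * B = C\<close> no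
  longer occurs as a subterm of \<open>A * (B * Z)\<close>; this is the form in which it can still
  be used.\<close>

lemma mat_mult_cancel_dim:
  "A * B = C \<Longrightarrow> dim_col A = dim_row B \<Longrightarrow> dim_col B = dim_row Z
    \<Longrightarrow> A * (B * Z) = C * (Z :: 'a :: semiring_0 mat)"
  by (auto simp: mat_mult_assoc_dim[symmetric])

text \<open>The diagonal entries of the Gram matrix are the squared norms of the columns.\<close>

lemma mat_adjoint_mult_self_eq_zero:
  assumes "A\<^sup>\<dagger> * A = 0\<^sub>m (dim_col A) (dim_col A)"
  shows "(A :: complex mat) = 0\<^sub>m (dim_row A) (dim_col A)"
proof (rule eq_matI)
  fix i j assume ij: "i < dim_row (0\<^sub>m (dim_row A) (dim_col A) :: complex mat)"
    "j < dim_col (0\<^sub>m (dim_row A) (dim_col A) :: complex mat)"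
  have "(A\<^sup>\<dagger> * A) $$ (j, j) = 0"
    using assms ij by simp
  moreover have "(A\<^sup>\<dagger> * A) $$ (j, j) = of_real (\<Sum>l<dim_row A. (cmod (A $$ (l, j)))\<^sup>2)"
    using ij by (auto simp: scalar_prod_def complex_norm_square lessThan_atLeast0 mult.commute
        simp del: of_real_power intro!: sum.cong)
  ultimately have "(\<Sum>l<dim_row A. (cmod (A $$ (l, j)))\<^sup>2) = 0"
    using of_real_eq_0_iff by metis
  then have "(cmod (A $$ (i, j)))\<^sup>2 = 0"
    using ij by (subst (asm) sum_nonneg_eq_0_iff) auto
  with ij show "A $$ (i, j) = 0\<^sub>m (dim_row A) (dim_col A) $$ (i, j)" by simp
qed auto

text \<open>Vectors are treated as one-column matrices, so that inner products, rank-one operators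
  and the action of an operator are all matrix products. This map and \<open>col _ 0\<close> are the
  bridge to the vectors of the definitions.\<close>

definition col_mat :: "'a vec \<Rightarrow> 'a mat" where
  "col_mat v = mat (dim_vec v) 1 (\<lambda>(i, _). v $ i)"

lemma dim_col_mat [simp]: "dim_row (col_mat v) = dim_vec v" "dim_col (col_mat v) = 1"
  by (auto simp: col_mat_def)

lemma col_mat_mult: "dim_col A = dim_vec v \<Longrightarrow> A * col_mat v = col_mat (A *\<^sub>v v)"
  by (rule eq_matI) (auto simp: col_mat_def scalar_prod_def)

lemma col_mat_col [simp]: "A \<in> carrier_mat n 1 \<Longrightarrow> col_mat (col A 0) = A"
  by (rule eq_matI) (auto simp: col_mat_def)

lemma col_col_mat [simp]: "col (col_mat v) 0 = v"
  by (rule eq_vecI) (auto simp: col_mat_def)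

text \<open>Padding with zero rows makes the matrix square and singular without changing its
  kernel.\<close>

lemma wide_matrix_kernel:
  fixes A :: "complex mat"
  assumes A: "A \<in> carrier_mat m d" and md: "m < d"
  obtains v where "v \<in> carrier_mat d 1" "v \<noteq> 0\<^sub>m d 1" "A * v = 0\<^sub>m m 1"
proof -
  define B where "B = mat d d (\<lambda>(i, j). if i < m then A $$ (i, j) else 0)"
  have B: "B \<in> carrier_mat d d" by (simp add: B_def)
  \<comment> \<open>Row \<open>m\<close> of \<open>B\<close> is one of the added zero rows, so the
    equation changes nothing; it only shows a zero row explicitly to the determinant rule.\<close>
  have "B = mat\<^sub>r d d (\<lambda>i. if i = m then 0\<^sub>v d else row B i)"
    by (rule eq_matI) (use md in \<open>auto simp: B_def  \<close>)
  moreover have "det \<dots> = 0"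
    using md B by (intro det_row_0) auto
  ultimately have "det B = 0" by simp
  then obtain v where v: "v \<in> carrier_vec d" "v \<noteq> 0\<^sub>v d" "B *\<^sub>v v = 0\<^sub>v d"
    using det_0_iff_vec_prod_zero[OF B] by auto
  have "A *\<^sub>v v = 0\<^sub>v m"
  proof (rule eq_vecI)
    fix i assume i: "i < dim_vec (0\<^sub>v m :: complex vec)"
    have "row A i = row B i"
      using i A md by (intro eq_vecI) (auto simp: B_def)
    with i md have "(A *\<^sub>v v) $ i = (B *\<^sub>v v) $ i"
      using A B by auto
    then show "(A *\<^sub>v v) $ i = 0\<^sub>v m $ i"
      using v i md by simp
  qed (use A in auto)
  then show ?thesis
    using v A by (intro that[of "col_mat v"])
     (auto simp: col_mat_mult, auto simp: col_mat_def mat_eq_iff vec_eq_iff)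
qed

section \<open>Isometries, orthogonal complements and orthonormal bases of subspaces\<close>

definition isometry :: "nat \<Rightarrow> nat \<Rightarrow> complex mat \<Rightarrow> bool" where
  "isometry n k X \<longleftrightarrow> X \<in> carrier_mat n k \<and> X\<^sup>\<dagger> * X = 1\<^sub>m k"

lemma isometry_le: "isometry n k X \<Longrightarrow> k \<le> n"
proof (rule ccontr)
  assume X: "isometry n k X" and "\<not> k \<le> n"
  then obtain v where v: "v \<in> carrier_mat k 1" "v \<noteq> 0\<^sub>m k 1" "X * v = 0\<^sub>m n 1"
    using wide_matrix_kernel[of X n k] by (auto simp: isometry_def)
  have "X\<^sup>\<dagger> * (X * v) = v"
    using X v by (subst mat_mult_cancel_dim[of _ _ "1\<^sub>m k"]) (auto simp: isometry_def)
  with v X show False by (auto simp: isometry_def)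
qed

lemma isometry_square: "isometry n n X \<Longrightarrow> unitary_mat n X"
  unfolding isometry_def unitary_mat_def
  using mat_mult_left_right_inverse[of "X\<^sup>\<dagger>" n X] by auto

text \<open>Schur's lemma supplies the scalar only as a complex number. Its value is the squared
  norm of column 0, hence real and positive for a nonzero \<open>X\<close>, and dividing by its
  square root normalises \<open>X\<close>.\<close>

lemma isometry_of_scalar_gram:
  assumes X: "X \<in> carrier_mat n d" "X \<noteq> 0\<^sub>m n d" and eq: "X\<^sup>\<dagger> * X = k \<cdot>\<^sub>m 1\<^sub>m d" and d: "d > 0"
  obtains a where "isometry n d (a \<cdot>\<^sub>m X)"
proof -
  define s where "s = (\<Sum>l<n. (cmod (X $$ (l, 0)))\<^sup>2)"
  have "(X\<^sup>\<dagger> * X) $$ (0, 0) = complex_of_real s"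
    using X d by (auto simp: s_def scalar_prod_def complex_norm_square
        lessThan_atLeast0 mult.commute simp del: of_real_power intro!: sum.cong)
  then have k: "k = complex_of_real s"
    using d by (simp add: eq)
  have "k \<noteq> 0"
    using mat_adjoint_mult_self_eq_zero[of X] X eq by (auto simp: mat_zero_smult)
  moreover have "s \<ge> 0"
    by (auto simp: s_def intro!: sum_nonneg)
  ultimately have s: "s > 0" using k by (auto simp: less_le)
  have "complex_of_real (1 / sqrt s) * complex_of_real (1 / sqrt s) * complex_of_real s = 1"
    using s unfolding of_real_mult[symmetric] by (simp add: field_simps)
  then have "isometry n d (complex_of_real (1 / sqrt s) \<cdot>\<^sub>m X)"
    using X by (auto simp: isometry_def mat_smult_left_dim mat_smult_right_dim eq k)
  then show ?thesis by (rule that)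
qed

lemma normalize_column:
  assumes w: "w \<in> carrier_mat n 1" "w \<noteq> 0\<^sub>m n 1"
  obtains k where "isometry n 1 (k \<cdot>\<^sub>m w)"
proof -
  have gram: "w\<^sup>\<dagger> * w = (w\<^sup>\<dagger> * w) $$ (0, 0) \<cdot>\<^sub>m 1\<^sub>m 1"
    using w by (intro eq_matI) auto
  show ?thesis
    by (rule isometry_of_scalar_gram[OF w gram]) (simp, rule that)
qed

text \<open>With \<open>inj2\<close>, the two inclusions into an orthogonal direct sum. Their Gram
  identities and the completeness relation below replace index computations with block
  matrices.\<close>

definition inj1 :: "nat \<Rightarrow> nat \<Rightarrow> complex mat" where
  "inj1 k l = mat (k + l) k (\<lambda>(i, j). if i = j then 1 else 0)"

definition inj2 :: "nat \<Rightarrow> nat \<Rightarrow> complex mat" where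
  "inj2 k l = mat (k + l) l (\<lambda>(i, j). if i = j + k then 1 else 0)"

lemma dim_inj [simp]:
  "dim_row (inj1 k l) = k + l" "dim_col (inj1 k l) = k"
  "dim_row (inj2 k l) = k + l" "dim_col (inj2 k l) = l"
  by (auto simp: inj1_def inj2_def)

lemma mult_inj:
  assumes "D \<in> carrier_mat m (k + l)"
  shows "D * inj1 k l = mat m k (\<lambda>(i, j). D $$ (i, j))"
    and "D * inj2 k l = mat m l (\<lambda>(i, j). D $$ (i, j + k))"
  using assms by (auto intro!: eq_matI simp: inj1_def inj2_def scalar_prod_def if_distrib cong: if_cong)

lemma inj_mult:
  shows "A \<in> carrier_mat k m \<Longrightarrow> inj1 k l * A = mat (k + l) m (\<lambda>(i, j). if i < k then A $$ (i, j) else 0)"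
    and "B \<in> carrier_mat l m \<Longrightarrow> inj2 k l * B = mat (k + l) m (\<lambda>(i, j). if i < k then 0 else B $$ (i - k, j))"
proof -
  show "inj1 k l * A = mat (k + l) m (\<lambda>(i, j). if i < k then A $$ (i, j) else 0)"
    if "A \<in> carrier_mat k m"
    using that
    by (auto intro!: eq_matI simp: inj1_def scalar_prod_def if_distrib if_distribR cong: if_cong)
  have "(\<Sum>x = 0..<l. (if i = x + k then 1 else 0) * B $$ (x, j))
      = (if i < k then 0 else B $$ (i - k, j))" if "i < k + l" for i j
  proof (cases "i < k")
    case False
    then have "(\<Sum>x = 0..<l. (if i = x + k then 1 else 0) * B $$ (x, j))
      = (\<Sum>x = 0..<l. if x = i - k then B $$ (x, j) else 0)"
      by (intro sum.cong) auto
    with that False show ?thesis by auto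
  qed auto
  then show "inj2 k l * B = mat (k + l) m (\<lambda>(i, j). if i < k then 0 else B $$ (i - k, j))"
    if "B \<in> carrier_mat l m"
    using that by (auto intro!: eq_matI simp: inj2_def scalar_prod_def)
qed

lemma inj_adjoint_mult [simp]:
  "(inj1 k l)\<^sup>\<dagger> * inj1 k l = 1\<^sub>m k" "(inj2 k l)\<^sup>\<dagger> * inj2 k l = 1\<^sub>m l"
  "(inj1 k l)\<^sup>\<dagger> * inj2 k l = 0\<^sub>m k l" "(inj2 k l)\<^sup>\<dagger> * inj1 k l = 0\<^sub>m l k"
  by (subst mult_inj[where m = k] mult_inj[where m = l], force,
      force intro!: eq_matI simp: inj1_def inj2_def)+

lemma inj_complete: "inj1 k l * (inj1 k l)\<^sup>\<dagger> + inj2 k l * (inj2 k l)\<^sup>\<dagger> = 1\<^sub>m (k + l)"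
  by (subst inj_mult[where m = "k + l"], force,
      subst inj_mult[where m = "k + l"], force,
      rule eq_matI) (auto simp: inj1_def inj2_def)

lemma inj_adjoint_mult_assoc [simp]:
  "dim_row Z = k \<Longrightarrow> (inj1 k l)\<^sup>\<dagger> * (inj1 k l * Z) = Z"
  "dim_row Z = l \<Longrightarrow> (inj2 k l)\<^sup>\<dagger> * (inj2 k l * Z) = Z"
  "dim_row Z = l \<Longrightarrow> (inj1 k l)\<^sup>\<dagger> * (inj2 k l * Z) = 0\<^sub>m k (dim_col Z)"
  "dim_row Z = k \<Longrightarrow> (inj2 k l)\<^sup>\<dagger> * (inj1 k l * Z) = 0\<^sub>m l (dim_col Z)"
  by (simp_all add: mat_mult_assoc_dim[symmetric])

lemma isometry_inj [simp]: "isometry (k + l) k (inj1 k l)" "isometry (k + l) l (inj2 k l)"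
  by (auto simp: isometry_def intro!: carrier_matI)

lemma isometry_mult: "isometry m n X \<Longrightarrow> isometry n k Y \<Longrightarrow> isometry m k (X * Y)"
  by (auto simp: isometry_def mat_mult_assoc_dim mat_mult_cancel_dim[of _ _ "1\<^sub>m n"])

text \<open>The matrix is the block row with blocks \<open>X\<close> and \<open>Y\<close>;
  orthogonality of the ranges removes the off-diagonal blocks of its Gram matrix.\<close>

lemma isometry_append:
  assumes "isometry n k X" "isometry n l Y" "X\<^sup>\<dagger> * Y = 0\<^sub>m k l"
  shows "isometry n (k + l) (X * (inj1 k l)\<^sup>\<dagger> + Y * (inj2 k l)\<^sup>\<dagger>)"
proof -
  have [simp]: "dim_row X = n" "dim_col X = k" "dim_row Y = n" "dim_col Y = l"
    and XX: "X\<^sup>\<dagger> * X = 1\<^sub>m k" and YY: "Y\<^sup>\<dagger> * Y = 1\<^sub>m l"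
    using assms by (auto simp: isometry_def)
  have "(X\<^sup>\<dagger> * Y)\<^sup>\<dagger> = 0\<^sub>m l k"
    using assms(3) by simp
  then have YX: "Y\<^sup>\<dagger> * X = 0\<^sub>m l k"
    by simp
  note cancel = mat_mult_cancel_dim[OF XX] mat_mult_cancel_dim[OF YY]
    mat_mult_cancel_dim[OF YX] mat_mult_cancel_dim[OF assms(3)]
  show ?thesis
    by (auto simp: isometry_def mat_dim_simps cancel inj_complete intro!: carrier_matI)
qed

text \<open>An orthonormal family is completed one vector at a time: while \<open>k < n\<close>, the
  wide matrix \<open>X\<^sup>\<dagger>\<close> has a nonzero kernel vector, which is orthogonal to
  the range of \<open>X\<close>.\<close>

lemma isometry_complement:
  assumes "isometry n k X"
  obtains Y where "isometry n (n - k) Y" "X\<^sup>\<dagger> * Y = 0\<^sub>m k (n - k)"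
proof -
  have "\<exists>Y. isometry n (n - k) Y \<and> X\<^sup>\<dagger> * Y = 0\<^sub>m k (n - k)"
    using assms
  proof (induction "n - k" arbitrary: k X)
    case 0
    then show ?case
      by (intro exI[of _ "0\<^sub>m n 0"]) (auto simp: isometry_def intro!: eq_matI)
  next
    case (Suc l)
    have [simp]: "dim_row X = n" "dim_col X = k" and kn: "k < n" and l: "l = n - (k + 1)"
      using Suc by (auto simp: isometry_def)
    obtain v where v: "v \<in> carrier_mat n 1" "v \<noteq> 0\<^sub>m n 1" "X\<^sup>\<dagger> * v = 0\<^sub>m k 1"
      by (rule wide_matrix_kernel[OF carrier_matI kn, of "X\<^sup>\<dagger>"]) auto
    obtain a where y: "isometry n 1 (a \<cdot>\<^sub>m v)"
      using normalize_column v by metis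
    define y where "y = a \<cdot>\<^sub>m v"
    have yd[simp]: "dim_row y = n" "dim_col y = 1" and Xy: "X\<^sup>\<dagger> * y = 0\<^sub>m k 1"
      and yi: "isometry n 1 y"
      using v y by (auto simp: y_def mat_dim_simps)
    define X' where "X' = X * (inj1 k 1)\<^sup>\<dagger> + y * (inj2 k 1)\<^sup>\<dagger>"
    have X': "isometry n (k + 1) X'"
      unfolding X'_def using Suc.prems yi Xy by (rule isometry_append)
    then obtain Y where Y: "isometry n l Y" "X'\<^sup>\<dagger> * Y = 0\<^sub>m (k + 1) l"
      using Suc(1)[of "k + 1" X'] l by auto
    have [simp]: "dim_row Y = n" "dim_col Y = l"
      using Y by (auto simp: isometry_def)
    have "X = X' * inj1 k 1" "y = X' * inj2 k 1"
      by (auto simp: X'_def mat_dim_simps)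
    then have XY: "X\<^sup>\<dagger> * Y = 0\<^sub>m k l" and yY: "y\<^sup>\<dagger> * Y = 0\<^sub>m 1 l"
      using X' Y by (auto simp: mat_dim_simps isometry_def)
    \<comment> \<open>A complement of \<open>X\<close> consists of the new vector \<open>y\<close>
      followed by a complement of the extended family.\<close>
    have "isometry n (1 + l) (y * (inj1 1 l)\<^sup>\<dagger> + Y * (inj2 1 l)\<^sup>\<dagger>)"
      using yi Y(1) yY by (rule isometry_append)
    moreover have "X\<^sup>\<dagger> * (y * (inj1 1 l)\<^sup>\<dagger> + Y * (inj2 1 l)\<^sup>\<dagger>) = 0\<^sub>m k (1 + l)"
      by (auto simp: mat_dim_simps mat_mult_cancel_dim[OF Xy] mat_mult_cancel_dim[OF XY])
    moreover have "1 + l = n - k"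
      using Suc by auto
    ultimately show ?case by metis
  qed
  with that show ?thesis by blast
qed

text \<open>Provides an orthonormal basis of a subspace, as the columns of an isometry into
  \<open>W\<close> of greatest rank. A vector of \<open>W\<close> not fixed by the projection
  \<open>X * X\<^sup>\<dagger>\<close> would have a nonzero residual in \<open>W\<close> orthogonal
  to \<open>X\<close>, and adjoining it would raise the rank.\<close>

lemma subspace_range_isometry:
  assumes W: "W \<subseteq> carrier_mat n 1"
    and add: "\<And>v w. v \<in> W \<Longrightarrow> w \<in> W \<Longrightarrow> v + w \<in> W"
    and smult: "\<And>k v. v \<in> W \<Longrightarrow> k \<cdot>\<^sub>m v \<in> W"
    and zero: "0\<^sub>m n 1 \<in> W"
  obtains k X where "isometry n k X" "\<And>v. v \<in> carrier_mat k 1 \<Longrightarrow> X * v \<in> W"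
    "\<And>v. v \<in> W \<Longrightarrow> X * (X\<^sup>\<dagger> * v) = v"
proof -
  define P where "P k \<longleftrightarrow> (\<exists>X. isometry n k X \<and> (\<forall>v\<in>carrier_mat k 1. X * v \<in> W))" for k
  have "0\<^sub>m n 0 * v = 0\<^sub>m n 1" if "v \<in> carrier_mat 0 1" for v :: "complex mat"
    using that by auto
  then have "P 0"
    using zero unfolding P_def
    by (intro exI[of _ "0\<^sub>m n 0"]) (auto simp: isometry_def intro!: eq_matI)
  moreover have bound: "\<forall>k. P k \<longrightarrow> k \<le> n"
    using isometry_le by (auto simp: P_def)
  ultimately have PG: "P (Greatest P)" and max: "\<And>k. P k \<Longrightarrow> k \<le> Greatest P"
    using GreatestI_nat[of P 0 n] Greatest_le_nat[of P _ n] by auto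
  define k where "k = Greatest P"
  obtain X where X: "isometry n k X" and XW: "\<And>v. v \<in> carrier_mat k 1 \<Longrightarrow> X * v \<in> W"
    using PG by (auto simp: P_def k_def)
  have [simp]: "dim_row X = n" "dim_col X = k" and XX: "X\<^sup>\<dagger> * X = 1\<^sub>m k"
    using X by (auto simp: isometry_def)
  have "X * (X\<^sup>\<dagger> * v) = v" if v: "v \<in> W" for v
  proof (rule ccontr)
    have [simp]: "dim_row v = n" "dim_col v = 1"
      using v W by auto
    define w where "w = v + (-1) \<cdot>\<^sub>m (X * (X\<^sup>\<dagger> * v))"
    have wW: "w \<in> W"
      unfolding w_def using v by (intro add smult XW) auto
    have [simp]: "dim_row w = n" "dim_col w = 1"
      using wW W by auto
    have Xw: "X\<^sup>\<dagger> * w = 0\<^sub>m k 1"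
      by (auto simp: w_def mat_dim_simps mat_mult_cancel_dim[OF XX] intro!: eq_matI)
    assume "X * (X\<^sup>\<dagger> * v) \<noteq> v"
    moreover have "X * (X\<^sup>\<dagger> * v) = v" if "w = 0\<^sub>m n 1"
      using that by (auto simp: w_def mat_eq_iff)
    ultimately have "w \<noteq> 0\<^sub>m n 1" by auto
    then obtain a where a: "isometry n 1 (a \<cdot>\<^sub>m w)"
      by (metis normalize_column carrier_matI \<open>dim_row w = n\<close> \<open>dim_col w = 1\<close>)
    have "isometry n (k + 1) (X * (inj1 k 1)\<^sup>\<dagger> + (a \<cdot>\<^sub>m w) * (inj2 k 1)\<^sup>\<dagger>)" (is "isometry _ _ ?X")
      by (rule isometry_append[OF X a]) (auto simp: mat_dim_simps Xw)
    moreover have "?X * u \<in> W" if u: "u \<in> carrier_mat (k + 1) 1" for u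
    proof -
      \<comment> \<open>The last coordinate of \<open>u\<close> is a matrix of size one by one; it
        has to be turned into a scalar before closure of \<open>W\<close> under scalar multiples
        applies.\<close>
      define b where "b = ((inj2 k 1)\<^sup>\<dagger> * u) $$ (0, 0)"
      have b: "(inj2 k 1)\<^sup>\<dagger> * u = b \<cdot>\<^sub>m 1\<^sub>m 1"
        using u by (auto intro!: eq_matI simp: b_def)
      have "?X * u = X * ((inj1 k 1)\<^sup>\<dagger> * u) + (a * b) \<cdot>\<^sub>m w"
        using u by (auto simp: mat_dim_simps b simp del: One_nat_def)
      then show ?thesis
        using u by (auto intro!: add XW smult wW)
    qed
    ultimately have "P (k + 1)"
      unfolding P_def by blast
    with max[of "k + 1"] show False
      by (simp add: k_def)
  qed
  with X XW show ?thesis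
    by (rule that)
qed

section \<open>Intertwiners and complete reducibility\<close>

definition rep_carrier :: "('g, 'x) monoid_scheme \<Rightarrow> nat \<Rightarrow> ('g \<Rightarrow> complex mat) \<Rightarrow> bool" where
  "rep_carrier G n V \<longleftrightarrow> (\<forall>g \<in> carrier G. V g \<in> carrier_mat n n)"

definition intertwiner :: "('g, 'x) monoid_scheme \<Rightarrow> nat \<Rightarrow> ('g \<Rightarrow> complex mat) \<Rightarrow> nat
    \<Rightarrow> ('g \<Rightarrow> complex mat) \<Rightarrow> complex mat \<Rightarrow> bool" where
  "intertwiner G d S n V X \<longleftrightarrow> rep_carrier G d S \<and> rep_carrier G n V \<and>
     X \<in> carrier_mat n d \<and> (\<forall>g \<in> carrier G. V g * X = X * S g)"

text \<open>Being unitarily equivalent to a subrepresentation. For equal dimensions this is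
  \<open>equivalent_rep\<close>, and unlike that relation it composes across dimensions.\<close>

definition embeds :: "('g, 'x) monoid_scheme \<Rightarrow> nat \<Rightarrow> ('g \<Rightarrow> complex mat) \<Rightarrow> nat
    \<Rightarrow> ('g \<Rightarrow> complex mat) \<Rightarrow> bool" where
  "embeds G d S n V \<longleftrightarrow> (\<exists>J. isometry n d J \<and> intertwiner G d S n V J)"

lemma rep_carrier_dim:
  assumes "rep_carrier G n V" "g \<in> carrier G"
  shows "dim_row (V g) = n" "dim_col (V g) = n"
  using assms by (auto simp: rep_carrier_def)

lemma proj_rep_carrier: "proj_rep G c n U \<Longrightarrow> rep_carrier G n U"
  by (auto simp: proj_rep_def rep_carrier_def unitary_mat_def)

lemma intertwiner_carrier:
  assumes "intertwiner G d S n V X"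
  shows "X \<in> carrier_mat n d" "dim_row X = n" "dim_col X = d" "rep_carrier G d S" "rep_carrier G n V"
  using assms by (auto simp: intertwiner_def)

lemma intertwinerD: "intertwiner G d S n V X \<Longrightarrow> g \<in> carrier G \<Longrightarrow> V g * X = X * S g"
  by (auto simp: intertwiner_def)

lemma intertwiner_mult:
  assumes X: "intertwiner G d S n V X" and Y: "intertwiner G e T d S Y"
  shows "intertwiner G e T n V (X * Y)"
proof -
  have "V g * (X * Y) = X * Y * T g" if g: "g \<in> carrier G" for g
  proof -
    note dims = intertwiner_carrier(2,3)[OF X] intertwiner_carrier(2,3)[OF Y]
      rep_carrier_dim[OF intertwiner_carrier(4)[OF X] g] rep_carrier_dim[OF intertwiner_carrier(5)[OF X] g]
      rep_carrier_dim[OF intertwiner_carrier(4)[OF Y] g]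
    show ?thesis
      using intertwinerD[OF X g] intertwinerD[OF Y g]
      by (simp add: mat_mult_cancel_dim[of "V g" X "X * S g"] mat_mult_assoc_dim dims)
  qed
  with X Y show ?thesis
    by (auto simp: intertwiner_def)
qed

lemma intertwinerI:
  assumes "rep_carrier G d S" "rep_carrier G n V" "X \<in> carrier_mat n d"
    and "\<And>g. g \<in> carrier G \<Longrightarrow> dim_row (V g) = n \<Longrightarrow> dim_col (V g) = n \<Longrightarrow> dim_row (S g) = d
      \<Longrightarrow> dim_col (S g) = d \<Longrightarrow> V g * X = X * S g"
  shows "intertwiner G d S n V X"
  unfolding intertwiner_def using assms rep_carrier_dim[OF assms(1)] rep_carrier_dim[OF assms(2)]
  by blast

lemma intertwiner_add:
  assumes X: "intertwiner G d S n V X" and Y: "intertwiner G d S n V Y"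
  shows "intertwiner G d S n V (X + Y)"
  using intertwiner_carrier[OF X] intertwiner_carrier[OF Y] intertwinerD[OF X] intertwinerD[OF Y]
  by (intro intertwinerI) (simp_all add: mat_dim_simps)

lemma intertwiner_smult:
  assumes X: "intertwiner G d S n V X"
  shows "intertwiner G d S n V (k \<cdot>\<^sub>m X)"
  using intertwiner_carrier[OF X] intertwinerD[OF X]
  by (intro intertwinerI) (simp_all add: mat_dim_simps)

lemma intertwiner_one: "rep_carrier G n V \<Longrightarrow> intertwiner G n V n V (1\<^sub>m n)"
  by (rule intertwinerI) (simp_all add: mat_dim_simps)

lemma intertwiner_zero: "rep_carrier G d S \<Longrightarrow> rep_carrier G n V \<Longrightarrow> intertwiner G d S n V (0\<^sub>m n d)"
  by (rule intertwinerI) (simp_all add: mat_dim_simps)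

lemma unitary_mat_simps:
  assumes "unitary_mat n A"
  shows "A \<in> carrier_mat n n" "dim_row A = n" "dim_col A = n" "A\<^sup>\<dagger> * A = 1\<^sub>m n" "A * A\<^sup>\<dagger> = 1\<^sub>m n"
    "dim_row Z = n \<Longrightarrow> A\<^sup>\<dagger> * (A * Z) = Z" "dim_row Z = n \<Longrightarrow> A * (A\<^sup>\<dagger> * Z) = Z"
  using assms by (auto simp: unitary_mat_def mat_mult_cancel_dim[of _ _ "1\<^sub>m n"])

text \<open>Multiplying \<open>V g * X = X * S g\<close> by the inverses, which are the adjoints,
  and taking adjoints reverses the arrow. This takes the place of Maschke's averaging: it makes
  orthogonal complements of subrepresentations invariant.\<close>

lemma intertwiner_adjoint:
  assumes X: "intertwiner G d S n V X"
    and S: "\<And>g. g \<in> carrier G \<Longrightarrow> unitary_mat d (S g)"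
    and V: "\<And>g. g \<in> carrier G \<Longrightarrow> unitary_mat n (V g)"
  shows "intertwiner G n V d S (X\<^sup>\<dagger>)"
proof -
  have "S g * X\<^sup>\<dagger> = X\<^sup>\<dagger> * V g" if g: "g \<in> carrier G" for g
  proof -
    note s = intertwiner_carrier(2,3)[OF X] unitary_mat_simps[OF S[OF g]] unitary_mat_simps[OF V[OF g]]
    have "X * (S g)\<^sup>\<dagger> = (V g)\<^sup>\<dagger> * ((V g * X) * (S g)\<^sup>\<dagger>)"
      by (simp add: mat_mult_assoc_dim s)
    also have "\<dots> = (V g)\<^sup>\<dagger> * X"
      by (simp add: mat_mult_assoc_dim s intertwinerD[OF X g] mat_mult_one_dim)
    finally have "(X * (S g)\<^sup>\<dagger>)\<^sup>\<dagger> = ((V g)\<^sup>\<dagger> * X)\<^sup>\<dagger>"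
      by simp
    then show ?thesis
      by (simp add: s)
  qed
  with X show ?thesis
    by (auto simp: intertwiner_def)
qed

text \<open>Here the unitarity sits in \<open>W\<close> rather than in the families, as is the case
  in \<open>equivalent_rep\<close>.\<close>

lemma intertwiner_unitary_inverse:
  assumes W: "unitary_mat n W" and X: "intertwiner G n S n T W"
  shows "intertwiner G n T n S (W\<^sup>\<dagger>)"
proof (rule intertwinerI)
  note s = unitary_mat_simps[OF W]
  show "rep_carrier G n T" "rep_carrier G n S"
    using X by (rule intertwiner_carrier)+
  fix g assume g: "g \<in> carrier G" and d: "dim_row (S g) = n" "dim_col (S g) = n"
    "dim_row (T g) = n" "dim_col (T g) = n"
  have "S g * W\<^sup>\<dagger> = W\<^sup>\<dagger> * (W * S g) * W\<^sup>\<dagger>"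
    by (simp add: mat_mult_assoc_dim s d)
  then show "S g * W\<^sup>\<dagger> = W\<^sup>\<dagger> * T g"
    by (simp add: intertwinerD[OF X g, symmetric] mat_mult_assoc_dim s d mat_mult_one_dim)
qed (use unitary_mat_simps[OF W] in auto)

lemma embeds_trans: "embeds G d S n V \<Longrightarrow> embeds G e T d S \<Longrightarrow> embeds G e T n V"
  unfolding embeds_def using isometry_mult intertwiner_mult by blast

lemma embeds_refl: "rep_carrier G n V \<Longrightarrow> embeds G n V n V"
  unfolding embeds_def using intertwiner_one by (intro exI[of _ "1\<^sub>m n"]) (auto simp: isometry_def)

text \<open>The direct sum is described by its inclusions and projections being intertwiners, so
  that later arguments never inspect a block diagonal matrix.\<close>

definition is_direct_sum :: "('g, 'x) monoid_scheme \<Rightarrow> nat \<Rightarrow> ('g \<Rightarrow> complex mat) \<Rightarrow> nat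
    \<Rightarrow> ('g \<Rightarrow> complex mat) \<Rightarrow> ('g \<Rightarrow> complex mat) \<Rightarrow> bool" where
  "is_direct_sum G k S l T D \<longleftrightarrow>
     intertwiner G k S (k + l) D (inj1 k l) \<and> intertwiner G l T (k + l) D (inj2 k l) \<and>
     intertwiner G (k + l) D k S ((inj1 k l)\<^sup>\<dagger>) \<and> intertwiner G (k + l) D l T ((inj2 k l)\<^sup>\<dagger>)"

lemma direct_sum_rep_Cons:
  assumes S: "rep_carrier G k S" and T: "rep_carrier G l (direct_sum_rep Ss)"
  shows "is_direct_sum G k S l (direct_sum_rep Ss) (direct_sum_rep (S # Ss))"
proof -
  let ?D = "direct_sum_rep (S # Ss)"
  have D: "?D g \<in> carrier_mat (k + l) (k + l)" and
    D1: "?D g * inj1 k l = inj1 k l * S g" and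
    D2: "?D g * inj2 k l = inj2 k l * direct_sum_rep Ss g" and
    D3: "S g * (inj1 k l)\<^sup>\<dagger> = (inj1 k l)\<^sup>\<dagger> * ?D g" and
    D4: "direct_sum_rep Ss g * (inj2 k l)\<^sup>\<dagger> = (inj2 k l)\<^sup>\<dagger> * ?D g"
    if g: "g \<in> carrier G" for g
  proof -
    define A where "A = S g"
    define B where "B = direct_sum_rep Ss g"
    have c: "A \<in> carrier_mat k k" "B \<in> carrier_mat l l"
      using S T g by (auto simp: rep_carrier_def A_def B_def)
    have [simp]: "dim_row A = k" "dim_col A = k" "dim_row B = l" "dim_col B = l"
      using c by auto
    have Dg: "?D g = four_block_mat A (0\<^sub>m k l) (0\<^sub>m l k) B"
      using c by (auto simp: direct_sum_rep_def Let_def A_def B_def)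
    show D: "?D g \<in> carrier_mat (k + l) (k + l)"
      unfolding Dg using c by (intro four_block_carrier_mat)
    have [simp]: "dim_row (?D g) = k + l" "dim_col (?D g) = k + l"
      using D by auto
    show 1: "?D g * inj1 k l = inj1 k l * S g"
      unfolding A_def[symmetric]
      by (subst mult_inj[OF D], subst inj_mult[OF c(1)])
        (rule eq_matI; use c in \<open>auto simp: Dg\<close>)
    show 2: "?D g * inj2 k l = inj2 k l * direct_sum_rep Ss g"
      unfolding B_def[symmetric]
      by (subst mult_inj[OF D], subst inj_mult[OF c(2)])
        (rule eq_matI; use c in \<open>auto simp: Dg\<close>)
    \<comment> \<open>The relations for the projections follow from those for the inclusions by
      expanding the identity with \<open>inj_complete\<close>.\<close>
    have "?D g = ?D g * (inj1 k l * (inj1 k l)\<^sup>\<dagger> + inj2 k l * (inj2 k l)\<^sup>\<dagger>)"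
      by (simp add: inj_complete mat_mult_one_dim)
    also have "\<dots> = (?D g * inj1 k l) * (inj1 k l)\<^sup>\<dagger> + (?D g * inj2 k l) * (inj2 k l)\<^sup>\<dagger>"
      by (simp add: mat_dim_simps)
    also have "\<dots> = inj1 k l * (A * (inj1 k l)\<^sup>\<dagger>) + inj2 k l * (B * (inj2 k l)\<^sup>\<dagger>)"
      unfolding 1 2 A_def[symmetric] B_def[symmetric] by (simp add: mat_mult_assoc_dim)
    finally have *: "?D g = inj1 k l * (A * (inj1 k l)\<^sup>\<dagger>) + inj2 k l * (B * (inj2 k l)\<^sup>\<dagger>)" .
    show "S g * (inj1 k l)\<^sup>\<dagger> = (inj1 k l)\<^sup>\<dagger> * ?D g"
      unfolding * A_def[symmetric] by (simp add: mat_dim_simps)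
    show "direct_sum_rep Ss g * (inj2 k l)\<^sup>\<dagger> = (inj2 k l)\<^sup>\<dagger> * ?D g"
      unfolding * B_def[symmetric] by (simp add: mat_dim_simps)
  qed
  then show ?thesis
    using S T by (auto simp: is_direct_sum_def intertwiner_def rep_carrier_def intro!: carrier_matI)
qed

lemma direct_sum_intertwiner:
  assumes D: "is_direct_sum G k S l T D"
    and X: "intertwiner G k S n V X" and Y: "intertwiner G l T n V Y"
  shows "intertwiner G (k + l) D n V (X * (inj1 k l)\<^sup>\<dagger> + Y * (inj2 k l)\<^sup>\<dagger>)"
  using assms by (auto simp: is_direct_sum_def intro!: intertwiner_add intertwiner_mult)

lemma embeds_direct_sum:
  assumes D: "is_direct_sum G k S l T D"
    and X: "intertwiner G k S n V X" "isometry n k X" and Y: "intertwiner G l T n V Y" "isometry n l Y"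
    and XY: "X\<^sup>\<dagger> * Y = 0\<^sub>m k l"
  shows "embeds G (k + l) D n V"
  unfolding embeds_def using direct_sum_intertwiner[OF D X(1) Y(1)] isometry_append[OF X(2) Y(2) XY]
  by blast

lemma equivalent_rep_embeds:
  assumes "equivalent_rep G n S T"
  shows "embeds G n S n T" "embeds G n T n S"
proof -
  obtain W where W: "unitary_mat n W" and WS: "\<And>g. g \<in> carrier G \<Longrightarrow> W * S g = T g * W"
    and c: "rep_carrier G n S" "rep_carrier G n T"
    using assms by (auto simp: equivalent_rep_def rep_carrier_def)
  note s = unitary_mat_simps[OF W]
  have 1: "intertwiner G n S n T W"
    using c s WS by (auto simp: intertwiner_def)
  have 2: "intertwiner G n T n S (W\<^sup>\<dagger>)"
    using W 1 by (rule intertwiner_unitary_inverse)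
  show "embeds G n S n T"
    unfolding embeds_def isometry_def using 1 s(1,4) by blast
  show "embeds G n T n S"
    unfolding embeds_def isometry_def using 2 s(1,5) by (intro exI[of _ "W\<^sup>\<dagger>"]) simp
qed

text \<open>A square isometry is unitary.\<close>

lemma embeds_imp_equivalent_rep:
  assumes "embeds G n S n T"
  shows "equivalent_rep G n S T"
proof -
  obtain J where J: "isometry n n J" "intertwiner G n S n T J"
    using assms by (auto simp: embeds_def)
  then show ?thesis
    using isometry_square[OF J(1)] unfolding equivalent_rep_def intertwiner_def rep_carrier_def
    by metis
qed

lemma equivalent_rep_sym: "equivalent_rep G n S T \<Longrightarrow> equivalent_rep G n T S"
  using equivalent_rep_embeds embeds_imp_equivalent_rep by blast

lemma equivalent_rep_trans:
  "equivalent_rep G n S T \<Longrightarrow> equivalent_rep G n T R \<Longrightarrow> equivalent_rep G n S R"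
  by (meson equivalent_rep_embeds(1) embeds_imp_equivalent_rep embeds_trans)

text \<open>The relation \<open>X\<^sup>\<dagger> * X = 1\<^sub>m k\<close> gives
  \<open>S g = X\<^sup>\<dagger> * (U g * X)\<close>. So the product rule, with the same factor set,
  is inherited, and comparing the Gram matrices of \<open>X * S g\<close> and \<open>U g * X\<close>
  shows that \<open>S g\<close> is unitary.\<close>

lemma subrep_proj_rep:
  assumes U: "proj_rep G c n U" and X: "isometry n k X"
    and S: "intertwiner G k S n U X" and G: "group G"
  shows "proj_rep G c k S"
proof -
  interpret group G by fact
  note Xd = intertwiner_carrier(2,3)[OF S]
  have XX: "X\<^sup>\<dagger> * X = 1\<^sub>m k"
    using X by (auto simp: isometry_def)
  note cancel = mat_mult_cancel_dim[OF XX]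
  have unitary: "unitary_mat n (U g)" if "g \<in> carrier G" for g
    using U that by (auto simp: proj_rep_def)
  have Seq: "S g = X\<^sup>\<dagger> * (U g * X)" if g: "g \<in> carrier G" for g
    using rep_carrier_dim[OF intertwiner_carrier(4)[OF S] g]
    by (simp add: intertwinerD[OF S g] cancel Xd mat_mult_one_dim)
  have "unitary_mat k (S g)" if g: "g \<in> carrier G" for g
  proof (rule isometry_square)
    note d = rep_carrier_dim[OF intertwiner_carrier(4)[OF S] g] Xd unitary_mat_simps[OF unitary[OF g]]
    have "(S g)\<^sup>\<dagger> * S g = (X * S g)\<^sup>\<dagger> * (X * S g)"
      by (simp add: d mat_mult_assoc_dim cancel mat_mult_one_dim)
    also have "\<dots> = (U g * X)\<^sup>\<dagger> * (U g * X)"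
      by (simp add: intertwinerD[OF S g])
    also have "\<dots> = 1\<^sub>m k"
      by (simp add: d mat_mult_assoc_dim XX)
    finally show "isometry k k (S g)"
      using d by (auto simp: isometry_def)
  qed
  moreover have "S g * S h = c g h \<cdot>\<^sub>m S (g \<otimes>\<^bsub>G\<^esub> h)"
    if g: "g \<in> carrier G" and h: "h \<in> carrier G" for g h
  proof -
    have gh: "g \<otimes>\<^bsub>G\<^esub> h \<in> carrier G" using g h by simp
    note d = rep_carrier_dim[OF intertwiner_carrier(4)[OF S] g]
      rep_carrier_dim[OF intertwiner_carrier(4)[OF S] h] Xd
      rep_carrier_dim[OF intertwiner_carrier(5)[OF S] g] 
      rep_carrier_dim[OF intertwiner_carrier(5)[OF S] h]
      rep_carrier_dim[OF intertwiner_carrier(5)[OF S] gh]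
    have "S g * S h = X\<^sup>\<dagger> * (U g * (X * S h))"
      by (simp add: Seq[OF g] mat_mult_assoc_dim d)
    also have "\<dots> = X\<^sup>\<dagger> * ((U g * U h) * X)"
      by (simp add: intertwinerD[OF S h, symmetric] mat_mult_assoc_dim d)
    also have "U g * U h = c g h \<cdot>\<^sub>m U (g \<otimes>\<^bsub>G\<^esub> h)"
      using U g h by (auto simp: proj_rep_def)
    also have "X\<^sup>\<dagger> * (\<dots> * X) = c g h \<cdot>\<^sub>m S (g \<otimes>\<^bsub>G\<^esub> h)"
      by (simp add: Seq[OF gh] mat_dim_simps d)
    finally show ?thesis .
  qed
  ultimately show ?thesis
    using U by (auto simp: proj_rep_def)
qed

section \<open>Invariant subspaces and splitting off irreducible subrepresentations\<close>

lemma mat_eq_by_columns: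
  fixes A :: "complex mat"
  assumes "A \<in> carrier_mat n m" "B \<in> carrier_mat n m"
    and eq: "\<And>v. v \<in> carrier_mat m 1 \<Longrightarrow> A * v = B * v"
  shows "A = B"
proof (rule eq_matI)
  fix i j assume ij: "i < dim_row B" "j < dim_col B"
  have "A *\<^sub>v unit_vec m j = B *\<^sub>v unit_vec m j"
    using eq[of "col_mat (unit_vec m j)"] assms(1,2)
    by (metis carrier_matD(2) carrier_matI col_col_mat col_mat_mult dim_col_mat index_unit_vec(3))
  then have "(A *\<^sub>v unit_vec m j) $ i = (B *\<^sub>v unit_vec m j) $ i" by simp
  then show "A $$ (i, j) = B $$ (i, j)"
    using ij assms(1,2) by simp
qed (use assms in auto)

text \<open>Unfolds the module-theoretic notion of the definitions into closure conditions that can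
  be checked on vectors.\<close>

lemma subspace_module_vec:
  "VectorSpace.subspace class_ring W (module_vec TYPE(complex) n) \<longleftrightarrow>
     W \<subseteq> carrier_vec n \<and> 0\<^sub>v n \<in> W \<and> (\<forall>v\<in>W. \<forall>w\<in>W. v + w \<in> W) \<and> (\<forall>k. \<forall>v\<in>W. k \<cdot>\<^sub>v v \<in> W)"
proof -
  interpret vec_space "TYPE(complex)" n .
  show ?thesis
    using vectorspace_axioms module_axioms
    by (auto simp: VectorSpace.subspace_def submodule_def module_vec_simps)
qed

text \<open>An invariant isometry of minimal positive rank has irreducible image; splitting it off reduces
  the dimension.\<close>

lemma irreducible_subrep_exists:
  assumes G: "group G" and U: "proj_rep G c n U" and n: "n > 0"
  obtains k S X where "irreducible_rep G c k S" "isometry n k X" "intertwiner G k S n U X"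
proof -
  define P where "P k \<longleftrightarrow> k > 0 \<and> (\<exists>S X. isometry n k X \<and> intertwiner G k S n U X)" for k
  have "P n"
    using n intertwiner_one[OF proj_rep_carrier[OF U]] unfolding P_def
    by (intro conjI exI[of _ U] exI[of _ "1\<^sub>m n"]) (auto simp: isometry_def)
  then have PL: "P (Least P)" and min: "\<And>k. P k \<Longrightarrow> Least P \<le> k"
    by (auto intro: LeastI Least_le)
  define k where "k = Least P"
  obtain S X where k: "k > 0" and X: "isometry n k X" and S: "intertwiner G k S n U X"
    using PL by (auto simp: P_def k_def)
  have Sc: "rep_carrier G k S"
    using S by (rule intertwiner_carrier)
  have "W = carrier_vec k"
    if sub: "VectorSpace.subspace class_ring W (module_vec TYPE(complex) k)"
      and inv: "\<forall>g \<in> carrier G. \<forall>v \<in> W. S g *\<^sub>v v \<in> W" and W0: "W \<noteq> {0\<^sub>v k}" for W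
  proof -
    have W: "W \<subseteq> carrier_vec k" "0\<^sub>v k \<in> W" "\<And>v w. v \<in> W \<Longrightarrow> w \<in> W \<Longrightarrow> v + w \<in> W"
      "\<And>a v. v \<in> W \<Longrightarrow> a \<cdot>\<^sub>v v \<in> W"
      using sub unfolding subspace_module_vec by auto
    define M where "M = {v \<in> carrier_mat k 1. col v 0 \<in> W}"
    have M: "M \<subseteq> carrier_mat k 1" by (auto simp: M_def)
    obtain j Y where Y: "isometry k j Y" and YM: "\<And>v. v \<in> carrier_mat j 1 \<Longrightarrow> Y * v \<in> M"
      and MY: "\<And>v. v \<in> M \<Longrightarrow> Y * (Y\<^sup>\<dagger> * v) = v"
    proof (rule subspace_range_isometry[OF M])
      show "v + w \<in> M" if "v \<in> M" "w \<in> M" for v w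
        using that W(3) by (auto simp: M_def col_add)
      show "a \<cdot>\<^sub>m v \<in> M" if "v \<in> M" for a v
        using that W(4) by (auto simp: M_def)
      show "0\<^sub>m k 1 \<in> M"
        using W(2) by (auto simp: M_def)
    qed auto
    have [simp]: "dim_row Y = k" "dim_col Y = j"
      using Y by (auto simp: isometry_def)
    have "j > 0"
    proof (rule ccontr)
      assume "\<not> j > 0"
      then have "Y * A = 0\<^sub>m k 1" if "A \<in> carrier_mat j 1" for A
        using that by (intro eq_matI) (auto simp: scalar_prod_def)
      then have "v = 0\<^sub>m k 1" if "v \<in> M" for v
        using MY[OF that] that by (metis M \<open>dim_col Y = j\<close> \<open>dim_row Y = k\<close> carrier_matI
            carrier_matD dim_mat_adjoint(1) index_mult_mat(2) index_mult_mat(3) subsetD)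
      moreover obtain w where "w \<in> W" "w \<noteq> 0\<^sub>v k" using W0 W(2) by blast
      moreover have "col_mat w \<in> M"
        using \<open>w \<in> W\<close> W(1) by (auto simp: M_def intro!: carrier_matI)
      ultimately have "col_mat w = 0\<^sub>m k 1" by blast
      then have "w = col (0\<^sub>m k 1) 0"
        by (metis col_col_mat)
      with \<open>w \<noteq> 0\<^sub>v k\<close> show False by simp
    qed
    define T where "T g = Y\<^sup>\<dagger> * (S g * Y)" for g
    \<comment> \<open>On each column the range of \<open>Y\<close> lies in \<open>M\<close>,
      invariance keeps it there, and \<open>Y * Y\<^sup>\<dagger>\<close> is the identity on
      \<open>M\<close>.\<close>
    have "S g * Y = Y * T g" if g: "g \<in> carrier G" for g
    proof (rule mat_eq_by_columns)
      note d = rep_carrier_dim[OF Sc g]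
      show "S g * Y \<in> carrier_mat k j" "Y * T g \<in> carrier_mat k j"
        using d by (auto simp: T_def)
      fix v :: "complex mat" assume v: "v \<in> carrier_mat j 1"
      have "Y * v \<in> M" using YM v by auto
      moreover have "col (S g * (Y * v)) 0 = S g *\<^sub>v col (Y * v) 0"
        by (rule col_mult2[of _ k k _ 1]) (use d v in auto)
      moreover have "S g * (Y * v) \<in> carrier_mat k 1"
        using d v by auto
      ultimately have "S g * (Y * v) \<in> M"
        using inv g unfolding M_def by simp
      then have "Y * (Y\<^sup>\<dagger> * (S g * (Y * v))) = S g * (Y * v)"
        by (rule MY)
      then show "S g * Y * v = Y * T g * v"
        using v d by (simp add: T_def mat_mult_assoc_dim)
    qed
    then have T: "intertwiner G j T k S Y"
      using Sc by (auto simp: intertwiner_def rep_carrier_def T_def intro!: carrier_matI)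
    have "P j"
      unfolding P_def using \<open>j > 0\<close> isometry_mult[OF X Y] intertwiner_mult[OF S T] by blast
    \<comment> \<open>Minimality gives one inequality and the isometry \<open>Y\<close> the other; a
      square \<open>Y\<close> is surjective, so the invariant subspace is the whole space.\<close>
    then have "j = k"
      using min[of j] isometry_le[OF Y] by (auto simp: k_def)
    then have YY: "Y * Y\<^sup>\<dagger> = 1\<^sub>m k"
      using isometry_square[of k Y] Y by (auto simp: unitary_mat_def)
    have "v \<in> W" if v: "v \<in> carrier_vec k" for v
    proof -
      have "Y * (Y\<^sup>\<dagger> * col_mat v) \<in> M"
        using v by (intro YM) auto
      then have "col_mat v \<in> M"
        using v by (subst (asm) mat_mult_cancel_dim[OF YY]) (auto simp: mat_mult_one_dim)
      then show ?thesis
        by (auto simp: M_def)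
    qed
    with W(1) show ?thesis by auto
  qed
  then have "irreducible_rep G c k S"
    using subrep_proj_rep[OF U X S G] k by (auto simp: irreducible_rep_def)
  then show ?thesis using X S by (rule that)
qed

text \<open>Strong induction on the dimension: the orthogonal complement of an irreducible
  subrepresentation is again a subrepresentation, of smaller dimension because an irreducible one
  has positive dimension.\<close>

lemma irreducible_decomposition_exists:
  assumes G: "group G"
  shows "proj_rep G c n U \<Longrightarrow> \<exists>Ss. irreducible_decomposition G c n U Ss"
proof (induction n arbitrary: U rule: less_induct)
  case (less n)
  show ?case
  proof (cases "n = 0")
    case True
    have "\<forall>g\<in>carrier G. 1\<^sub>m 0 * direct_sum_rep [] g = U g * 1\<^sub>m 0"
      using proj_rep_carrier[OF less.prems] True
      by (auto simp: rep_carrier_def direct_sum_rep_def intro!: eq_matI)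
    then have "irreducible_decomposition G c n U []"
      using proj_rep_carrier[OF less.prems] True
      by (auto simp: irreducible_decomposition_def equivalent_rep_def rep_carrier_def
          unitary_mat_def direct_sum_rep_def intro!: exI[of _ "1\<^sub>m 0"])
    then show ?thesis by blast
  next
    case False
    obtain k S X where S: "irreducible_rep G c k S" and X: "isometry n k X"
      and XS: "intertwiner G k S n U X"
      using irreducible_subrep_exists[OF G less.prems] False by blast
    obtain Y where Y: "isometry n (n - k) Y" and XY: "X\<^sup>\<dagger> * Y = 0\<^sub>m k (n - k)"
      using isometry_complement[OF X] by blast
    have kn: "k + (n - k) = n"
      using isometry_le[OF X] by simp
    have Xd [simp]: "dim_row X = n" "dim_col X = k" "dim_row Y = n" "dim_col Y = n - k"
      using X Y by (auto simp: isometry_def)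
    have S_un: "\<And>g. g \<in> carrier G \<Longrightarrow> unitary_mat k (S g)"
      and U_un: "\<And>g. g \<in> carrier G \<Longrightarrow> unitary_mat n (U g)"
      using S less.prems by (auto simp: irreducible_rep_def proj_rep_def)
    define J where "J = X * (inj1 k (n - k))\<^sup>\<dagger> + Y * (inj2 k (n - k))\<^sup>\<dagger>"
    have "unitary_mat n J"
      using isometry_append[OF X Y XY] isometry_square kn by (simp add: J_def)
    \<comment> \<open>\<open>J\<close> is the block row of \<open>X\<close> and \<open>Y\<close>.
      Since it is unitary, the projections onto the two ranges add up to the identity.\<close>
    moreover have "J * J\<^sup>\<dagger> = X * X\<^sup>\<dagger> + Y * Y\<^sup>\<dagger>"
      by (simp add: J_def mat_dim_simps)
    ultimately have JJ: "X * X\<^sup>\<dagger> + Y * Y\<^sup>\<dagger> = 1\<^sub>m n"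
      by (simp add: unitary_mat_def)
    define T where "T g = Y\<^sup>\<dagger> * (U g * Y)" for g
    have "U g * Y = Y * T g" if g: "g \<in> carrier G" for g
    proof -
      note d = unitary_mat_simps[OF U_un[OF g]] unitary_mat_simps[OF S_un[OF g]]
      \<comment> \<open>The adjoint relation shows that \<open>U g * Y\<close> has no component in
        the range of \<open>X\<close>, so the range of \<open>Y\<close> is invariant.\<close>
      have "S g * X\<^sup>\<dagger> = X\<^sup>\<dagger> * U g"
        using intertwinerD[OF intertwiner_adjoint[OF XS S_un U_un] g] .
      then have "X\<^sup>\<dagger> * (U g * Y) = S g * (X\<^sup>\<dagger> * Y)"
        by (simp add: mat_mult_assoc_dim[symmetric] d)
      then have "X\<^sup>\<dagger> * (U g * Y) = 0\<^sub>m k (n - k)"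
        by (simp add: XY d mat_dim_simps)
      moreover have "U g * Y = (X * X\<^sup>\<dagger> + Y * Y\<^sup>\<dagger>) * (U g * Y)"
        unfolding JJ by (simp add: d mat_mult_one_dim)
      ultimately show ?thesis
        by (simp add: T_def mat_dim_simps d)
    qed
    then have YT: "intertwiner G (n - k) T n U Y"
      using proj_rep_carrier[OF less.prems]
      by (auto simp: intertwiner_def rep_carrier_def T_def intro!: carrier_matI)
    have "k > 0" using S by (auto simp: irreducible_rep_def)
    then obtain Ts where Ts: "irreducible_decomposition G c (n - k) T Ts"
      using less.IH[of "n - k" T] subrep_proj_rep[OF less.prems Y YT G] False by auto
    then obtain W where W: "isometry (n - k) (n - k) W" "intertwiner G (n - k) (direct_sum_rep Ts) (n - k) T W"
      by (meson equivalent_rep_embeds(1) irreducible_decomposition_def embeds_def)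
    have "X\<^sup>\<dagger> * (Y * W) = 0\<^sub>m k (n - k)"
      using W(1) mat_mult_cancel_dim[OF XY, of W] by (auto simp: isometry_def)
    then have "embeds G (k + (n - k)) (direct_sum_rep (S # Ts)) n U"
      using direct_sum_rep_Cons[OF intertwiner_carrier(4)[OF XS] intertwiner_carrier(4)[OF W(2)]]
        XS X intertwiner_mult[OF YT W(2)] isometry_mult[OF Y W(1)] by (rule embeds_direct_sum[rotated -1])
    then have "irreducible_decomposition G c n U (S # Ts)"
      using S Ts embeds_imp_equivalent_rep unfolding kn irreducible_decomposition_def by auto
    then show ?thesis by blast
  qed
qed

section \<open>Schur's lemma and multiplicities\<close>

text \<open>Over the complex numbers \<open>X\<close> has an eigenvalue, and its eigenspace is a
  nonzero invariant subspace.\<close>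

lemma schur_scalar:
  assumes S: "irreducible_rep G c d S" and X: "intertwiner G d S d S X"
  obtains k where "X = k \<cdot>\<^sub>m 1\<^sub>m d"
proof -
  have Xc: "X \<in> carrier_mat d d" using X by (rule intertwiner_carrier)
  have d: "d > 0" using S by (simp add: irreducible_rep_def)
  obtain k where "k \<in> spectrum X"
    using spectrum_non_empty[OF Xc d] by auto
  then obtain v where v: "v \<in> carrier_vec d" "v \<noteq> 0\<^sub>v d" "X *\<^sub>v v = k \<cdot>\<^sub>v v"
    using Xc by (auto simp: spectrum_def eigenvalue_def eigenvector_def)
  define W where "W = {v \<in> carrier_vec d. X *\<^sub>v v = k \<cdot>\<^sub>v v}"
  have "VectorSpace.subspace class_ring W (module_vec TYPE(complex) d)"
    unfolding subspace_module_vec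
  proof (intro conjI ballI allI)
    show "v + w \<in> W" if "v \<in> W" "w \<in> W" for v w
      using that Xc by (auto simp: W_def mult_add_distrib_mat_vec[of _ d d] smult_add_distrib_vec[of _ d])
    show "a \<cdot>\<^sub>v v \<in> W" if "v \<in> W" for a v
      using that Xc by (auto simp: W_def mult_mat_vec[of _ d d] smult_smult_assoc mult.commute)
  qed (use Xc in \<open>auto simp: W_def\<close>)
  moreover have "S g *\<^sub>v w \<in> W" if g: "g \<in> carrier G" and w: "w \<in> W" for g w
  proof -
    have Sg: "S g \<in> carrier_mat d d"
      using intertwiner_carrier(4)[OF X] g by (auto simp: rep_carrier_def)
    have "X *\<^sub>v (S g *\<^sub>v w) = (X * S g) *\<^sub>v w"
      using w Sg Xc by (simp add: W_def assoc_mult_mat_vec[of _ d d _ d])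
    also have "\<dots> = S g *\<^sub>v (X *\<^sub>v w)"
      using w Sg Xc unfolding intertwinerD[OF X g, symmetric]
      by (simp add: W_def assoc_mult_mat_vec[of _ d d _ d])
    also have "\<dots> = k \<cdot>\<^sub>v (S g *\<^sub>v w)"
      using w Sg by (simp add: W_def mult_mat_vec[of _ d d])
    finally show ?thesis
      using w Sg by (simp add: W_def)
  qed
  moreover have "v \<in> W" using v by (simp add: W_def)
  ultimately have W: "W = carrier_vec d"
    using S v unfolding irreducible_rep_def by blast
  have "X = k \<cdot>\<^sub>m 1\<^sub>m d"
  proof (rule mat_eq_by_columns[OF Xc])
    fix u :: "complex mat" assume u: "u \<in> carrier_mat d 1"
    then have "col u 0 \<in> W" by (auto simp: W)
    then have "col (X * u) 0 = k \<cdot>\<^sub>v col u 0"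
      using u Xc by (subst col_mult2[of _ d d _ 1]) (auto simp: W_def)
    then have "col_mat (col (X * u) 0) = col_mat (col (k \<cdot>\<^sub>m u) 0)"
      using u by simp
    moreover have "X * u \<in> carrier_mat d 1" "k \<cdot>\<^sub>m u \<in> carrier_mat d 1"
      using u Xc by auto
    ultimately have "X * u = k \<cdot>\<^sub>m u"
      by (simp only: col_mat_col)
    then show "X * u = k \<cdot>\<^sub>m 1\<^sub>m d * u"
      using u by (simp add: mat_dim_simps)
  qed simp
  then show ?thesis by (rule that)
qed

text \<open>Both \<open>X\<^sup>\<dagger> * X\<close> and \<open>X * X\<^sup>\<dagger>\<close> are
  scalar, so multiples of \<open>X\<close> and of its adjoint are isometries. This forces equal
  dimensions and yields unitary equivalence at once, instead of a mere linear isomorphism.\<close>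

lemma schur_nonzero:
  assumes S: "irreducible_rep G c d S" and T: "irreducible_rep G c e T"
    and X: "intertwiner G d S e T X" and X0: "X \<noteq> 0\<^sub>m e d"
  shows "equivalent_rep G d S T"
proof -
  note Xc = intertwiner_carrier(1-3)[OF X]
  have S_un: "\<And>g. g \<in> carrier G \<Longrightarrow> unitary_mat d (S g)"
    and T_un: "\<And>g. g \<in> carrier G \<Longrightarrow> unitary_mat e (T g)" and pos: "d > 0" "e > 0"
    using S T by (auto simp: irreducible_rep_def proj_rep_def)
  have Xadj: "intertwiner G e T d S (X\<^sup>\<dagger>)"
    using X S_un T_un by (rule intertwiner_adjoint)
  have "(X\<^sup>\<dagger>)\<^sup>\<dagger> \<noteq> (0\<^sub>m d e)\<^sup>\<dagger>"
    using X0 by simp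
  then have Xadj0: "X\<^sup>\<dagger> \<noteq> 0\<^sub>m d e" by metis
  obtain k where "X\<^sup>\<dagger> * X = k \<cdot>\<^sub>m 1\<^sub>m d"
    using schur_scalar[OF S intertwiner_mult[OF Xadj X]] by blast
  then obtain a where a: "isometry e d (a \<cdot>\<^sub>m X)"
    using isometry_of_scalar_gram[OF Xc(1) X0] pos by blast
  obtain l where "(X\<^sup>\<dagger>)\<^sup>\<dagger> * X\<^sup>\<dagger> = l \<cdot>\<^sub>m 1\<^sub>m e"
    using schur_scalar[OF T intertwiner_mult[OF X Xadj]] by auto
  then obtain b where b: "isometry d e (b \<cdot>\<^sub>m X\<^sup>\<dagger>)"
    using isometry_of_scalar_gram[OF mat_adjoint_carrier[OF Xc(1)] Xadj0] pos by blast
  have "d = e"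
    using isometry_le[OF a] isometry_le[OF b] by simp
  then show ?thesis
    using embeds_imp_equivalent_rep intertwiner_smult[OF X] a by (metis embeds_def)
qed

text \<open>Composing an intertwiner \<open>X\<close> with \<open>W\<^sup>\<dagger>\<close> gives an
  intertwiner of \<open>S\<close> with itself, which is scalar.\<close>

lemma schur_equivalent:
  assumes S: "irreducible_rep G c d S" and eq: "equivalent_rep G d S T"
  obtains W where "unitary_mat d W" "intertwiner G d S d T W"
    "\<And>X. intertwiner G d S d T X \<Longrightarrow> \<exists>k. X = k \<cdot>\<^sub>m W"
proof -
  obtain W where W: "isometry d d W" "intertwiner G d S d T W"
    using equivalent_rep_embeds(1)[OF eq] by (auto simp: embeds_def)
  have Wu: "unitary_mat d W" using W(1) by (rule isometry_square)
  note s = unitary_mat_simps[OF Wu]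
  have Wadj: "intertwiner G d T d S (W\<^sup>\<dagger>)"
    using Wu W(2) by (rule intertwiner_unitary_inverse)
  have "\<exists>k. X = k \<cdot>\<^sub>m W" if X: "intertwiner G d S d T X" for X
  proof -
    obtain k where k: "W\<^sup>\<dagger> * X = k \<cdot>\<^sub>m 1\<^sub>m d"
      using schur_scalar[OF S intertwiner_mult[OF Wadj X]] by blast
    have "X = W * (W\<^sup>\<dagger> * X)"
      using intertwiner_carrier(2)[OF X] by (simp add: s)
    also have "\<dots> = k \<cdot>\<^sub>m W"
      unfolding k by (simp add: mat_dim_simps s)
    finally show ?thesis by blast
  qed
  with Wu W(2) show ?thesis by (rule that)
qed

section \<open>Dimensions of intertwiner spaces through linear parametrisations\<close>

definition linear_on_columns :: "nat \<Rightarrow> nat \<Rightarrow> nat \<Rightarrow> (complex mat \<Rightarrow> complex mat) \<Rightarrow> bool" where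
  "linear_on_columns m n d f \<longleftrightarrow>
     (\<forall>a \<in> carrier_mat m 1. f a \<in> carrier_mat n d) \<and>
     (\<forall>a \<in> carrier_mat m 1. \<forall>b \<in> carrier_mat m 1. f (a + b) = f a + f b) \<and>
     (\<forall>k. \<forall>a \<in> carrier_mat m 1. f (k \<cdot>\<^sub>m a) = k \<cdot>\<^sub>m f a)"

definition kernel_free :: "nat \<Rightarrow> nat \<Rightarrow> nat \<Rightarrow> (complex mat \<Rightarrow> complex mat) \<Rightarrow> bool" where
  "kernel_free m n d f \<longleftrightarrow> (\<forall>a \<in> carrier_mat m 1. f a = 0\<^sub>m n d \<longrightarrow> a = 0\<^sub>m m 1)"

lemma linear_on_columnsD:
  assumes "linear_on_columns m n d f" "a \<in> carrier_mat m 1"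
  shows "f a \<in> carrier_mat n d" "dim_row (f a) = n" "dim_col (f a) = d"
    "b \<in> carrier_mat m 1 \<Longrightarrow> f (a + b) = f a + f b" "f (k \<cdot>\<^sub>m a) = k \<cdot>\<^sub>m f a"
proof -
  show "f a \<in> carrier_mat n d" "b \<in> carrier_mat m 1 \<Longrightarrow> f (a + b) = f a + f b"
    "f (k \<cdot>\<^sub>m a) = k \<cdot>\<^sub>m f a"
    using assms unfolding linear_on_columns_def by blast+
  then show "dim_row (f a) = n" "dim_col (f a) = d"
    by blast+
qed

lemma linear_on_columns_eq_mult:
  assumes f: "linear_on_columns p m 1 f"
  obtains B where "B \<in> carrier_mat m p" "\<And>a. a \<in> carrier_mat p 1 \<Longrightarrow> f a = B * a"
proof -
  define e where "e i = mat p 1 (\<lambda>(r, _). if r = i then 1 else (0 :: complex))" for i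
  define B where "B = mat m p (\<lambda>(r, i). f (e i) $$ (r, 0))"
  have e: "e i \<in> carrier_mat p 1" for i by (auto simp: e_def)
  have B: "B \<in> carrier_mat m p" by (simp add: B_def)
  \<comment> \<open>Induction on \<open>j\<close>, where \<open>a\<close> is supported on the first
    \<open>j\<close> coordinates; the step removes coordinate \<open>j\<close>. The columns of
    \<open>B\<close> are the images of the unit columns.\<close>
  have "f a = B * a"
    if "j \<le> p" "a \<in> carrier_mat p 1" "\<And>i. j \<le> i \<Longrightarrow> i < p \<Longrightarrow> a $$ (i, 0) = 0" for j a
    using that
  proof (induction j arbitrary: a)
    case 0
    then have a: "a = 0 \<cdot>\<^sub>m a" by (auto simp: mat_eq_iff)
    have "f (0 \<cdot>\<^sub>m a) = 0\<^sub>m m 1"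
      unfolding linear_on_columnsD(5)[OF f 0(2)]
      using linear_on_columnsD(2,3)[OF f 0(2)] by (simp add: mat_zero_smult)
    moreover have "B * (0 \<cdot>\<^sub>m a) = 0\<^sub>m m 1"
      using 0 B by (simp add: mat_zero_smult mat_dim_simps)
    ultimately show ?case using a by simp
  next
    case (Suc j)
    define b where "b = a + (- a $$ (j, 0)) \<cdot>\<^sub>m e j"
    have b: "b \<in> carrier_mat p 1" using Suc.prems e by (simp add: b_def)
    have a: "a = b + (a $$ (j, 0)) \<cdot>\<^sub>m e j"
      using Suc.prems by (auto simp: b_def e_def mat_eq_iff)
    have fb: "f b = B * b"
      using Suc.prems b
      by (intro Suc.IH) (auto simp: b_def e_def not_less_eq_eq le_less_Suc_eq
          dest: le_neq_implies_less)
    have Be: "B * e j = f (e j)"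
      using Suc.prems linear_on_columnsD(2,3)[OF f e]
      by (intro eq_matI) (auto simp: B_def e_def scalar_prod_def if_distrib cong: if_cong)
    have "f a = f b + a $$ (j, 0) \<cdot>\<^sub>m f (e j)"
      using b e by (subst a) (simp add: linear_on_columnsD[OF f])
    also have "\<dots> = B * (b + a $$ (j, 0) \<cdot>\<^sub>m e j)"
      using b B e[of j] carrier_matD[OF e[of j]] carrier_matD[OF b] by (simp add: mat_dim_simps fb Be)
    finally show ?case using a by simp
  qed
  from this[OF order_refl] have "f a = B * a" if "a \<in> carrier_mat p 1" for a
    using that by (metis not_le)
  with B show ?thesis by (rule that)
qed

lemma linear_kernel_free_le:
  assumes f: "linear_on_columns p m 1 f" and inj: "kernel_free p m 1 f"
  shows "p \<le> m"
proof (rule ccontr)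
  obtain B where B: "B \<in> carrier_mat m p" "\<And>a. a \<in> carrier_mat p 1 \<Longrightarrow> f a = B * a"
    using linear_on_columns_eq_mult[OF f] by blast
  assume "\<not> p \<le> m"
  then obtain a where "a \<in> carrier_mat p 1" "a \<noteq> 0\<^sub>m p 1" "B * a = 0\<^sub>m m 1"
    using wide_matrix_kernel[OF B(1)] by (metis not_less)
  with inj B(2) show False
    by (auto simp: kernel_free_def)
qed

text \<open>States that the intertwiner space has dimension \<open>m\<close>, with \<open>f\<close>
  as the coordinate isomorphism. Carrying the isomorphism along lets dimensions be added,
  transported and compared without a vector space of matrices.\<close>

definition hom_coordinates :: "('g, 'x) monoid_scheme \<Rightarrow> nat \<Rightarrow> ('g \<Rightarrow> complex mat) \<Rightarrow> nat
    \<Rightarrow> ('g \<Rightarrow> complex mat) \<Rightarrow> nat \<Rightarrow> (complex mat \<Rightarrow> complex mat) \<Rightarrow> bool" where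
  "hom_coordinates G d S n V m f \<longleftrightarrow>
     linear_on_columns m n d f \<and> kernel_free m n d f \<and>
     f ` carrier_mat m 1 = {X. intertwiner G d S n V X}"

text \<open>Reading the intertwiners \<open>h a\<close> in the coordinates \<open>f\<close> gives an
  injective linear map from columns of length \<open>p\<close> to columns of length
  \<open>m\<close>.\<close>

lemma hom_dim_ge:
  assumes f: "hom_coordinates G d S n V m f"
    and h: "linear_on_columns p n d h" "kernel_free p n d h"
    and hom: "\<And>a. a \<in> carrier_mat p 1 \<Longrightarrow> intertwiner G d S n V (h a)"
  shows "p \<le> m"
proof -
  have lin: "linear_on_columns m n d f" and inj: "kernel_free m n d f"
    and im: "f ` carrier_mat m 1 = {X. intertwiner G d S n V X}"
    using f by (auto simp: hom_coordinates_def)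
  note l = linear_on_columnsD[OF lin] and hl = linear_on_columnsD[OF h(1)]
  define g where "g a = (SOME b. b \<in> carrier_mat m 1 \<and> f b = h a)" for a
  have g: "g a \<in> carrier_mat m 1 \<and> f (g a) = h a" if "a \<in> carrier_mat p 1" for a
  proof -
    have "h a \<in> f ` carrier_mat m 1"
      using hom[OF that] unfolding im by simp
    then have "\<exists>b. b \<in> carrier_mat m 1 \<and> f b = h a"
      by (metis imageE)
    then show ?thesis unfolding g_def by (rule someI_ex)
  qed
  \<comment> \<open>Uniqueness of coordinates is what makes the chosen \<open>g\<close>
    linear.\<close>
  have f_inj: "x = y" if x: "x \<in> carrier_mat m 1" and y: "y \<in> carrier_mat m 1" and eq: "f x = f y" for x y
  proof -
    have "f (x + (-1) \<cdot>\<^sub>m y) = f y + (-1) \<cdot>\<^sub>m f y"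
      using x y by (simp add: l eq)
    also have "\<dots> = 0\<^sub>m n d"
      using l(1)[OF y] by (auto intro!: eq_matI)
    finally have "x + (-1) \<cdot>\<^sub>m y = 0\<^sub>m m 1"
      using inj x y by (auto simp: kernel_free_def)
    then show ?thesis
      using x y by (auto simp: mat_eq_iff)
  qed
  have "linear_on_columns p m 1 g"
    unfolding linear_on_columns_def
  proof (intro conjI ballI allI)
    show "g (a + b) = g a + g b" if "a \<in> carrier_mat p 1" "b \<in> carrier_mat p 1" for a b
    proof (rule f_inj)
      have "f (g a + g b) = f (g a) + f (g b)"
        using that g by (intro l(4)) blast+
      then show "f (g (a + b)) = f (g a + g b)"
        using that g by (simp add: hl(4))
    qed (use that g in auto)
    show "g (k \<cdot>\<^sub>m a) = k \<cdot>\<^sub>m g a" if "a \<in> carrier_mat p 1" for k a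
    proof (rule f_inj)
      have "f (k \<cdot>\<^sub>m g a) = k \<cdot>\<^sub>m f (g a)"
        using that g by (intro l(5)) blast
      then show "f (g (k \<cdot>\<^sub>m a)) = f (k \<cdot>\<^sub>m g a)"
        using that g by (simp add: hl(5))
    qed (use that g in auto)
  qed (use g in auto)
  moreover have "kernel_free p m 1 g"
    unfolding kernel_free_def
  proof (intro ballI impI)
    fix a assume a: "a \<in> carrier_mat p 1" "g a = 0\<^sub>m m 1"
    have "f (0 \<cdot>\<^sub>m (0\<^sub>m m 1)) = 0 \<cdot>\<^sub>m f (0\<^sub>m m 1)"
      by (rule l(5)) simp
    also have "\<dots> = 0\<^sub>m n d"
      using l(2,3)[OF zero_carrier_mat[of m 1]] by (simp add: mat_zero_smult)
    finally have "f (0 \<cdot>\<^sub>m (0\<^sub>m m 1)) = 0\<^sub>m n d" .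
    then have "h a = 0\<^sub>m n d" using g[OF a(1)] a(2) by simp
    then show "a = 0\<^sub>m p 1" using h(2) a(1) by (auto simp: kernel_free_def)
  qed
  ultimately show ?thesis by (rule linear_kernel_free_le)
qed

lemma hom_coordinates_intertwiner:
  assumes "hom_coordinates G d S n V m f" "a \<in> carrier_mat m 1"
  shows "intertwiner G d S n V (f a)"
proof -
  have "f ` carrier_mat m 1 = {X. intertwiner G d S n V X}"
    using assms(1) unfolding hom_coordinates_def by blast
  with imageI[OF assms(2), of f] show ?thesis by simp
qed

lemma hom_dim_unique:
  assumes f: "hom_coordinates G d S n V m f" and h: "hom_coordinates G d S n V p h"
  shows "m = p"
proof (rule antisym)
  have "linear_on_columns p n d h" "kernel_free p n d h"
    using h unfolding hom_coordinates_def by blast+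
  then show "p \<le> m"
    by (rule hom_dim_ge[OF f]) (rule hom_coordinates_intertwiner[OF h])
  have "linear_on_columns m n d f" "kernel_free m n d f"
    using f unfolding hom_coordinates_def by blast+
  then show "m \<le> p"
    by (rule hom_dim_ge[OF h]) (rule hom_coordinates_intertwiner[OF f])
qed

text \<open>Intertwiners into a direct sum are pairs of intertwiners into the summands, the
  components being obtained with the projections; hence the dimensions add.\<close>

lemma hom_coordinates_direct_sum:
  assumes D: "is_direct_sum G k T l R D"
    and f: "hom_coordinates G d S k T m f" and h: "hom_coordinates G d S l R p h"
  shows "hom_coordinates G d S (k + l) D (m + p)
    (\<lambda>a. inj1 k l * f ((inj1 m p)\<^sup>\<dagger> * a) + inj2 k l * h ((inj2 m p)\<^sup>\<dagger> * a))" (is "hom_coordinates _ _ _ _ _ _ ?F")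
proof -
  have i: "intertwiner G k T (k + l) D (inj1 k l)" "intertwiner G l R (k + l) D (inj2 k l)"
     "intertwiner G (k + l) D k T ((inj1 k l)\<^sup>\<dagger>)" "intertwiner G (k + l) D l R ((inj2 k l)\<^sup>\<dagger>)"
    using D by (auto simp: is_direct_sum_def)
  have fl: "linear_on_columns m k d f" and fi: "kernel_free m k d f"
    and fim: "f ` carrier_mat m 1 = {X. intertwiner G d S k T X}"
    and hl: "linear_on_columns p l d h" and hi: "kernel_free p l d h"
    and him: "h ` carrier_mat p 1 = {X. intertwiner G d S l R X}"
    using f h by (auto simp: hom_coordinates_def)
  have c: "(inj1 m p)\<^sup>\<dagger> * a \<in> carrier_mat m 1" "(inj2 m p)\<^sup>\<dagger> * a \<in> carrier_mat p 1"
    if "a \<in> carrier_mat (m + p) 1" for a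
    using that by auto
  note fD = linear_on_columnsD[OF fl c(1)] and hD = linear_on_columnsD[OF hl c(2)]
  have "linear_on_columns (m + p) (k + l) d ?F"
    unfolding linear_on_columns_def
  proof (intro conjI ballI allI)
    fix a b :: "complex mat" and x
    assume a: "a \<in> carrier_mat (m + p) 1"
    show "?F a \<in> carrier_mat (k + l) d"
      using fD[OF a] hD[OF a] by auto
    have "?F (x \<cdot>\<^sub>m a) = inj1 k l * (x \<cdot>\<^sub>m f ((inj1 m p)\<^sup>\<dagger> * a)) + inj2 k l * (x \<cdot>\<^sub>m h ((inj2 m p)\<^sup>\<dagger> * a))"
      using a fD(5)[OF a] hD(5)[OF a] by (simp add: mat_dim_simps)
    also have "\<dots> = x \<cdot>\<^sub>m ?F a"
      using fD(2,3)[OF a] hD(2,3)[OF a]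
      by (simp add: mat_dim_simps) (auto intro!: eq_matI simp: distrib_left)
    finally show "?F (x \<cdot>\<^sub>m a) = x \<cdot>\<^sub>m ?F a" .
    assume b: "b \<in> carrier_mat (m + p) 1"
    have "?F (a + b) = inj1 k l * (f ((inj1 m p)\<^sup>\<dagger> * a) + f ((inj1 m p)\<^sup>\<dagger> * b))
        + inj2 k l * (h ((inj2 m p)\<^sup>\<dagger> * a) + h ((inj2 m p)\<^sup>\<dagger> * b))"
      using a b fD(4)[OF a c(1)[OF b]] hD(4)[OF a c(2)[OF b]] by (simp add: mat_dim_simps)
    also have "\<dots> = ?F a + ?F b"
      using fD(2,3)[OF a] hD(2,3)[OF a] fD(2,3)[OF b] hD(2,3)[OF b]
      by (simp add: mat_dim_simps) (auto intro!: eq_matI)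
    finally show "?F (a + b) = ?F a + ?F b" .
  qed
  moreover have "kernel_free (m + p) (k + l) d ?F"
    unfolding kernel_free_def
  proof (intro ballI impI)
    fix a assume a: "a \<in> carrier_mat (m + p) 1" and F: "?F a = 0\<^sub>m (k + l) d"
    have "f ((inj1 m p)\<^sup>\<dagger> * a) = (inj1 k l)\<^sup>\<dagger> * ?F a" "h ((inj2 m p)\<^sup>\<dagger> * a) = (inj2 k l)\<^sup>\<dagger> * ?F a"
      using fD(2,3)[OF a] hD(2,3)[OF a] by (simp_all add: mat_dim_simps)
    then have "(inj1 m p)\<^sup>\<dagger> * a = 0\<^sub>m m 1" "(inj2 m p)\<^sup>\<dagger> * a = 0\<^sub>m p 1"
      using fi hi c[OF a] unfolding F kernel_free_def by (auto simp: mat_dim_simps)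
    then have "(inj1 m p * (inj1 m p)\<^sup>\<dagger> + inj2 m p * (inj2 m p)\<^sup>\<dagger>) * a = 0\<^sub>m (m + p) 1"
      using a by (simp add: mat_dim_simps)
    then show "a = 0\<^sub>m (m + p) 1"
      using a by (simp add: inj_complete)
  qed
  moreover have "?F ` carrier_mat (m + p) 1 = {X. intertwiner G d S (k + l) D X}"
  proof (intro equalityI subsetI)
    fix X assume "X \<in> ?F ` carrier_mat (m + p) 1"
    then obtain a where a: "a \<in> carrier_mat (m + p) 1" "X = ?F a" by auto
    have "intertwiner G d S k T (f ((inj1 m p)\<^sup>\<dagger> * a))" "intertwiner G d S l R (h ((inj2 m p)\<^sup>\<dagger> * a))"
      using fim him c[OF a(1)] by blast+
    then show "X \<in> {X. intertwiner G d S (k + l) D X}"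
      unfolding a(2) using i by (auto intro!: intertwiner_add intertwiner_mult)
  next
    fix X assume "X \<in> {X. intertwiner G d S (k + l) D X}"
    then have X: "intertwiner G d S (k + l) D X" by simp
    obtain x where x: "x \<in> carrier_mat m 1" "f x = (inj1 k l)\<^sup>\<dagger> * X"
      using intertwiner_mult[OF i(3) X] fim by (auto simp: image_def set_eq_iff) metis
    obtain y where y: "y \<in> carrier_mat p 1" "h y = (inj2 k l)\<^sup>\<dagger> * X"
      using intertwiner_mult[OF i(4) X] him by (auto simp: image_def set_eq_iff) metis
    define a where "a = inj1 m p * x + inj2 m p * y"
    have "(inj1 m p)\<^sup>\<dagger> * a = x" "(inj2 m p)\<^sup>\<dagger> * a = y"
      using x(1) y(1) by (simp_all add: a_def mat_dim_simps)
    then have "?F a = (inj1 k l * (inj1 k l)\<^sup>\<dagger> + inj2 k l * (inj2 k l)\<^sup>\<dagger>) * X"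
      using intertwiner_carrier(2,3)[OF X] x y by (simp add: mat_dim_simps)
    then have "?F a = X"
      using intertwiner_carrier(2)[OF X] by (simp add: inj_complete mat_mult_one_dim)
    moreover have "a \<in> carrier_mat (m + p) 1"
      using x y by (auto simp: a_def)
    ultimately show "X \<in> ?F ` carrier_mat (m + p) 1" by blast
  qed
  ultimately show ?thesis
    by (simp add: hom_coordinates_def)
qed

lemma hom_coordinates_trivial:
  assumes "rep_carrier G d S" "rep_carrier G n V"
    and zero: "\<And>X. intertwiner G d S n V X \<Longrightarrow> X = 0\<^sub>m n d"
  shows "hom_coordinates G d S n V 0 (\<lambda>_. 0\<^sub>m n d)"
proof -
  have "(\<lambda>_. 0\<^sub>m n d) ` (carrier_mat 0 1 :: complex mat set) = {X. intertwiner G d S n V X}"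
  proof (intro equalityI subsetI)
    fix X assume "X \<in> {X. intertwiner G d S n V X}"
    then have "X = 0\<^sub>m n d" using zero by blast
    then show "X \<in> (\<lambda>_. 0\<^sub>m n d) ` (carrier_mat 0 1 :: complex mat set)"
      by (rule image_eqI[OF _ zero_carrier_mat])
  qed (use intertwiner_zero[OF assms(1,2)] in blast)
  moreover have "kernel_free 0 n d (\<lambda>_. 0\<^sub>m n d)"
    unfolding kernel_free_def by (auto intro!: eq_matI)
  ultimately show ?thesis
    unfolding hom_coordinates_def linear_on_columns_def by (simp add: mat_add_zero_dim)
qed

lemma hom_coordinates_irreducible:
  assumes S: "irreducible_rep G c d S" and eq: "equivalent_rep G d S T"
  obtains f where "hom_coordinates G d S d T 1 f"
proof -
  obtain W where W: "unitary_mat d W" "intertwiner G d S d T W"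
    and span: "\<And>X. intertwiner G d S d T X \<Longrightarrow> \<exists>k. X = k \<cdot>\<^sub>m W"
    using schur_equivalent[OF S eq] by blast
  note s = unitary_mat_simps[OF W(1)]
  define f where "f a = (a $$ (0, 0)) \<cdot>\<^sub>m W" for a :: "complex mat"
  have lin: "linear_on_columns 1 d d f"
    unfolding linear_on_columns_def f_def using s(1) by (auto simp: add_smult_distrib_right_mat[of _ d d])
  have d: "d > 0" using S by (simp add: irreducible_rep_def)
  have "W \<noteq> 0\<^sub>m d d"
  proof
    assume "W = 0\<^sub>m d d"
    then have "(1\<^sub>m d :: complex mat) = 0\<^sub>m d d"
      using s(4) by simp
    then have "(1\<^sub>m d :: complex mat) $$ (0, 0) = 0\<^sub>m d d $$ (0, 0)"
      by (rule arg_cong)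
    with d show False by simp
  qed
  then have "a $$ (0, 0) = 0" if "f a = 0\<^sub>m d d" for a
    using mat_smult_eq_zero[of "a $$ (0, 0)" W d d] that unfolding f_def by blast
  then have "a = 0\<^sub>m 1 1" if "a \<in> carrier_mat 1 1" "f a = 0\<^sub>m d d" for a
    using that by (intro eq_matI) auto
  then have ker: "kernel_free 1 d d f"
    unfolding kernel_free_def by blast
  have "X \<in> f ` carrier_mat 1 1" if X: "intertwiner G d S d T X" for X
  proof -
    obtain k where "X = k \<cdot>\<^sub>m W" using span[OF X] by blast
    then show ?thesis
      by (intro image_eqI[of _ _ "k \<cdot>\<^sub>m 1\<^sub>m 1"]) (simp_all add: f_def)
  qed
  then have "f ` carrier_mat 1 1 = {X. intertwiner G d S d T X}"
    using intertwiner_smult[OF W(2)] by (auto simp: f_def)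
  with lin ker show ?thesis
    by (intro that[of f]) (simp add: hom_coordinates_def)
qed

lemma irreducible_rep_carrier: "irreducible_rep G c d S \<Longrightarrow> rep_carrier G d S"
  using proj_rep_carrier by (auto simp: irreducible_rep_def)

text \<open>A family determines its dimension, by its value at the unit of the group. This is used
  constantly because lists of summands do not record dimensions.\<close>

lemma rep_carrier_unique:
  "group G \<Longrightarrow> rep_carrier G k V \<Longrightarrow> rep_carrier G l V \<Longrightarrow> k = l"
  using rep_carrier_dim[of G _ V "\<one>\<^bsub>G\<^esub>"] by (metis group.is_monoid monoid.one_closed)

lemma rep_carrier_direct_sum_Nil: "rep_carrier G 0 (direct_sum_rep [])"
  by (auto simp: rep_carrier_def direct_sum_rep_def)

lemma is_direct_sum_carrier: "is_direct_sum G k S l T D \<Longrightarrow> rep_carrier G (k + l) D"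
  unfolding is_direct_sum_def using intertwiner_carrier(5) by blast

text \<open>Counting summands equivalent to \<open>S\<close> is computing the dimension of an
  intertwiner space, which makes no reference to the list.\<close>

lemma hom_coordinates_direct_sum_rep:
  assumes G: "group G" and S: "irreducible_rep G c d S" and Ss: "\<forall>T \<in> set Ss. \<exists>e. irreducible_rep G c e T"
  shows "\<exists>l f. rep_carrier G l (direct_sum_rep Ss) \<and>
    hom_coordinates G d S l (direct_sum_rep Ss) (length (filter (equivalent_rep G d S) Ss)) f"
  using Ss
proof (induction Ss)
  case Nil
  have "hom_coordinates G d S 0 (direct_sum_rep []) 0 (\<lambda>_. 0\<^sub>m 0 d)"
    using irreducible_rep_carrier[OF S] rep_carrier_direct_sum_Nil
    by (rule hom_coordinates_trivial) (auto intro!: eq_matI dest: intertwiner_carrier(2,3))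
  then show ?case
    using rep_carrier_direct_sum_Nil by auto
next
  case (Cons T Ss)
  obtain l f where l: "rep_carrier G l (direct_sum_rep Ss)" and
    f: "hom_coordinates G d S l (direct_sum_rep Ss) (length (filter (equivalent_rep G d S) Ss)) f"
    using Cons by auto
  obtain e where T: "irreducible_rep G c e T" using Cons.prems by auto
  have D: "is_direct_sum G e T l (direct_sum_rep Ss) (direct_sum_rep (T # Ss))"
    using irreducible_rep_carrier[OF T] l by (rule direct_sum_rep_Cons)
  \<comment> \<open>Schur's lemma decides the contribution of one summand; in the equivalent case
    \<open>e\<close> must first be identified with \<open>d\<close>.\<close>
  have "\<exists>h. hom_coordinates G d S e T (if equivalent_rep G d S T then 1 else 0) h"
  proof (cases "equivalent_rep G d S T")
    case True
    have "rep_carrier G d T"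
      using True by (auto simp: equivalent_rep_def rep_carrier_def)
    then have "e = d"
      by (rule rep_carrier_unique[OF G irreducible_rep_carrier[OF T]])
    then show ?thesis
      using hom_coordinates_irreducible[OF S True] True by auto
  next
    case False
    then have "hom_coordinates G d S e T 0 (\<lambda>_. 0\<^sub>m e d)"
      using schur_nonzero[OF S T] irreducible_rep_carrier[OF S] irreducible_rep_carrier[OF T]
      by (intro hom_coordinates_trivial) blast+
    with False show ?thesis by auto
  qed
  then obtain h where
    "hom_coordinates G d S e T (if equivalent_rep G d S T then 1 else 0) h" by blast
  from hom_coordinates_direct_sum[OF D this f] show ?case
    using is_direct_sum_carrier[OF D] by (cases "equivalent_rep G d S T") auto
qed

text \<open>A unitary intertwiner transports coordinates by composition;
  \<open>J\<^sup>\<dagger>\<close> shows that no intertwiner into \<open>U\<close> is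
  missed.\<close>

lemma hom_coordinates_embedding:
  assumes f: "hom_coordinates G d S n V m f" and J: "isometry n n J" "intertwiner G n V n U J"
  shows "hom_coordinates G d S n U m (\<lambda>a. J * f a)"
proof -
  have Ju: "unitary_mat n J" using J(1) by (rule isometry_square)
  note s = unitary_mat_simps[OF Ju]
  have Jadj: "intertwiner G n U n V (J\<^sup>\<dagger>)"
    using Ju J(2) by (rule intertwiner_unitary_inverse)
  have lin: "linear_on_columns m n d f" and inj: "kernel_free m n d f"
    and im: "f ` carrier_mat m 1 = {X. intertwiner G d S n V X}"
    using f unfolding hom_coordinates_def by blast+
  note l = linear_on_columnsD[OF lin]
  have "linear_on_columns m n d (\<lambda>a. J * f a)"
    unfolding linear_on_columns_def
  proof (intro conjI ballI allI)
    fix a b :: "complex mat" and k assume a: "a \<in> carrier_mat m 1"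
    show "J * f a \<in> carrier_mat n d" using s(1) l(1)[OF a] by simp
    show "J * f (k \<cdot>\<^sub>m a) = k \<cdot>\<^sub>m (J * f a)"
      unfolding l(5)[OF a] using s l(2)[OF a] by (intro mat_smult_right_dim) simp
    assume b: "b \<in> carrier_mat m 1"
    show "J * f (a + b) = J * f a + J * f b"
      unfolding l(4)[OF a b] using s l(2,3)[OF a] l(2,3)[OF b] by (intro mat_distrib_left_dim) simp_all
  qed
  moreover have "kernel_free m n d (\<lambda>a. J * f a)"
    unfolding kernel_free_def
  proof (intro ballI impI)
    fix a assume a: "a \<in> carrier_mat m 1" "J * f a = 0\<^sub>m n d"
    have "f a = J\<^sup>\<dagger> * (J * f a)"
      using l(2)[OF a(1)] by (simp add: s)
    then have "f a = 0\<^sub>m n d"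
      unfolding a(2) by (simp add: mat_dim_simps s)
    with inj a(1) show "a = 0\<^sub>m m 1" unfolding kernel_free_def by blast
  qed
  moreover have "(\<lambda>a. J * f a) ` carrier_mat m 1 = {X. intertwiner G d S n U X}"
  proof (intro equalityI subsetI)
    fix X assume "X \<in> {X. intertwiner G d S n U X}"
    then have X: "intertwiner G d S n U X" by simp
    have "J\<^sup>\<dagger> * X \<in> f ` carrier_mat m 1"
      unfolding im using intertwiner_mult[OF Jadj X] by simp
    then obtain a where a: "a \<in> carrier_mat m 1" "J\<^sup>\<dagger> * X = f a" by blast
    have "X = J * (J\<^sup>\<dagger> * X)"
      using intertwiner_carrier(2)[OF X] by (simp add: s)
    then have "X = J * f a" unfolding a(2) .
    then show "X \<in> (\<lambda>a. J * f a) ` carrier_mat m 1"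
      using a(1) by (rule image_eqI)
  qed (use intertwiner_mult[OF J(2) hom_coordinates_intertwiner[OF f]] in blast)
  ultimately show ?thesis by (simp add: hom_coordinates_def)
qed

lemma hom_coordinates_decomposition:
  assumes G: "group G" and S: "irreducible_rep G c d S" and Ss: "irreducible_decomposition G c n U Ss"
  obtains f where "hom_coordinates G d S n U (length (filter (equivalent_rep G d S) Ss)) f"
proof -
  obtain J where J: "isometry n n J" "intertwiner G n (direct_sum_rep Ss) n U J"
    using Ss equivalent_rep_embeds(1) unfolding irreducible_decomposition_def embeds_def by metis
  obtain l f where "rep_carrier G l (direct_sum_rep Ss)" and
    f: "hom_coordinates G d S l (direct_sum_rep Ss) (length (filter (equivalent_rep G d S) Ss)) f"
    using hom_coordinates_direct_sum_rep[OF G S, of Ss] Ss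
    unfolding irreducible_decomposition_def by blast
  then have "l = n"
    using rep_carrier_unique[OF G] intertwiner_carrier(4)[OF J(2)] by blast
  with f that hom_coordinates_embedding[OF _ J] show ?thesis by blast
qed

text \<open>Any two decompositions count the dimension of the same intertwiner space, so the
  definite description has a unique candidate and may be evaluated on any decomposition.\<close>

lemma multiplicity_rep_decomposition:
  assumes G: "group G" and S: "irreducible_rep G c d S" and Ss: "irreducible_decomposition G c n U Ss"
  shows "multiplicity_rep G c n U d S = length (filter (equivalent_rep G d S) Ss)"
  unfolding multiplicity_rep_def
proof (rule the_equality)
  fix k assume "\<exists>Ts. irreducible_decomposition G c n U Ts \<and> k = length (filter (equivalent_rep G d S) Ts)"
  then obtain Ts where "irreducible_decomposition G c n U Ts"
    and k: "k = length (filter (equivalent_rep G d S) Ts)" by blast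
  then show "k = length (filter (equivalent_rep G d S) Ss)"
    using hom_coordinates_decomposition[OF G S] Ss hom_dim_unique by (metis (no_types))
qed (use Ss in blast)

lemma multiplicity_rep_hom:
  assumes G: "group G" and S: "irreducible_rep G c d S" and U: "proj_rep G c n U"
  obtains f where "hom_coordinates G d S n U (multiplicity_rep G c n U d S) f"
proof -
  obtain Ss where Ss: "irreducible_decomposition G c n U Ss"
    using irreducible_decomposition_exists[OF G U] by blast
  show ?thesis
    using hom_coordinates_decomposition[OF G S Ss] that
    unfolding multiplicity_rep_decomposition[OF G S Ss] by blast
qed

section \<open>Embedding one direct sum into another by comparing multiplicities\<close>

lemma direct_sum_rep_carrier:
  assumes "\<forall>T \<in> set Ss. \<exists>e. rep_carrier G e T"
  obtains l where "rep_carrier G l (direct_sum_rep Ss)"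
proof -
  have "\<exists>l. rep_carrier G l (direct_sum_rep Ss)"
    using assms
  proof (induction Ss)
    case Nil
    show ?case using rep_carrier_direct_sum_Nil by blast
  next
    case (Cons T Ss)
    then show ?case
      using is_direct_sum_carrier[OF direct_sum_rep_Cons] by force
  qed
  with that show ?thesis by blast
qed

lemma is_direct_sumD:
  assumes "is_direct_sum G k S l T D"
  shows "intertwiner G k S (k + l) D (inj1 k l)" "intertwiner G l T (k + l) D (inj2 k l)"
    "embeds G k S (k + l) D" "embeds G l T (k + l) D" "rep_carrier G k S" "rep_carrier G l T"
  using assms isometry_inj intertwiner_carrier(4) unfolding is_direct_sum_def embeds_def by blast+

lemma embeds_direct_sum_member:
  assumes "T \<in> set Ss" "rep_carrier G e T" "\<forall>T \<in> set Ss. \<exists>e. rep_carrier G e T" "group G"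
    "rep_carrier G n (direct_sum_rep Ss)"
  shows "embeds G e T n (direct_sum_rep Ss)"
  using assms
proof (induction Ss arbitrary: n)
  case (Cons S Ss)
  obtain l where l: "rep_carrier G l (direct_sum_rep Ss)"
    using direct_sum_rep_carrier[of Ss G] Cons.prems by auto
  obtain k where k: "rep_carrier G k S" using Cons.prems by auto
  have D: "is_direct_sum G k S l (direct_sum_rep Ss) (direct_sum_rep (S # Ss))"
    using k l by (rule direct_sum_rep_Cons)
  have n: "n = k + l"
    using rep_carrier_unique is_direct_sum_carrier[OF D] Cons.prems by blast
  show ?case
  proof (cases "T = S")
    case True
    then have "e = k" using rep_carrier_unique k Cons.prems by blast
    with True n is_direct_sumD(3)[OF D] show ?thesis by simp
  next
    case False
    then have "embeds G e T l (direct_sum_rep Ss)"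
      using Cons l by auto
    with n is_direct_sumD(4)[OF D] show ?thesis
      using embeds_trans by blast
  qed
qed simp

lemma embeds_direct_sum_mono:
  assumes D: "is_direct_sum G k S l T D" and D': "is_direct_sum G k' S' l' T' D'"
    and S: "embeds G k S k' S'" and T: "embeds G l T l' T'"
  shows "embeds G (k + l) D (k' + l') D'"
proof -
  obtain X where X: "isometry k' k X" "intertwiner G k S k' S' X" using S by (auto simp: embeds_def)
  obtain Y where Y: "isometry l' l Y" "intertwiner G l T l' T' Y" using T by (auto simp: embeds_def)
  have "(inj1 k' l' * X)\<^sup>\<dagger> * (inj2 k' l' * Y) = 0\<^sub>m k l"
    using intertwiner_carrier(2,3)[OF X(2)] intertwiner_carrier(2,3)[OF Y(2)]
    by (simp add: mat_dim_simps)
  then show ?thesis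
    using embeds_direct_sum[OF D] intertwiner_mult[OF is_direct_sumD(1)[OF D'] X(2)]
      intertwiner_mult[OF is_direct_sumD(2)[OF D'] Y(2)]
      isometry_mult[OF isometry_inj(1) X(1)] isometry_mult[OF isometry_inj(2) Y(1)]
    by blast
qed

text \<open>Exchanges the two leading summands: \<open>S\<close> goes to second place,
  \<open>T\<close> to first place and the common rest \<open>F\<close> stays. These exchanges
  generate the reorderings needed for lists.\<close>

lemma embeds_direct_sum_swap:
  assumes D: "is_direct_sum G k S (l + m) E D" and E: "is_direct_sum G l T m F E"
    and D': "is_direct_sum G l T (k + m) E' D'" and E': "is_direct_sum G k S m F E'"
  shows "embeds G (k + (l + m)) D (l + (k + m)) D'"
proof (rule embeds_direct_sum[OF D])
  note i = is_direct_sumD(1)[OF D'] is_direct_sumD(2)[OF D'] is_direct_sumD(1)[OF E'] is_direct_sumD(2)[OF E']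
  show "intertwiner G k S (l + (k + m)) D' (inj2 l (k + m) * inj1 k m)"
    using i by (blast intro: intertwiner_mult)
  show "isometry (l + (k + m)) k (inj2 l (k + m) * inj1 k m)"
    using isometry_inj by (blast intro: isometry_mult)
  have X: "isometry (l + (k + m)) m (inj2 l (k + m) * inj2 k m)"
    using isometry_inj by (blast intro: isometry_mult)
  show "intertwiner G (l + m) E (l + (k + m)) D'
    (inj1 l (k + m) * (inj1 l m)\<^sup>\<dagger> + inj2 l (k + m) * inj2 k m * (inj2 l m)\<^sup>\<dagger>)"
    using i by (intro direct_sum_intertwiner[OF E]) (blast intro: intertwiner_mult)+
  show "isometry (l + (k + m)) (l + m)
    (inj1 l (k + m) * (inj1 l m)\<^sup>\<dagger> + inj2 l (k + m) * inj2 k m * (inj2 l m)\<^sup>\<dagger>)"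
    by (rule isometry_append[OF isometry_inj(1) X]) (simp add: mat_dim_simps)
  show "(inj2 l (k + m) * inj1 k m)\<^sup>\<dagger> *
    (inj1 l (k + m) * (inj1 l m)\<^sup>\<dagger> + inj2 l (k + m) * inj2 k m * (inj2 l m)\<^sup>\<dagger>) = 0\<^sub>m k (l + m)"
    by (simp add: mat_dim_simps)
qed

text \<open>The head moves to its place by adjacent exchanges: one exchange with \<open>S\<close>,
  then the induction hypothesis behind \<open>S\<close>.\<close>

lemma embeds_direct_sum_insert:
  assumes G: "group G" and T: "rep_carrier G e T" and Ss: "\<forall>S \<in> set (Ts1 @ Ts2). \<exists>e. rep_carrier G e S"
  shows "\<exists>n. embeds G n (direct_sum_rep (T # Ts1 @ Ts2)) n (direct_sum_rep (Ts1 @ T # Ts2))"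
  using Ss
proof (induction Ts1)
  case Nil
  have "\<forall>S \<in> set (T # Ts2). \<exists>e. rep_carrier G e S"
    using Nil T by auto
  then obtain n where "rep_carrier G n (direct_sum_rep (T # Ts2))"
    by (rule direct_sum_rep_carrier)
  from embeds_refl[OF this] show ?case by auto
next
  case (Cons S Ts1)
  obtain n where n: "embeds G n (direct_sum_rep (T # Ts1 @ Ts2)) n (direct_sum_rep (Ts1 @ T # Ts2))"
    using Cons by auto
  obtain k where k: "rep_carrier G k S" using Cons.prems by auto
  obtain m where m: "rep_carrier G m (direct_sum_rep (Ts1 @ Ts2))"
    using direct_sum_rep_carrier[of "Ts1 @ Ts2" G] Cons.prems by auto
  have T_sum: "is_direct_sum G e T m (direct_sum_rep (Ts1 @ Ts2)) (direct_sum_rep (T # Ts1 @ Ts2))"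
    using T m by (rule direct_sum_rep_Cons)
  have S_sum: "is_direct_sum G k S m (direct_sum_rep (Ts1 @ Ts2)) (direct_sum_rep (S # Ts1 @ Ts2))"
    using k m by (rule direct_sum_rep_Cons)
  have nc: "rep_carrier G n (direct_sum_rep (T # Ts1 @ Ts2))" "rep_carrier G n (direct_sum_rep (Ts1 @ T # Ts2))"
    using n intertwiner_carrier(4,5) unfolding embeds_def by blast+
  have n_eq: "n = e + m"
    using rep_carrier_unique[OF G nc(1)] is_direct_sum_carrier[OF T_sum] by blast
  have ST_sum: "is_direct_sum G k S (e + m) (direct_sum_rep (T # Ts1 @ Ts2)) (direct_sum_rep (S # T # Ts1 @ Ts2))"
    using k is_direct_sum_carrier[OF T_sum] by (rule direct_sum_rep_Cons)
  have TS_sum: "is_direct_sum G e T (k + m) (direct_sum_rep (S # Ts1 @ Ts2)) (direct_sum_rep (T # S # Ts1 @ Ts2))"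
    using T is_direct_sum_carrier[OF S_sum] by (rule direct_sum_rep_Cons)
  have "embeds G (e + (k + m)) (direct_sum_rep (T # S # Ts1 @ Ts2)) (k + (e + m)) (direct_sum_rep (S # T # Ts1 @ Ts2))"
    by (rule embeds_direct_sum_swap[OF TS_sum S_sum ST_sum T_sum])
  moreover have "embeds G (k + (e + m)) (direct_sum_rep (S # T # Ts1 @ Ts2)) (k + n) (direct_sum_rep (S # Ts1 @ T # Ts2))"
    using n embeds_refl[OF k] n_eq
    by (intro embeds_direct_sum_mono[OF ST_sum direct_sum_rep_Cons[OF k nc(2)]]) simp_all
  ultimately have "embeds G (e + (k + m)) (direct_sum_rep (T # S # Ts1 @ Ts2)) (k + n) (direct_sum_rep (S # Ts1 @ T # Ts2))"
    by (rule embeds_trans[rotated])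
  moreover have "e + (k + m) = k + n" by (simp add: n_eq)
  ultimately show ?case by auto
qed

lemma equivalent_rep_carrier:
  "equivalent_rep G n S T \<Longrightarrow> rep_carrier G n S" "equivalent_rep G n S T \<Longrightarrow> rep_carrier G n T"
  by (auto simp: equivalent_rep_def rep_carrier_def)

lemma equivalent_rep_refl: "rep_carrier G n S \<Longrightarrow> equivalent_rep G n S S"
  by (rule embeds_imp_equivalent_rep) (rule embeds_refl)

text \<open>A greedy matching: the first summand of \<open>Ss\<close> finds an equivalent partner in
  \<open>Ts\<close>, both are removed and the induction continues. The partner is brought to the
  front first, since direct sums are built from the head.\<close>

lemma embeds_direct_sum_of_counts:
  assumes G: "group G"
    and Ss: "\<forall>S \<in> set Ss. \<exists>d. irreducible_rep G c d S" and Ts: "\<forall>S \<in> set Ts. \<exists>d. irreducible_rep G c d S"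
    and count: "\<And>d S. irreducible_rep G c d S \<Longrightarrow>
      length (filter (equivalent_rep G d S) Ss) \<le> length (filter (equivalent_rep G d S) Ts)"
  shows "\<exists>k l. embeds G k (direct_sum_rep Ss) l (direct_sum_rep Ts)"
  using Ss Ts count
proof (induction Ss arbitrary: Ts)
  case Nil
  have "\<forall>S \<in> set Ts. \<exists>d. rep_carrier G d S"
    using Nil irreducible_rep_carrier by blast
  then obtain l where l: "rep_carrier G l (direct_sum_rep Ts)"
    by (rule direct_sum_rep_carrier)
  have "isometry l 0 (0\<^sub>m l 0)"
    by (auto simp: isometry_def intro!: eq_matI)
  with intertwiner_zero[OF rep_carrier_direct_sum_Nil l] show ?case
    unfolding embeds_def by blast
next
  case (Cons S Ss)
  obtain d where S: "irreducible_rep G c d S" using Cons.prems by auto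
  have "equivalent_rep G d S S"
    using S irreducible_rep_carrier equivalent_rep_refl by blast
  then have "Suc (length (filter (equivalent_rep G d S) Ss)) \<le> length (filter (equivalent_rep G d S) Ts)"
    using Cons.prems(3)[OF S] by simp
  then have "0 < length (filter (equivalent_rep G d S) Ts)" by linarith
  then obtain T where T: "T \<in> set Ts" "equivalent_rep G d S T"
    by (auto simp: filter_empty_conv)
  obtain Ts1 Ts2 where Ts: "Ts = Ts1 @ T # Ts2"
    using split_list[OF T(1)] by blast
  \<comment> \<open>An irreducible \<open>R\<close> cannot distinguish the removed pair, so both
    counts drop equally and the inequality survives.\<close>
  have cond: "equivalent_rep G e R S = equivalent_rep G e R T" for e R
  proof -
    have "e = d" if "equivalent_rep G e R S \<or> equivalent_rep G e R T"
      using that rep_carrier_unique[OF G] equivalent_rep_carrier T(2) by blast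
    then show ?thesis
      using T(2) equivalent_rep_trans equivalent_rep_sym by blast
  qed
  have "length (filter (equivalent_rep G e R) Ss) \<le> length (filter (equivalent_rep G e R) (Ts1 @ Ts2))"
    if "irreducible_rep G c e R" for e R
    using Cons.prems(3)[OF that] by (auto simp: Ts cond split: if_splits)
  then obtain k l where kl: "embeds G k (direct_sum_rep Ss) l (direct_sum_rep (Ts1 @ Ts2))"
    using Cons.IH[of "Ts1 @ Ts2"] Cons.prems(1,2) by (auto simp: Ts)
  have c: "rep_carrier G k (direct_sum_rep Ss)" "rep_carrier G l (direct_sum_rep (Ts1 @ Ts2))"
    using kl intertwiner_carrier(4,5) unfolding embeds_def by blast+
  have Sc: "rep_carrier G d S" and Tc: "rep_carrier G d T"
    using T(2) by (rule equivalent_rep_carrier)+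
  note T_sum = direct_sum_rep_Cons[OF Tc c(2)]
  have 1: "embeds G (d + k) (direct_sum_rep (S # Ss)) (d + l) (direct_sum_rep (T # Ts1 @ Ts2))"
    using equivalent_rep_embeds(1)[OF T(2)] kl
    by (rule embeds_direct_sum_mono[OF direct_sum_rep_Cons[OF Sc c(1)] T_sum])
  have "\<forall>S \<in> set (Ts1 @ Ts2). \<exists>e. rep_carrier G e S"
    using Cons.prems(2) irreducible_rep_carrier by (fastforce simp: Ts)
  from embeds_direct_sum_insert[OF G Tc this] obtain n where
    n: "embeds G n (direct_sum_rep (T # Ts1 @ Ts2)) n (direct_sum_rep Ts)"
    unfolding Ts by blast
  then have "n = d + l"
    using rep_carrier_unique[OF G] is_direct_sum_carrier[OF T_sum] intertwiner_carrier(4)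
    unfolding embeds_def by blast
  with n 1 show ?case
    using embeds_trans by blast
qed

section \<open>Kronecker products and ancillas\<close>

lemma dim_kronecker [simp]:
  "dim_row (kronecker A B) = dim_row A * dim_row B" "dim_col (kronecker A B) = dim_col A * dim_col B"
  by (auto simp: kronecker_def)

lemma index_kronecker:
  "i < dim_row A * dim_row B \<Longrightarrow> j < dim_col A * dim_col B \<Longrightarrow>
    kronecker A B $$ (i, j) = A $$ (i div dim_row B, j div dim_col B) * B $$ (i mod dim_row B, j mod dim_col B)"
  by (auto simp: kronecker_def)

lemma div_mod_less:
  assumes "i < m * (r :: nat)"
  shows "i div r < m" "i mod r < r"
proof -
  have "r > 0" using assms by (cases r) auto
  then show "i div r < m" "i mod r < r"
    using assms by (auto simp: less_mult_imp_div_less)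
qed

lemma sum_div_mod:
  "(\<Sum>p < m * r. f (p div r) (p mod r)) = (\<Sum>x < m. \<Sum>y < (r :: nat). f x y :: complex)"
proof -
  have "x * r + y < m * r" if "x < m" "y < r" for x y
  proof -
    have "x * r + y < (x + 1) * r" using that by simp
    also have "\<dots> \<le> m * r" using that by (intro mult_le_mono1) simp
    finally show ?thesis .
  qed
  then show ?thesis
    unfolding sum.cartesian_product
    by (intro sum.reindex_bij_witness[of _ "\<lambda>(x, y). x * r + y" "\<lambda>p. (p div r, p mod r)"])
      (auto simp: div_mod_less)
qed

lemma kronecker_mult:
  assumes "dim_col A = dim_row C" "dim_col B = dim_row D"
  shows "kronecker A B * kronecker C D = kronecker (A * C) (B * D)"
proof (rule eq_matI)
  fix i j assume "i < dim_row (kronecker (A * C) (B * D))" "j < dim_col (kronecker (A * C) (B * D))"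
  then have i: "i < dim_row A * dim_row B" and j: "j < dim_col C * dim_col D" by auto
  note ij = div_mod_less[OF i] div_mod_less[OF j]
  have "(kronecker A B * kronecker C D) $$ (i, j) =
      (\<Sum>p < dim_row C * dim_row D. (A $$ (i div dim_row B, p div dim_row D) * B $$ (i mod dim_row B, p mod dim_row D))
        * (C $$ (p div dim_row D, j div dim_col D) * D $$ (p mod dim_row D, j mod dim_col D)))"
    using i j assms by (auto simp: scalar_prod_def index_kronecker lessThan_atLeast0 intro!: sum.cong)
  also have "\<dots> = (\<Sum>x < dim_row C. \<Sum>y < dim_row D.
      (A $$ (i div dim_row B, x) * B $$ (i mod dim_row B, y)) * (C $$ (x, j div dim_col D) * D $$ (y, j mod dim_col D)))"
    by (rule sum_div_mod)
  also have "\<dots> = (\<Sum>x < dim_row C. A $$ (i div dim_row B, x) * C $$ (x, j div dim_col D))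
      * (\<Sum>y < dim_row D. B $$ (i mod dim_row B, y) * D $$ (y, j mod dim_col D))"
    by (simp add: sum_product mult_ac)
  also have "\<dots> = kronecker (A * C) (B * D) $$ (i, j)"
    using i j ij assms by (simp add: index_kronecker scalar_prod_def lessThan_atLeast0)
  finally show "(kronecker A B * kronecker C D) $$ (i, j) = kronecker (A * C) (B * D) $$ (i, j)" .
qed auto

lemma kronecker_adjoint: "(kronecker A B)\<^sup>\<dagger> = kronecker (A\<^sup>\<dagger>) (B\<^sup>\<dagger>)"
  by (rule eq_matI) (auto simp: index_kronecker div_mod_less)

lemma kronecker_one: "kronecker (1\<^sub>m n) (1\<^sub>m r) = 1\<^sub>m (n * r)"
proof (rule eq_matI)
  fix i j assume "i < dim_row (1\<^sub>m (n * r) :: complex mat)" "j < dim_col (1\<^sub>m (n * r) :: complex mat)"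
  then show "kronecker (1\<^sub>m n) (1\<^sub>m r) $$ (i, j) = 1\<^sub>m (n * r) $$ (i, j)"
    by (simp add: index_kronecker div_mod_less) (metis div_mult_mod_eq)
qed auto

lemma kronecker_zero: "kronecker A (0\<^sub>m k l) = 0\<^sub>m (dim_row A * k) (dim_col A * l)"
  by (rule eq_matI) (auto simp: index_kronecker div_mod_less)

lemma kronecker_add_right:
  "dim_row B = dim_row C \<Longrightarrow> dim_col B = dim_col C \<Longrightarrow> kronecker A (B + C) = kronecker A B + kronecker A C"
  by (rule eq_matI) (auto simp: index_kronecker div_mod_less distrib_left)

lemma kronecker_smult: "kronecker (k \<cdot>\<^sub>m A) B = k \<cdot>\<^sub>m kronecker A B"
  by (rule eq_matI) (auto simp: index_kronecker div_mod_less)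

lemma kronecker_one_right: "kronecker A (1\<^sub>m 1) = A"
  by (rule eq_matI) (auto simp: index_kronecker)

section \<open>Representations extended by a trivially acted-on ancilla\<close>

lemma proj_rep_with_ancilla:
  assumes "proj_rep G c n U" "group G"
  shows "proj_rep G c (n * r) (with_ancilla r U)"
proof -
  interpret group G by fact
  have "unitary_mat (n * r) (with_ancilla r U g)" if "g \<in> carrier G" for g
  proof -
    have "unitary_mat n (U g)" using assms that by (auto simp: proj_rep_def)
    note s = unitary_mat_simps[OF this]
    show ?thesis
      by (rule isometry_square)
        (auto simp: isometry_def with_ancilla_def kronecker_adjoint kronecker_mult s kronecker_one intro!: carrier_matI)
  qed
  moreover have "with_ancilla r U g * with_ancilla r U h = c g h \<cdot>\<^sub>m with_ancilla r U (g \<otimes>\<^bsub>G\<^esub> h)"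
    if "g \<in> carrier G" "h \<in> carrier G" for g h
  proof -
    have "U g * U h = c g h \<cdot>\<^sub>m U (g \<otimes>\<^bsub>G\<^esub> h)" and "unitary_mat n (U g)" "unitary_mat n (U h)"
      using assms that by (auto simp: proj_rep_def)
    then show ?thesis
      by (simp add: with_ancilla_def kronecker_mult unitary_mat_simps kronecker_smult)
  qed
  ultimately show ?thesis
    using assms by (auto simp: proj_rep_def)
qed

text \<open>Operators on the ancilla alone commute with the group action, also when they change the
  dimension of the ancilla.\<close>

lemma ancilla_intertwiner:
  assumes U: "rep_carrier G n U" and A: "A \<in> carrier_mat s r"
  shows "intertwiner G (n * r) (with_ancilla r U) (n * s) (with_ancilla s U) (kronecker (1\<^sub>m n) A)"
proof -
  have c: "rep_carrier G (n * t) (with_ancilla t U)" for t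
    using rep_carrier_dim[OF U] by (auto simp: rep_carrier_def with_ancilla_def intro!: carrier_matI)
  have "with_ancilla s U g * kronecker (1\<^sub>m n) A = kronecker (1\<^sub>m n) A * with_ancilla r U g"
    if "g \<in> carrier G" for g
    using rep_carrier_dim[OF U that] A by (simp add: with_ancilla_def kronecker_mult mat_mult_one_dim)
  then show ?thesis
    using c A by (auto simp: intertwiner_def intro!: carrier_matI)
qed

lemma with_ancilla_one: "with_ancilla 1 U = U"
  by (rule ext) (simp only: with_ancilla_def kronecker_one_right)

lemma ancilla_isometry:
  assumes "isometry s r A"
  shows "isometry (n * s) (n * r) (kronecker (1\<^sub>m n) A)"
  using assms by (auto simp: isometry_def kronecker_adjoint kronecker_mult kronecker_one intro!: carrier_matI)

text \<open>Every basis vector of the ancilla carries its own copy of \<open>U\<close>, so summands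
  that only fit into \<open>U\<close> one at a time can be placed in different, mutually orthogonal
  copies.\<close>

lemma embeds_with_ancilla:
  assumes G: "group G" and U: "rep_carrier G n U"
    and Ss: "\<forall>S \<in> set Ss. \<exists>d. embeds G d S n U" and r: "length Ss \<le> r"
  shows "\<exists>k. embeds G k (direct_sum_rep Ss) (n * r) (with_ancilla r U)"
  using Ss r
proof (induction Ss arbitrary: r)
  case Nil
  have "rep_carrier G (n * r) (with_ancilla r U)"
    using rep_carrier_dim[OF U] by (auto simp: rep_carrier_def with_ancilla_def intro!: carrier_matI)
  then have "intertwiner G 0 (direct_sum_rep []) (n * r) (with_ancilla r U) (0\<^sub>m (n * r) 0)"
    by (rule intertwiner_zero[OF rep_carrier_direct_sum_Nil])
  moreover have "isometry (n * r) 0 (0\<^sub>m (n * r) 0)"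
    by (auto simp: isometry_def intro!: eq_matI)
  ultimately show ?case unfolding embeds_def by blast
next
  case (Cons S Ss)
  then obtain r' where r: "r = 1 + r'" "length Ss \<le> r'"
    by (cases r) auto
  obtain k J where J: "isometry (n * r') k J" "intertwiner G k (direct_sum_rep Ss) (n * r') (with_ancilla r' U) J"
    using Cons r unfolding embeds_def by force
  obtain d X where X: "isometry n d X" "intertwiner G d S n U X"
    using Cons.prems unfolding embeds_def by auto
  \<comment> \<open>\<open>A\<close> is the copy of \<open>U\<close> at the first ancilla coordinate
    and \<open>B\<close> the part belonging to the remaining ones.\<close>
  define A where "A = kronecker (1\<^sub>m n) (inj1 1 r')"
  define B where "B = kronecker (1\<^sub>m n) (inj2 1 r')"
  have A: "isometry (n * r) n A" "intertwiner G n U (n * r) (with_ancilla r U) A"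
    using ancilla_isometry[OF isometry_inj(1), of n 1 r'] with_ancilla_one[of U]
      ancilla_intertwiner[OF U, of "inj1 1 r'" r 1]
    by (simp_all add: A_def r carrier_matI)
  have B: "isometry (n * r) (n * r') B" "intertwiner G (n * r') (with_ancilla r' U) (n * r) (with_ancilla r U) B"
    using ancilla_isometry[OF isometry_inj(2), of n 1 r'] ancilla_intertwiner[OF U, of "inj2 1 r'" r r']
    by (simp_all add: B_def r carrier_matI)
  have AB: "A\<^sup>\<dagger> * B = 0\<^sub>m n (n * r')"
    by (simp add: A_def B_def kronecker_adjoint kronecker_mult kronecker_zero)
  have "(A * X)\<^sup>\<dagger> * (B * J) = 0\<^sub>m d k"
    using intertwiner_carrier(2,3)[OF A(2)] intertwiner_carrier(2,3)[OF B(2)]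
      intertwiner_carrier(2,3)[OF X(2)] intertwiner_carrier(2,3)[OF J(2)]
    by (simp add: mat_dim_simps mat_mult_cancel_dim[OF AB])
  with embeds_direct_sum[OF direct_sum_rep_Cons[OF intertwiner_carrier(4)[OF X(2)] intertwiner_carrier(4)[OF J(2)]]
      intertwiner_mult[OF A(2) X(2)] isometry_mult[OF A(1) X(1)]
      intertwiner_mult[OF B(2) J(2)] isometry_mult[OF B(1) J(1)]]
  show ?case by blast
qed

text \<open>Compressing \<open>X\<close> to one ancilla coordinate gives an intertwiner into
  \<open>U\<close>, hence zero. The compressions determine \<open>X\<close>.\<close>

lemma ancilla_intertwiner_zero:
  assumes U: "rep_carrier G n U" and zero: "\<And>X. intertwiner G d S n U X \<Longrightarrow> X = 0\<^sub>m n d"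
  shows "intertwiner G d S (n * r) (with_ancilla r U) X \<Longrightarrow> X = 0\<^sub>m (n * r) d"
proof (induction r arbitrary: X)
  case 0
  then show ?case by (auto intro!: eq_matI dest: intertwiner_carrier(2,3))
next
  case (Suc r)
  define A where "A = kronecker (1\<^sub>m n) (inj1 1 r)"
  define B where "B = kronecker (1\<^sub>m n) (inj2 1 r)"
  have [simp]: "dim_row A = n * (1 + r)" "dim_col A = n" "dim_row B = n * (1 + r)" "dim_col B = n * r"
    by (simp_all add: A_def B_def)
  have dX: "dim_row X = n * (1 + r)" "dim_col X = d"
    using intertwiner_carrier(2,3)[OF Suc.prems] by simp_all
  have "intertwiner G (n * (1 + r)) (with_ancilla (1 + r) U) (n * 1) (with_ancilla 1 U) (A\<^sup>\<dagger>)"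
    unfolding A_def kronecker_adjoint mat_adjoint_one
    by (rule ancilla_intertwiner[OF U]) (auto intro: carrier_matI)
  then have "intertwiner G (n * (1 + r)) (with_ancilla (1 + r) U) n U (A\<^sup>\<dagger>)"
    using with_ancilla_one[of U] by simp
  from zero[OF intertwiner_mult[OF this]] have A: "A\<^sup>\<dagger> * X = 0\<^sub>m n d"
    using Suc.prems by simp
  have "intertwiner G (n * (1 + r)) (with_ancilla (1 + r) U) (n * r) (with_ancilla r U) (B\<^sup>\<dagger>)"
    unfolding B_def kronecker_adjoint mat_adjoint_one
    by (rule ancilla_intertwiner[OF U]) (auto intro: carrier_matI)
  from Suc.IH[OF intertwiner_mult[OF this]] have B: "B\<^sup>\<dagger> * X = 0\<^sub>m (n * r) d"
    using Suc.prems by simp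
  have "A * A\<^sup>\<dagger> + B * B\<^sup>\<dagger> = kronecker (1\<^sub>m n) (inj1 1 r * (inj1 1 r)\<^sup>\<dagger> + inj2 1 r * (inj2 1 r)\<^sup>\<dagger>)"
    by (simp add: A_def B_def kronecker_adjoint kronecker_mult kronecker_add_right)
  then have "X = (A * A\<^sup>\<dagger> + B * B\<^sup>\<dagger>) * X"
    unfolding inj_complete kronecker_one by (simp add: dX mat_mult_one_dim)
  also have "\<dots> = A * (A\<^sup>\<dagger> * X) + B * (B\<^sup>\<dagger> * X)"
    by (simp add: mat_distrib_right_dim mat_mult_assoc_dim dX)
  also have "\<dots> = 0\<^sub>m (n * Suc r) d"
    unfolding A B by (simp add: mat_dim_simps)
  finally show ?case .
qed

section \<open>The twisted regular representation\<close>

text \<open>Both sides are the phase of the product of three operators, bracketed in two ways.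
  Positive dimension allows the comparison of scalars.\<close>

lemma factor_set_cocycle:
  assumes G: "group G" and U: "proj_rep G c n U" and n: "n > 0"
    and g: "g \<in> carrier G" and h: "h \<in> carrier G" and k: "k \<in> carrier G"
  shows "c g h * c (g \<otimes>\<^bsub>G\<^esub> h) k = c h k * c g (h \<otimes>\<^bsub>G\<^esub> k)"
proof -
  interpret group G by fact
  have U_mult: "U x * U y = c x y \<cdot>\<^sub>m U (x \<otimes>\<^bsub>G\<^esub> y)" if "x \<in> carrier G" "y \<in> carrier G" for x y
    using U that by (auto simp: proj_rep_def)
  have U_un: "unitary_mat n (U x)" if "x \<in> carrier G" for x
    using U that by (auto simp: proj_rep_def)
  define x where "x = g \<otimes>\<^bsub>G\<^esub> h \<otimes>\<^bsub>G\<^esub> k"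
  have x: "x \<in> carrier G" "x = g \<otimes>\<^bsub>G\<^esub> (h \<otimes>\<^bsub>G\<^esub> k)"
    using g h k by (auto simp: x_def m_assoc)
  note d = unitary_mat_simps(2,3)[OF U_un[OF g]] unitary_mat_simps(2,3)[OF U_un[OF h]]
    unitary_mat_simps(2,3)[OF U_un[OF k]] unitary_mat_simps(2-5)[OF U_un[OF x(1)]]
    unitary_mat_simps(2,3)[OF U_un[OF m_closed[OF g h]]] unitary_mat_simps(2,3)[OF U_un[OF m_closed[OF h k]]]
  have "U g * U h * U k = (c g h * c (g \<otimes>\<^bsub>G\<^esub> h) k) \<cdot>\<^sub>m U x"
    using g h k by (simp add: U_mult mat_smult_left_dim d x_def)
  moreover have "U g * (U h * U k) = (c h k * c g (h \<otimes>\<^bsub>G\<^esub> k)) \<cdot>\<^sub>m U x"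
    using g h k by (simp add: U_mult mat_smult_right_dim d x(2))
  ultimately have "(c g h * c (g \<otimes>\<^bsub>G\<^esub> h) k) \<cdot>\<^sub>m U x = (c h k * c g (h \<otimes>\<^bsub>G\<^esub> k)) \<cdot>\<^sub>m U x"
    by (simp add: mat_mult_assoc_dim d)
  then have "((c g h * c (g \<otimes>\<^bsub>G\<^esub> h) k) \<cdot>\<^sub>m U x) * (U x)\<^sup>\<dagger> = ((c h k * c g (h \<otimes>\<^bsub>G\<^esub> k)) \<cdot>\<^sub>m U x) * (U x)\<^sup>\<dagger>"
    by simp
  then have "(c g h * c (g \<otimes>\<^bsub>G\<^esub> h) k) \<cdot>\<^sub>m 1\<^sub>m n = (c h k * c g (h \<otimes>\<^bsub>G\<^esub> k)) \<cdot>\<^sub>m 1\<^sub>m n"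
    by (simp add: mat_smult_left_dim d)
  then have "((c g h * c (g \<otimes>\<^bsub>G\<^esub> h) k) \<cdot>\<^sub>m 1\<^sub>m n) $$ (0, 0) = ((c h k * c g (h \<otimes>\<^bsub>G\<^esub> k)) \<cdot>\<^sub>m 1\<^sub>m n) $$ (0, 0)"
    by simp
  with n show ?thesis by simp
qed

text \<open>\<open>R\<close> is the left regular representation twisted by \<open>c\<close>, and
  \<open>e\<close> its orthonormal basis indexed by the group. The last clause says that this basis
  is complete. The enumeration of the group that the matrices require is thereby hidden from later
  use.\<close>

definition regular_rep_basis :: "('g, 'x) monoid_scheme \<Rightarrow> ('g \<Rightarrow> 'g \<Rightarrow> complex)
    \<Rightarrow> ('g \<Rightarrow> complex mat) \<Rightarrow> ('g \<Rightarrow> complex mat) \<Rightarrow> bool" where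
  "regular_rep_basis G c R e \<longleftrightarrow> proj_rep G c (card (carrier G)) R \<and>
     (\<forall>g \<in> carrier G. e g \<in> carrier_mat (card (carrier G)) 1) \<and>
     (\<forall>g \<in> carrier G. \<forall>h \<in> carrier G. (e g)\<^sup>\<dagger> * e h = (if g = h then 1\<^sub>m 1 else 0\<^sub>m 1 1)) \<and>
     (\<forall>g \<in> carrier G. \<forall>h \<in> carrier G. R g * e h = c g h \<cdot>\<^sub>m e (g \<otimes>\<^bsub>G\<^esub> h)) \<and>
     (\<forall>d. \<forall>X \<in> carrier_mat (card (carrier G)) d.
        (\<forall>g \<in> carrier G. (e g)\<^sup>\<dagger> * X = 0\<^sub>m 1 d) \<longrightarrow> X = 0\<^sub>m (card (carrier G)) d)"

lemma regular_rep_exists: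
  fixes c :: "'g \<Rightarrow> 'g \<Rightarrow> complex"
  assumes G: "group G" and fin: "finite (carrier G)" and U: "proj_rep G c n U" and n: "n > 0"
  obtains R e where "regular_rep_basis G c R e"
proof -
  interpret group G by fact
  define N where "N = card (carrier G)"
  obtain x where x: "bij_betw x {..<N} (carrier G)"
    using ex_bij_betw_nat_finite[OF fin] by (auto simp: N_def lessThan_atLeast0)
  define p where "p = inv_into {..<N} x"
  have p: "p g < N" "x (p g) = g" if "g \<in> carrier G" for g
    using bij_betw_inv_into_right[OF x that] bij_betw_apply[OF bij_betw_inv_into[OF x] that]
    by (auto simp: p_def)
  have xc: "x i \<in> carrier G" and px: "p (x i) = i" if "i < N" for i
    using bij_betw_apply[OF x] bij_betw_inv_into_left[OF x] that by (auto simp: p_def)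
  have p_inj: "p g = p h \<longleftrightarrow> g = h" if "g \<in> carrier G" "h \<in> carrier G" for g h
    using p(2)[OF that(1)] p(2)[OF that(2)] by metis
  have x_inj: "x i = x j \<longleftrightarrow> i = j" if "i < N" "j < N" for i j
    using px[OF that(1)] px[OF that(2)] by metis
  define e :: "'g \<Rightarrow> complex mat" where "e g = mat N 1 (\<lambda>(i, _). if i = p g then 1 else 0)" for g
  \<comment> \<open>Column \<open>j\<close> belongs to the group element \<open>x j\<close>. Each
    column has one nonzero entry, of modulus one, and left translation puts these in distinct rows;
    hence \<open>R g\<close> is unitary.\<close>
  define R where "R g = mat N N (\<lambda>(i, j). if i = p (g \<otimes>\<^bsub>G\<^esub> x j) then c g (x j) else 0)" for g
  have Rd: "dim_row (R g) = N" "dim_col (R g) = N" for g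
    by (simp_all add: R_def)
  have c1: "cmod (c g h) = 1" if "g \<in> carrier G" "h \<in> carrier G" for g h
    using U that by (auto simp: proj_rep_def factor_set_def)
  have "unitary_mat N (R g)" if g: "g \<in> carrier G" for g
  proof (rule isometry_square)
    have "(R g)\<^sup>\<dagger> * R g = 1\<^sub>m N"
    proof (rule eq_matI)
      fix i j assume "i < dim_row (1\<^sub>m N :: complex mat)" "j < dim_col (1\<^sub>m N :: complex mat)"
      then have ij: "i < N" "j < N" by auto
      have "((R g)\<^sup>\<dagger> * R g) $$ (i, j) = (\<Sum>l = 0..<N. cnj (R g $$ (l, i)) * R g $$ (l, j))"
        using ij Rd by (simp add: scalar_prod_def)
      also have "\<dots> = (\<Sum>l = 0..<N. if l = p (g \<otimes>\<^bsub>G\<^esub> x j) then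
          (if p (g \<otimes>\<^bsub>G\<^esub> x i) = p (g \<otimes>\<^bsub>G\<^esub> x j) then cnj (c g (x i)) * c g (x j) else 0) else 0)"
        using ij by (intro sum.cong) (auto simp: R_def)
      also have "\<dots> = (if i = j then cnj (c g (x i)) * c g (x i) else 0)"
        using ij g p(1)[of "g \<otimes>\<^bsub>G\<^esub> x j"] xc x_inj by (auto simp: p_inj)
      also have "\<dots> = 1\<^sub>m N $$ (i, j)"
        using ij c1[OF g xc[OF ij(1)]] complex_norm_square[of "c g (x i)"] by (auto simp: mult.commute)
      finally show "((R g)\<^sup>\<dagger> * R g) $$ (i, j) = 1\<^sub>m N $$ (i, j)" .
    qed (auto simp: R_def)
    then show "isometry N N (R g)" by (auto simp: isometry_def R_def)
  qed
  moreover have "R g * R h = c g h \<cdot>\<^sub>m R (g \<otimes>\<^bsub>G\<^esub> h)" if g: "g \<in> carrier G" and h: "h \<in> carrier G" for g h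
  proof (rule eq_matI)
    fix i j assume "i < dim_row (c g h \<cdot>\<^sub>m R (g \<otimes>\<^bsub>G\<^esub> h))" "j < dim_col (c g h \<cdot>\<^sub>m R (g \<otimes>\<^bsub>G\<^esub> h))"
    then have ij: "i < N" "j < N" by (auto simp: R_def)
    have hx: "h \<otimes>\<^bsub>G\<^esub> x j \<in> carrier G" using h xc ij by auto
    have "(R g * R h) $$ (i, j) = (\<Sum>l = 0..<N. R g $$ (i, l) * R h $$ (l, j))"
      using ij Rd by (simp add: scalar_prod_def)
    also have "\<dots> = (\<Sum>l = 0..<N. if l = p (h \<otimes>\<^bsub>G\<^esub> x j) then
        (if i = p (g \<otimes>\<^bsub>G\<^esub> x l) then c g (x l) * c h (x j) else 0) else 0)"
      using ij by (intro sum.cong) (auto simp: R_def)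
    also have "\<dots> = (if i = p (g \<otimes>\<^bsub>G\<^esub> (h \<otimes>\<^bsub>G\<^esub> x j)) then c h (x j) * c g (h \<otimes>\<^bsub>G\<^esub> x j) else 0)"
      using p[OF hx] by auto
    \<comment> \<open>Compatibility of the phases with multiplication is exactly the cocycle
      identity.\<close>
    also have "\<dots> = (c g h \<cdot>\<^sub>m R (g \<otimes>\<^bsub>G\<^esub> h)) $$ (i, j)"
      using ij factor_set_cocycle[OF G U n g h xc[OF ij(2)]] by (auto simp: R_def m_assoc g h xc)
    finally show "(R g * R h) $$ (i, j) = (c g h \<cdot>\<^sub>m R (g \<otimes>\<^bsub>G\<^esub> h)) $$ (i, j)" .
  qed (auto simp: R_def)
  ultimately have "proj_rep G c N R"
    using U by (auto simp: proj_rep_def)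
  moreover have "(e g)\<^sup>\<dagger> * e h = (if g = h then 1\<^sub>m 1 else 0\<^sub>m 1 1)" if "g \<in> carrier G" "h \<in> carrier G" for g h
    using that p(1) p_inj by (auto intro!: eq_matI simp: e_def scalar_prod_def if_distrib cong: if_cong)
  moreover have "R g * e h = c g h \<cdot>\<^sub>m e (g \<otimes>\<^bsub>G\<^esub> h)" if "g \<in> carrier G" "h \<in> carrier G" for g h
  proof (rule eq_matI)
    fix i j assume "i < dim_row (c g h \<cdot>\<^sub>m e (g \<otimes>\<^bsub>G\<^esub> h))" "j < dim_col (c g h \<cdot>\<^sub>m e (g \<otimes>\<^bsub>G\<^esub> h))"
    then have ij: "i < N" "j = 0" by (auto simp: e_def)
    have "(R g * e h) $$ (i, j) = (\<Sum>l = 0..<N. R g $$ (i, l) * e h $$ (l, 0))"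
      using ij by (simp add: scalar_prod_def e_def R_def)
    also have "\<dots> = (\<Sum>l = 0..<N. if l = p h then (if i = p (g \<otimes>\<^bsub>G\<^esub> h) then c g h else 0) else 0)"
      using ij that p by (intro sum.cong) (auto simp: R_def e_def)
    also have "\<dots> = (c g h \<cdot>\<^sub>m e (g \<otimes>\<^bsub>G\<^esub> h)) $$ (i, j)"
      using ij that p by (auto simp: e_def)
    finally show "(R g * e h) $$ (i, j) = (c g h \<cdot>\<^sub>m e (g \<otimes>\<^bsub>G\<^esub> h)) $$ (i, j)" .
  qed (auto simp: e_def R_def)
  moreover have "X = 0\<^sub>m N d" if X: "X \<in> carrier_mat N d" and zero: "\<And>g. g \<in> carrier G \<Longrightarrow> (e g)\<^sup>\<dagger> * X = 0\<^sub>m 1 d" for X d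
  proof (rule eq_matI)
    fix i j assume "i < dim_row (0\<^sub>m N d :: complex mat)" "j < dim_col (0\<^sub>m N d :: complex mat)"
    then have ij: "i < N" "j < d" by auto
    have "((e (x i))\<^sup>\<dagger> * X) $$ (0, j) = (\<Sum>l = 0..<N. cnj (e (x i) $$ (l, 0)) * X $$ (l, j))"
      using ij X by (simp add: scalar_prod_def e_def)
    also have "\<dots> = (\<Sum>l = 0..<N. if l = i then X $$ (l, j) else 0)"
      using ij X px[OF ij(1)] by (intro sum.cong) (auto simp: e_def)
    finally have "((e (x i))\<^sup>\<dagger> * X) $$ (0, j) = (\<Sum>l = 0..<N. if l = i then X $$ (l, j) else 0)" .
    with zero[OF xc[OF ij(1)]] ij show "X $$ (i, j) = 0\<^sub>m N d $$ (i, j)" by simp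
  qed (use X in auto)
  ultimately show ?thesis
    by (intro that[of R e]) (auto simp: regular_rep_basis_def N_def[symmetric] e_def)
qed

text \<open>Up to phases the basis is the orbit of the vector at the unit. So an intertwiner into
  \<open>R\<close> is determined by its row at the unit, which has only \<open>d\<close>
  entries.\<close>

lemma regular_rep_hom_dim_le:
  assumes G: "group G" and R: "regular_rep_basis G c R e"
    and S: "irreducible_rep G c d S" and f: "hom_coordinates G d S (card (carrier G)) R m f"
  shows "m \<le> d"
proof -
  interpret group G by fact
  define N where "N = card (carrier G)"
  have R_rep: "proj_rep G c N R" and e: "\<And>g. g \<in> carrier G \<Longrightarrow> e g \<in> carrier_mat N 1"
    and Re: "\<And>g h. g \<in> carrier G \<Longrightarrow> h \<in> carrier G \<Longrightarrow> R g * e h = c g h \<cdot>\<^sub>m e (g \<otimes>\<^bsub>G\<^esub> h)"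
    and sep: "\<And>k X. X \<in> carrier_mat N k \<Longrightarrow> (\<And>g. g \<in> carrier G \<Longrightarrow> (e g)\<^sup>\<dagger> * X = 0\<^sub>m 1 k) \<Longrightarrow> X = 0\<^sub>m N k"
    using R by (auto simp: regular_rep_basis_def N_def)
  have f: "hom_coordinates G d S N R m f" using f by (simp add: N_def)
  have lin: "linear_on_columns m N d f" and inj: "kernel_free m N d f"
    using f unfolding hom_coordinates_def by blast+
  note l = linear_on_columnsD[OF lin]
  define v where "v = e \<one>\<^bsub>G\<^esub>"
  have v: "dim_row v = N" "dim_col v = 1"
    using e[OF one_closed] by (auto simp: v_def)
  \<comment> \<open>The transpose turns that row into a column without losing linearity in
    \<open>a\<close>.\<close>
  define h where "h a = transpose_mat (v\<^sup>\<dagger> * f a)" for a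
  have "linear_on_columns m d 1 h"
    unfolding linear_on_columns_def
  proof (intro conjI ballI allI)
    fix a b :: "complex mat" and k assume a: "a \<in> carrier_mat m 1"
    show "h a \<in> carrier_mat d 1" using l(2,3)[OF a] v by (auto simp: h_def)
    have "v\<^sup>\<dagger> * f (k \<cdot>\<^sub>m a) = k \<cdot>\<^sub>m (v\<^sup>\<dagger> * f a)"
      unfolding l(5)[OF a] using l(2)[OF a] v by (intro mat_smult_right_dim) simp
    then show "h (k \<cdot>\<^sub>m a) = k \<cdot>\<^sub>m h a"
      by (auto simp: h_def intro!: eq_matI)
    assume b: "b \<in> carrier_mat m 1"
    have "v\<^sup>\<dagger> * f (a + b) = v\<^sup>\<dagger> * f a + v\<^sup>\<dagger> * f b"
      unfolding l(4)[OF a b] using v l(2,3)[OF a] l(2,3)[OF b] by (intro mat_distrib_left_dim) simp_all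
    then show "h (a + b) = h a + h b"
      using l(3)[OF a] l(3)[OF b] by (auto simp: h_def intro!: eq_matI)
  qed
  moreover have "kernel_free m d 1 h"
    unfolding kernel_free_def
  proof (intro ballI impI)
    fix a assume a: "a \<in> carrier_mat m 1" "h a = 0\<^sub>m d 1"
    have "transpose_mat (h a) = 0\<^sub>m 1 d" unfolding a(2) by auto
    then have va: "v\<^sup>\<dagger> * f a = 0\<^sub>m 1 d" by (simp add: h_def)
    have "(e g)\<^sup>\<dagger> * f a = 0\<^sub>m 1 d" if g: "g \<in> carrier G" for g
    proof -
      have Rg: "unitary_mat N (R g)" and Sg: "unitary_mat d (S g)"
        and cg: "cmod (c g \<one>\<^bsub>G\<^esub>) = 1"
        using R_rep S g by (auto simp: irreducible_rep_def proj_rep_def factor_set_def)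
      note s = unitary_mat_simps[OF Rg] unitary_mat_simps[OF Sg] v l(2,3)[OF a(1)]
      have "cnj (c g \<one>\<^bsub>G\<^esub>) * c g \<one>\<^bsub>G\<^esub> = 1"
        using cg complex_norm_square[of "c g \<one>\<^bsub>G\<^esub>"] by (simp add: mult.commute)
      then have "e g = cnj (c g \<one>\<^bsub>G\<^esub>) \<cdot>\<^sub>m (R g * v)"
        using Re[OF g one_closed] g by (simp add: v_def)
      then have "(e g)\<^sup>\<dagger> * f a = c g \<one>\<^bsub>G\<^esub> \<cdot>\<^sub>m (v\<^sup>\<dagger> * ((R g)\<^sup>\<dagger> * f a))"
        by (simp add: s mat_mult_assoc_dim mat_smult_left_dim)
      also have "(R g)\<^sup>\<dagger> * f a = (R g)\<^sup>\<dagger> * ((f a * S g) * (S g)\<^sup>\<dagger>)"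
        by (simp add: s mat_mult_assoc_dim mat_mult_one_dim)
      also have "\<dots> = f a * (S g)\<^sup>\<dagger>"
        unfolding intertwinerD[OF hom_coordinates_intertwiner[OF f a(1)] g, symmetric]
        by (simp add: s mat_mult_assoc_dim)
      also have "v\<^sup>\<dagger> * \<dots> = 0\<^sub>m 1 d"
        using s by (simp add: mat_mult_assoc_dim[symmetric] va mat_mult_zero_dim)
      finally show ?thesis by simp
    qed
    then have "f a = 0\<^sub>m N d"
      by (rule sep[OF l(1)[OF a(1)]])
    with inj a(1) show "a = 0\<^sub>m m 1" unfolding kernel_free_def by blast
  qed
  ultimately show ?thesis by (rule linear_kernel_free_le)
qed

text \<open>The multiplicity of \<open>S\<close> in the regular representation is at most
  \<open>d\<close>, hence at most its multiplicity in \<open>U\<close>; the greedy matching does the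
  rest.\<close>

lemma regular_rep_embeds:
  assumes G: "group G" and R: "regular_rep_basis G c R e" and U: "proj_rep G c n U"
    and mult: "\<And>d S. irreducible_rep G c d S \<Longrightarrow> d \<le> multiplicity_rep G c n U d S"
  shows "embeds G (card (carrier G)) R n U"
proof -
  define N where "N = card (carrier G)"
  have R_rep: "proj_rep G c N R"
    using R by (auto simp: regular_rep_basis_def N_def)
  obtain Ss where Ss: "irreducible_decomposition G c N R Ss"
    using irreducible_decomposition_exists[OF G R_rep] by blast
  obtain Ts where Ts: "irreducible_decomposition G c n U Ts"
    using irreducible_decomposition_exists[OF G U] by blast
  have "length (filter (equivalent_rep G d S) Ss) \<le> length (filter (equivalent_rep G d S) Ts)"
    if S: "irreducible_rep G c d S" for d S
  proof -
    obtain f where "hom_coordinates G d S N R (length (filter (equivalent_rep G d S) Ss)) f"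
      using hom_coordinates_decomposition[OF G S Ss] by blast
    then have "length (filter (equivalent_rep G d S) Ss) \<le> d"
      using regular_rep_hom_dim_le[OF G R S] by (simp add: N_def)
    with mult[OF S] show ?thesis
      by (simp add: multiplicity_rep_decomposition[OF G S Ts])
  qed
  then obtain k l where kl: "embeds G k (direct_sum_rep Ss) l (direct_sum_rep Ts)"
    using embeds_direct_sum_of_counts[OF G, of Ss c Ts] Ss Ts
    unfolding irreducible_decomposition_def by blast
  have eqs: "equivalent_rep G N (direct_sum_rep Ss) R" "equivalent_rep G n (direct_sum_rep Ts) U"
    using Ss Ts unfolding irreducible_decomposition_def by blast+
  have "k = N" "l = n"
    using kl intertwiner_carrier(4,5) rep_carrier_unique[OF G] equivalent_rep_carrier(1)[OF eqs(1)]
      equivalent_rep_carrier(1)[OF eqs(2)] unfolding embeds_def by blast+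
  with kl equivalent_rep_embeds(2)[OF eqs(1)] equivalent_rep_embeds(1)[OF eqs(2)]
  show ?thesis
    unfolding N_def using embeds_trans by metis
qed

text \<open>Each irreducible summand of \<open>R\<close> occurs in \<open>U\<close> at least once.
  With one ancilla dimension per summand all of them fit, so \<open>r0\<close> is the number of
  summands of \<open>R\<close>.\<close>

lemma regular_rep_embeds_ancilla:
  assumes G: "group G" and R: "regular_rep_basis G c R e" and U: "proj_rep G c n U"
    and mult: "\<And>d S. irreducible_rep G c d S \<Longrightarrow> 1 \<le> multiplicity_rep G c n U d S"
  obtains r0 where "\<And>r. r0 \<le> r \<Longrightarrow> embeds G (card (carrier G)) R (n * r) (with_ancilla r U)"
proof -
  define N where "N = card (carrier G)"
  have R_rep: "proj_rep G c N R"
    using R by (auto simp: regular_rep_basis_def N_def)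
  obtain Ss where Ss: "irreducible_decomposition G c N R Ss"
    using irreducible_decomposition_exists[OF G R_rep] by blast
  obtain Ts where Ts: "irreducible_decomposition G c n U Ts"
    using irreducible_decomposition_exists[OF G U] by blast
  have eqs: "equivalent_rep G N (direct_sum_rep Ss) R" "equivalent_rep G n (direct_sum_rep Ts) U"
    using Ss Ts unfolding irreducible_decomposition_def by blast+
  have Ts_c: "\<forall>T \<in> set Ts. \<exists>e. rep_carrier G e T"
    using Ts irreducible_rep_carrier unfolding irreducible_decomposition_def by blast
  have "\<exists>d. embeds G d S n U" if "S \<in> set Ss" for S
  proof -
    obtain d where S: "irreducible_rep G c d S"
      using Ss \<open>S \<in> set Ss\<close> unfolding irreducible_decomposition_def by blast
    have "0 < length (filter (equivalent_rep G d S) Ts)"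
      using mult[OF S] unfolding multiplicity_rep_decomposition[OF G S Ts] by linarith
    then obtain T where T: "T \<in> set Ts" "equivalent_rep G d S T"
      by (auto simp: filter_empty_conv)
    have "embeds G d T n (direct_sum_rep Ts)"
      using embeds_direct_sum_member[OF T(1) equivalent_rep_carrier(2)[OF T(2)] Ts_c G]
        equivalent_rep_carrier(1)[OF eqs(2)] by blast
    then show ?thesis
      using equivalent_rep_embeds(1)[OF T(2)] equivalent_rep_embeds(1)[OF eqs(2)] embeds_trans by blast
  qed
  then have emb: "\<exists>k. embeds G k (direct_sum_rep Ss) (n * r) (with_ancilla r U)" if "length Ss \<le> r" for r
    using embeds_with_ancilla[OF G proj_rep_carrier[OF U] _ that] by blast
  have "embeds G N R (n * r) (with_ancilla r U)" if r: "length Ss \<le> r" for r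
  proof -
    obtain k where k: "embeds G k (direct_sum_rep Ss) (n * r) (with_ancilla r U)"
      using emb[OF r] by blast
    then have "k = N"
      using intertwiner_carrier(4) rep_carrier_unique[OF G] equivalent_rep_carrier(1)[OF eqs(1)]
      unfolding embeds_def by blast
    with k equivalent_rep_embeds(2)[OF eqs(1)] show ?thesis
      using embeds_trans by blast
  qed
  then show ?thesis
    by (intro that[of "length Ss"]) (simp add: N_def)
qed

section \<open>Positive semidefinite matrices\<close>

definition form :: "complex mat \<Rightarrow> complex mat \<Rightarrow> complex mat \<Rightarrow> complex" where
  "form A u v = (u\<^sup>\<dagger> * (A * v)) $$ (0, 0)"

lemma psd_mat_iff_form:
  "psd_mat n A \<longleftrightarrow> A \<in> carrier_mat n n \<and> (\<forall>v \<in> carrier_mat n 1. 0 \<le> form A v v)"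
proof -
  have eq: "form A (col_mat v) (col_mat v) = (A *\<^sub>v v) \<bullet>c v"
    if "A \<in> carrier_mat n n" "v \<in> carrier_vec n" for v
    using that by (auto simp: form_def col_mat_mult scalar_prod_def col_mat_def mult.commute intro!: sum.cong)
  have "(\<forall>v \<in> carrier_vec n. 0 \<le> (A *\<^sub>v v) \<bullet>c v) \<longleftrightarrow> (\<forall>v \<in> carrier_mat n 1. 0 \<le> form A v v)"
    if A: "A \<in> carrier_mat n n"
  proof (intro iffI ballI)
    fix v :: "complex mat"
    assume "\<forall>v \<in> carrier_vec n. 0 \<le> (A *\<^sub>v v) \<bullet>c v" and v: "v \<in> carrier_mat n 1"
    then have "0 \<le> form A (col_mat (col v 0)) (col_mat (col v 0))"
      using eq[OF A, of "col v 0"] col_carrier_vec[of 0 1 v n] by simp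
    then show "0 \<le> form A v v"
      using v by (simp only: col_mat_col)
  next
    fix v :: "complex vec"
    assume *: "\<forall>v \<in> carrier_mat n 1. 0 \<le> form A v v" and v: "v \<in> carrier_vec n"
    have "col_mat v \<in> carrier_mat n 1"
      using v by (intro carrier_matI) simp_all
    with * have "0 \<le> form A (col_mat v) (col_mat v)" by blast
    then show "0 \<le> (A *\<^sub>v v) \<bullet>c v"
      using eq[OF A v] by simp
  qed
  then show ?thesis by (auto simp: psd_mat_def)
qed

lemma psd_formD:
  assumes "psd_mat n A" "v \<in> carrier_mat n 1"
  shows "0 \<le> Re (form A v v)" "Im (form A v v) = 0"
  using assms by (auto simp: psd_mat_iff_form less_eq_complex_def)

lemma psd_matI_gram:
  assumes B: "B \<in> carrier_mat m n"
  shows "psd_mat n (B\<^sup>\<dagger> * B)"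
  unfolding psd_mat_iff_form
proof (intro conjI ballI)
  fix v :: "complex mat" assume v: "v \<in> carrier_mat n 1"
  define w where "w = B * v"
  have w: "dim_row w = m" "dim_col w = 1" using B v by (auto simp: w_def)
  have "form (B\<^sup>\<dagger> * B) v v = (w\<^sup>\<dagger> * w) $$ (0, 0)"
    using B v by (simp add: form_def w_def mat_mult_assoc_dim)
  also have "\<dots> = of_real (\<Sum>l<m. (cmod (w $$ (l, 0)))\<^sup>2)"
    using w by (auto simp: scalar_prod_def complex_norm_square lessThan_atLeast0 mult.commute
        simp del: of_real_power intro!: sum.cong)
  finally show "0 \<le> form (B\<^sup>\<dagger> * B) v v"
    by (simp add: less_eq_complex_def sum_nonneg del: of_real_sum of_real_power)
qed (use B in auto)

lemma psd_congruence:
  assumes A: "psd_mat n A" and B: "B \<in> carrier_mat m n"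
  shows "psd_mat m (B * A * B\<^sup>\<dagger>)"
  unfolding psd_mat_iff_form
proof (intro conjI ballI)
  have Ac: "A \<in> carrier_mat n n" using A by (simp add: psd_mat_def)
  show "B * A * B\<^sup>\<dagger> \<in> carrier_mat m m" using Ac B by auto
  fix v :: "complex mat" assume v: "v \<in> carrier_mat m 1"
  have "form (B * A * B\<^sup>\<dagger>) v v = form A (B\<^sup>\<dagger> * v) (B\<^sup>\<dagger> * v)"
    using Ac B v by (auto simp: form_def mat_mult_assoc_dim)
  moreover have "B\<^sup>\<dagger> * v \<in> carrier_mat n 1" using B v by auto
  then have "0 \<le> form A (B\<^sup>\<dagger> * v) (B\<^sup>\<dagger> * v)"
    using A unfolding psd_mat_iff_form by blast
  ultimately show "0 \<le> form (B * A * B\<^sup>\<dagger>) v v" by simp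
qed

text \<open>The values \<open>t = 1\<close> and \<open>t = \<i>\<close> force the cross terms to be
  conjugate; the bound is the discriminant condition along one line in the complex plane.\<close>

lemma nonneg_quadratic:
  fixes a b z w :: complex
  assumes q: "\<And>t. 0 \<le> a + t * z + cnj t * w + t * cnj t * b" and b: "0 \<le> b"
  shows "w = cnj z" and "(cmod z)\<^sup>2 \<le> Re a * Re b"
proof -
  have b': "Im b = 0" "Re b \<ge> 0" using b by (auto simp: less_eq_complex_def)
  have a': "Im a = 0" using q[of 0] by (auto simp: less_eq_complex_def)
  have 1: "Im z + Im w = 0" using q[of 1] a' b' by (auto simp: less_eq_complex_def)
  have 2: "Re z - Re w = 0" using q[of \<i>] a' b' by (auto simp: less_eq_complex_def)
  show w: "w = cnj z" using 1 2 by (auto simp: complex_eq_iff)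
  have z2: "(cmod z)\<^sup>2 = (Re z)\<^sup>2 + (Im z)\<^sup>2" by (rule cmod_power2)
  \<comment> \<open>This choice of \<open>t\<close> makes both cross terms equal to
    \<open>- s\<close> times the squared modulus of \<open>z\<close>.\<close>
  have ineq: "0 \<le> Re a - 2 * s * (cmod z)\<^sup>2 + s\<^sup>2 * (cmod z)\<^sup>2 * Re b" for s :: real
    using q[of "- of_real s * cnj z"] a' b'
    by (simp add: w less_eq_complex_def z2) (simp add: power2_eq_square algebra_simps)
  show "(cmod z)\<^sup>2 \<le> Re a * Re b"
  proof (cases "Re b = 0")
    case True
    have "(cmod z)\<^sup>2 = 0"
    proof (rule ccontr)
      assume "(cmod z)\<^sup>2 \<noteq> 0"
      \<comment> \<open>Without a quadratic term the expression is affine in \<open>s\<close>; this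
        value of \<open>s\<close> brings it down to -1.\<close>
      then have "0 \<le> Re a - 2 * ((Re a + 1) / (2 * (cmod z)\<^sup>2)) * (cmod z)\<^sup>2"
        using ineq[of "(Re a + 1) / (2 * (cmod z)\<^sup>2)"] True by simp
      also have "\<dots> = -1" using \<open>(cmod z)\<^sup>2 \<noteq> 0\<close> by (simp add: field_simps)
      finally show False by simp
    qed
    with True show ?thesis by simp
  next
    case False
    then have bp: "Re b > 0" using b' by simp
    \<comment> \<open>The parameter \<open>1 / Re b\<close> is the minimiser of the
      quadratic.\<close>
    have "0 \<le> Re a - 2 * (1 / Re b) * (cmod z)\<^sup>2 + (1 / Re b)\<^sup>2 * (cmod z)\<^sup>2 * Re b"
      by (rule ineq)
    also have "\<dots> = Re a - (cmod z)\<^sup>2 / Re b"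
      using bp by (simp add: power2_eq_square field_simps)
    finally show ?thesis using bp by (simp add: field_simps)
  qed
qed

text \<open>Nonnegativity of the form at \<open>u + t v\<close> for all complex \<open>t\<close> is
  the quadratic above. It also yields Hermitian symmetry, which \<open>psd_mat\<close> does not
  demand separately.\<close>

lemma psd_cauchy_schwarz:
  assumes A: "psd_mat n A" and u: "u \<in> carrier_mat n 1" and v: "v \<in> carrier_mat n 1"
  shows "form A v u = cnj (form A u v)"
    and "(cmod (form A u v))\<^sup>2 \<le> Re (form A u u) * Re (form A v v)"
proof -
  have Ac: "A \<in> carrier_mat n n" using A by (simp add: psd_mat_def)
  have "form A (u + t \<cdot>\<^sub>m v) (u + t \<cdot>\<^sub>m v) =
      form A u u + t * form A u v + cnj t * form A v u + t * cnj t * form A v v" for t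
    using Ac u v by (simp add: form_def mat_dim_simps) (simp add: algebra_simps)
  moreover have "0 \<le> form A (u + t \<cdot>\<^sub>m v) (u + t \<cdot>\<^sub>m v)" for t
    using A u v unfolding psd_mat_iff_form by (intro bspec[of _ _ "u + t \<cdot>\<^sub>m v"]) auto
  ultimately have q: "0 \<le> form A u u + t * form A u v + cnj t * form A v u + t * cnj t * form A v v" for t
    by simp
  have b: "0 \<le> form A v v" using A v unfolding psd_mat_iff_form by blast
  show "form A v u = cnj (form A u v)"
    and "(cmod (form A u v))\<^sup>2 \<le> Re (form A u u) * Re (form A v v)"
    using nonneg_quadratic[OF q b] by auto
qed

section \<open>Traces of products of positive semidefinite matrices\<close>

definition basis_col :: "nat \<Rightarrow> nat \<Rightarrow> complex mat" where
  "basis_col n i = mat n 1 (\<lambda>(r, _). if r = i then 1 else 0)"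

lemma basis_col_carrier [simp]: "basis_col n i \<in> carrier_mat n 1"
  "dim_row (basis_col n i) = n" "dim_col (basis_col n i) = 1"
  by (auto simp: basis_col_def)

lemma mult_basis_col:
  assumes "A \<in> carrier_mat m n" "i < n"
  shows "A * basis_col n i = mat m 1 (\<lambda>(r, _). A $$ (r, i))"
  using assms by (auto intro!: eq_matI simp: basis_col_def scalar_prod_def if_distrib cong: if_cong)

lemma basis_col_mult:
  assumes "A \<in> carrier_mat n m" "i < n"
  shows "(basis_col n i)\<^sup>\<dagger> * A = mat 1 m (\<lambda>(_, r). A $$ (i, r))"
  using assms
  by (auto intro!: eq_matI simp: basis_col_def scalar_prod_def if_distrib if_distribR cong: if_cong)

text \<open>By the Cauchy-Schwarz inequality every coordinate of \<open>A * v\<close>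
  vanishes.\<close>

lemma psd_form_zero:
  assumes A: "psd_mat n A" and v: "v \<in> carrier_mat n 1" and "Re (form A v v) = 0"
  shows "A * v = 0\<^sub>m n 1"
proof (rule eq_matI)
  have Ac: "A \<in> carrier_mat n n" using A by (simp add: psd_mat_def)
  fix i j assume "i < dim_row (0\<^sub>m n 1 :: complex mat)" "j < dim_col (0\<^sub>m n 1 :: complex mat)"
  then have ij: "i < n" "j = 0" by auto
  have "form A (basis_col n i) v = 0"
    using psd_cauchy_schwarz(2)[OF A basis_col_carrier(1) v, of i] assms(3) by simp
  then show "(A * v) $$ (i, j) = 0\<^sub>m n 1 $$ (i, j)"
    unfolding form_def using ij Ac v by (subst (asm) basis_col_mult[where m = 1]) auto
qed (use A v in \<open>auto simp: psd_mat_def\<close>)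

lemma mat_trace_mult:
  assumes "A \<in> carrier_mat n m" "B \<in> carrier_mat m n"
  shows "mat_trace (A * B) = (\<Sum>i<n. \<Sum>j<m. A $$ (i, j) * B $$ (j, i))"
  using assms by (auto simp: mat_trace_def scalar_prod_def lessThan_atLeast0)

lemma mat_trace_comm:
  assumes "A \<in> carrier_mat n m" "B \<in> carrier_mat m n"
  shows "mat_trace (A * B) = mat_trace (B * A)"
  unfolding mat_trace_mult[OF assms] mat_trace_mult[OF assms(2,1)]
  by (subst sum.swap) (simp add: mult.commute)

lemma mat_trace_add:
  "A \<in> carrier_mat n n \<Longrightarrow> B \<in> carrier_mat n n \<Longrightarrow> mat_trace (A + B) = mat_trace A + mat_trace B"
  by (auto simp: mat_trace_def sum.distrib)

lemma mat_trace_smult: "A \<in> carrier_mat n n \<Longrightarrow> mat_trace (k \<cdot>\<^sub>m A) = k * mat_trace A"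
  by (auto simp: mat_trace_def sum_distrib_left)

lemma mat_trace_single: "A \<in> carrier_mat 1 1 \<Longrightarrow> mat_trace A = A $$ (0, 0)"
  by (auto simp: mat_trace_def)

lemma mat_trace_rank_one:
  assumes "E \<in> carrier_mat n n" "v \<in> carrier_mat n 1"
  shows "mat_trace (E * (v * v\<^sup>\<dagger>)) = form E v v"
proof -
  have "mat_trace (E * (v * v\<^sup>\<dagger>)) = mat_trace ((E * v) * v\<^sup>\<dagger>)"
    using assms by (simp add: mat_mult_assoc_dim)
  also have "\<dots> = mat_trace (v\<^sup>\<dagger> * (E * v))"
    using assms by (intro mat_trace_comm) auto
  also have "\<dots> = form E v v"
    unfolding form_def using assms by (intro mat_trace_single) auto
  finally show ?thesis .
qed

text \<open>Subtracting the rank-one matrix of a Cholesky step annihilates one more basis vector, so every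
  positive semidefinite matrix is built from rank-one matrices.\<close>

lemma psd_trace_mult:
  assumes E: "psd_mat n E" and A: "psd_mat n A"
  shows "0 \<le> Re (mat_trace (E * A))" and "Re (mat_trace (E * A)) = 0 \<Longrightarrow> E * A = 0\<^sub>m n n"
proof -
  have Ec: "E \<in> carrier_mat n n" using E by (simp add: psd_mat_def)
  \<comment> \<open>The induction parameter \<open>k\<close> bounds the columns of \<open>A\<close>
    that may be nonzero. Both claims go through together: a vanishing sum of nonnegative traces must
    vanish in each part.\<close>
  have "0 \<le> Re (mat_trace (E * A)) \<and> (Re (mat_trace (E * A)) = 0 \<longrightarrow> E * A = 0\<^sub>m n n)"
    if "psd_mat n A" "k \<le> n" "\<And>j. k \<le> j \<Longrightarrow> j < n \<Longrightarrow> A * basis_col n j = 0\<^sub>m n 1" for k A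
    using that
  proof (induction k arbitrary: A)
    case 0
    have Ac: "A \<in> carrier_mat n n" using 0 by (simp add: psd_mat_def)
    have "A = 0\<^sub>m n n"
    proof (rule eq_matI)
      fix i j assume "i < dim_row (0\<^sub>m n n :: complex mat)" "j < dim_col (0\<^sub>m n n :: complex mat)"
      then have ij: "i < n" "j < n" by auto
      have "(A * basis_col n j) $$ (i, 0) = 0" using 0(3)[of j] ij by simp
      then show "A $$ (i, j) = 0\<^sub>m n n $$ (i, j)"
        using ij by (simp add: mult_basis_col[OF Ac])
    qed (use Ac in auto)
    then show ?case using Ec by (simp add: mat_mult_zero_dim mat_trace_def)
  next
    case (Suc k)
    have Ac: "A \<in> carrier_mat n n" using Suc.prems by (simp add: psd_mat_def)
    define e where "e = basis_col n k"
    have e: "e \<in> carrier_mat n 1" "dim_row e = n" "dim_col e = 1"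
      by (simp_all add: e_def del: One_nat_def)
    define s where "s = Re (form A e e)"
    show ?case
    proof (cases "s = 0")
      case True
      \<comment> \<open>A zero pivot means that this basis vector is annihilated already, so nothing
        is subtracted.\<close>
      then have Ae: "A * e = 0\<^sub>m n 1"
        using psd_form_zero[OF Suc.prems(1) e(1)] by (simp add: s_def)
      have "A * basis_col n j = 0\<^sub>m n 1" if "k \<le> j" "j < n" for j
        using that Ae Suc.prems(3)[of j] by (cases "j = k") (auto simp: e_def)
      then show ?thesis using Suc by auto
    next
      case False
      have s: "s > 0" "form A e e = of_real s"
        using psd_formD[OF Suc.prems(1) e(1)] False by (auto simp: s_def complex_eq_iff)
      define v where "v = A * e"
      have v: "v \<in> carrier_mat n 1" "dim_row v = n" "dim_col v = 1"
        using Ac e by (auto simp: v_def)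
      \<comment> \<open>The factor \<open>1 / s\<close> is chosen so that \<open>B * e\<close>
        vanishes. Positivity of \<open>B\<close> is the Cauchy-Schwarz inequality for
        \<open>u\<close> and \<open>e\<close>, and basis vectors killed by \<open>A\<close> stay
        killed because they are orthogonal to \<open>v\<close>.\<close>
      define B where "B = A + (- of_real (1 / s)) \<cdot>\<^sub>m (v * v\<^sup>\<dagger>)"
      have Bc: "B \<in> carrier_mat n n" using Ac v by (simp add: B_def)
      have uv: "u\<^sup>\<dagger> * v = form A u e \<cdot>\<^sub>m 1\<^sub>m 1" "v\<^sup>\<dagger> * u = cnj (form A u e) \<cdot>\<^sub>m 1\<^sub>m 1"
        if u: "u \<in> carrier_mat n 1" for u
      proof -
        show 1: "u\<^sup>\<dagger> * v = form A u e \<cdot>\<^sub>m 1\<^sub>m 1"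
          using u v by (intro eq_matI) (auto simp: form_def v_def)
        have "v\<^sup>\<dagger> * u = (u\<^sup>\<dagger> * v)\<^sup>\<dagger>" using u v by simp
        then show "v\<^sup>\<dagger> * u = cnj (form A u e) \<cdot>\<^sub>m 1\<^sub>m 1" unfolding 1 by simp
      qed
      have "psd_mat n B"
        unfolding psd_mat_iff_form
      proof (intro conjI ballI)
        fix u :: "complex mat" assume u: "u \<in> carrier_mat n 1"
        have "u\<^sup>\<dagger> * (B * u) = u\<^sup>\<dagger> * (A * u) + (- of_real (1 / s)) \<cdot>\<^sub>m ((u\<^sup>\<dagger> * v) * (v\<^sup>\<dagger> * u))"
          using u v Ac by (simp add: B_def mat_dim_simps)
        then have "form B u u = form A u u - of_real (1 / s) * (form A u e * cnj (form A u e))"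
          unfolding form_def uv[OF u] using u Ac e by (simp add: mat_dim_simps)
        also have "\<dots> = form A u u - of_real ((cmod (form A u e))\<^sup>2 / s)"
          unfolding complex_norm_square[symmetric] by simp
        finally have fB: "form B u u = form A u u - of_real ((cmod (form A u e))\<^sup>2 / s)" .
        have "(cmod (form A u e))\<^sup>2 / s \<le> Re (form A u u)"
          using psd_cauchy_schwarz(2)[OF Suc.prems(1) u e(1)] s by (simp add: field_simps)
        then show "0 \<le> form B u u"
          using psd_formD[OF Suc.prems(1) u] by (simp add: fB less_eq_complex_def)
      qed (rule Bc)
      moreover have "B * basis_col n j = 0\<^sub>m n 1" if j: "k \<le> j" "j < n" for j
      proof -
        have "B * basis_col n j = A * basis_col n j + (- of_real (1 / s)) \<cdot>\<^sub>m (v * (v\<^sup>\<dagger> * basis_col n j))"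
          using Ac v by (simp add: B_def mat_dim_simps)
        also have "\<dots> = A * basis_col n j + (- of_real (1 / s) * cnj (form A (basis_col n j) e)) \<cdot>\<^sub>m v"
          unfolding uv(2)[OF basis_col_carrier(1)] using v by (simp add: mat_dim_simps)
        also have "\<dots> = 0\<^sub>m n 1"
        proof (cases "j = k")
          case True
          then show ?thesis
            using s v by (auto simp: e_def[symmetric] v_def[symmetric] intro!: eq_matI)
        next
          case False
          then have Aj: "A * basis_col n j = 0\<^sub>m n 1" using Suc.prems(3)[of j] j by auto
          have "form A e (basis_col n j) = 0"
            using e by (simp add: form_def Aj mat_dim_simps)
          then have "form A (basis_col n j) e = 0"
            using psd_cauchy_schwarz(1)[OF Suc.prems(1) e(1) basis_col_carrier(1)[of n j]] by simp
          then show ?thesis using v by (simp add: Aj mat_zero_smult)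
        qed
        finally show ?thesis .
      qed
      ultimately have IH: "0 \<le> Re (mat_trace (E * B))" "Re (mat_trace (E * B)) = 0 \<Longrightarrow> E * B = 0\<^sub>m n n"
        using Suc.IH[of B] Suc.prems(2) by auto
      have "A = B + of_real (1 / s) \<cdot>\<^sub>m (v * v\<^sup>\<dagger>)"
        using Ac v by (auto simp: B_def intro!: eq_matI)
      then have EA: "E * A = E * B + of_real (1 / s) \<cdot>\<^sub>m (E * (v * v\<^sup>\<dagger>))"
        using Ec Bc v by (simp add: mat_dim_simps)
      have "mat_trace (E * A) = mat_trace (E * B) + of_real (1 / s) * form E v v"
        unfolding EA mat_trace_rank_one[OF Ec v(1), symmetric] using Ec Bc v
        by (subst mat_trace_add[where n = n]) (auto simp: mat_trace_smult[where n = n])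
      then have tr: "Re (mat_trace (E * A)) = Re (mat_trace (E * B)) + Re (form E v v) / s"
        by simp
      have nn: "0 \<le> Re (form E v v) / s"
        using psd_formD(1)[OF E v(1)] s by simp
      have "E * A = 0\<^sub>m n n" if "Re (mat_trace (E * A)) = 0"
      proof -
        have "Re (mat_trace (E * B)) = 0" and "Re (form E v v) / s = 0"
          using IH(1) nn that tr by linarith+
        moreover from this(1) have "E * B = 0\<^sub>m n n" by (rule IH(2))
        moreover from calculation have "E * v = 0\<^sub>m n 1"
          using psd_form_zero[OF E v(1)] s by simp
        then have "E * (v * v\<^sup>\<dagger>) = 0\<^sub>m n n"
          using v Ec by (simp add: mat_mult_assoc_dim[symmetric] mat_mult_zero_dim)
        ultimately show ?thesis by (simp add: EA mat_dim_simps)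
      qed
      with IH(1) nn show ?thesis by (simp add: tr)
    qed
  qed
  from this[OF A order_refl] show "0 \<le> Re (mat_trace (E * A))"
    and "Re (mat_trace (E * A)) = 0 \<Longrightarrow> E * A = 0\<^sub>m n n"
    by auto
qed

section \<open>Unambiguous discrimination\<close>

text \<open>The rectangular version of \<open>mat_sum\<close>, needed for averages of maps between
  spaces of different dimensions.\<close>

definition matrix_sum :: "nat \<Rightarrow> nat \<Rightarrow> ('i \<Rightarrow> complex mat) \<Rightarrow> 'i set \<Rightarrow> complex mat" where
  "matrix_sum n m F I = mat n m (\<lambda>ij. \<Sum>x\<in>I. F x $$ ij)"

lemma mat_sum_eq_matrix_sum: "mat_sum n F I = matrix_sum n n F I"
  by (simp add: mat_sum_def matrix_sum_def)

lemma matrix_sum_carrier [simp]: "matrix_sum n m F I \<in> carrier_mat n m"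
  "dim_row (matrix_sum n m F I) = n" "dim_col (matrix_sum n m F I) = m"
  by (auto simp: matrix_sum_def)

lemma matrix_sum_cong: "(\<And>x. x \<in> I \<Longrightarrow> F x = H x) \<Longrightarrow> matrix_sum n m F I = matrix_sum n m H I"
  by (auto simp: matrix_sum_def intro!: eq_matI sum.cong)

lemma mult_matrix_sum:
  assumes A: "A \<in> carrier_mat k n" and F: "\<And>x. x \<in> I \<Longrightarrow> F x \<in> carrier_mat n m"
  shows "A * matrix_sum n m F I = matrix_sum k m (\<lambda>x. A * F x) I"
proof (rule eq_matI)
  fix i j assume "i < dim_row (matrix_sum k m (\<lambda>x. A * F x) I)" "j < dim_col (matrix_sum k m (\<lambda>x. A * F x) I)"
  then have ij: "i < k" "j < m" by auto
  have "(A * matrix_sum n m F I) $$ (i, j) = (\<Sum>l = 0..<n. \<Sum>x\<in>I. A $$ (i, l) * F x $$ (l, j))"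
    using ij A by (simp add: matrix_sum_def scalar_prod_def sum_distrib_left)
  also have "\<dots> = (\<Sum>x\<in>I. \<Sum>l = 0..<n. A $$ (i, l) * F x $$ (l, j))"
    by (rule sum.swap)
  also have "\<dots> = (\<Sum>x\<in>I. (A * F x) $$ (i, j))"
  proof (rule sum.cong[OF refl])
    fix x assume "x \<in> I"
    then show "(\<Sum>l = 0..<n. A $$ (i, l) * F x $$ (l, j)) = (A * F x) $$ (i, j)"
      using F[of x] ij A by (simp add: scalar_prod_def)
  qed
  finally show "(A * matrix_sum n m F I) $$ (i, j) = matrix_sum k m (\<lambda>x. A * F x) I $$ (i, j)"
    using ij by (simp add: matrix_sum_def)
qed (use A in auto)

lemma matrix_sum_mult:
  assumes A: "A \<in> carrier_mat m k" and F: "\<And>x. x \<in> I \<Longrightarrow> F x \<in> carrier_mat n m"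
  shows "matrix_sum n m F I * A = matrix_sum n k (\<lambda>x. F x * A) I"
proof (rule eq_matI)
  fix i j assume "i < dim_row (matrix_sum n k (\<lambda>x. F x * A) I)" "j < dim_col (matrix_sum n k (\<lambda>x. F x * A) I)"
  then have ij: "i < n" "j < k" by auto
  have "(matrix_sum n m F I * A) $$ (i, j) = (\<Sum>l = 0..<m. \<Sum>x\<in>I. F x $$ (i, l) * A $$ (l, j))"
    using ij A by (simp add: matrix_sum_def scalar_prod_def sum_distrib_right)
  also have "\<dots> = (\<Sum>x\<in>I. \<Sum>l = 0..<m. F x $$ (i, l) * A $$ (l, j))"
    by (rule sum.swap)
  also have "\<dots> = (\<Sum>x\<in>I. (F x * A) $$ (i, j))"
  proof (rule sum.cong[OF refl])
    fix x assume "x \<in> I"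
    then show "(\<Sum>l = 0..<m. F x $$ (i, l) * A $$ (l, j)) = (F x * A) $$ (i, j)"
      using F[of x] ij A by (simp add: scalar_prod_def)
  qed
  finally show "(matrix_sum n m F I * A) $$ (i, j) = matrix_sum n k (\<lambda>x. F x * A) I $$ (i, j)"
    using ij by (simp add: matrix_sum_def)
qed (use A in auto)

lemma matrix_sum_single:
  assumes "finite I" "g \<in> I" "F g \<in> carrier_mat n m" "\<And>x. x \<in> I \<Longrightarrow> x \<noteq> g \<Longrightarrow> F x = 0\<^sub>m n m"
  shows "matrix_sum n m F I = F g"
proof (rule eq_matI)
  fix i j assume ij: "i < dim_row (F g)" "j < dim_col (F g)"
  have "(\<Sum>x\<in>I. F x $$ (i, j)) = F g $$ (i, j) + (\<Sum>x\<in>I - {g}. F x $$ (i, j))"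
    using assms(1,2) by (rule sum.remove)
  also have "(\<Sum>x\<in>I - {g}. F x $$ (i, j)) = 0"
    using assms(3,4) ij by (intro sum.neutral) auto
  finally show "matrix_sum n m F I $$ (i, j) = F g $$ (i, j)"
    using ij assms(3) by (simp add: matrix_sum_def)
qed (use assms(3) in auto)

text \<open>Frobenius reciprocity: averaging the rank-one maps \<open>V g * \<phi> * b\<^sup>T * (S g)\<^sup>\<dagger>\<close> over the group gives
  an intertwiner for every vector \<open>b\<close>; it does not vanish when some \<open>V g * \<phi>\<close> can be told
  apart from all the others.\<close>

lemma separated_orbit_hom:
  assumes G: "group G" and fin: "finite (carrier G)" and V: "proj_rep G c n V"
    and S: "irreducible_rep G c d S" and g: "g \<in> carrier G" and \<phi>: "\<phi> \<in> carrier_mat n 1"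
    and F: "F \<in> carrier_mat n n" and Fg: "F * (V g * \<phi>) \<noteq> 0\<^sub>m n 1"
    and Fh: "\<And>h. h \<in> carrier G \<Longrightarrow> h \<noteq> g \<Longrightarrow> F * (V h * \<phi>) = 0\<^sub>m n 1"
  obtains f where "linear_on_columns d n d f" "kernel_free d n d f"
    "\<And>a. a \<in> carrier_mat d 1 \<Longrightarrow> intertwiner G d S n V (f a)"
proof -
  interpret group G by fact
  have S_rep: "proj_rep G c d S" using S by (simp add: irreducible_rep_def)
  have V_un: "\<And>k. k \<in> carrier G \<Longrightarrow> unitary_mat n (V k)"
    and S_un: "\<And>k. k \<in> carrier G \<Longrightarrow> unitary_mat d (S k)"
    and V_mult: "\<And>h k. h \<in> carrier G \<Longrightarrow> k \<in> carrier G \<Longrightarrow> V h * V k = c h k \<cdot>\<^sub>m V (h \<otimes>\<^bsub>G\<^esub> k)"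
    and S_mult: "\<And>h k. h \<in> carrier G \<Longrightarrow> k \<in> carrier G \<Longrightarrow> S h * S k = c h k \<cdot>\<^sub>m S (h \<otimes>\<^bsub>G\<^esub> k)"
    and c1: "\<And>h k. h \<in> carrier G \<Longrightarrow> k \<in> carrier G \<Longrightarrow> cmod (c h k) = 1"
    using V S_rep by (auto simp: proj_rep_def factor_set_def)
  note Vd = unitary_mat_simps(2,3)[OF V_un] and Sd = unitary_mat_simps(2,3)[OF S_un]
  have \<phi>d: "dim_row \<phi> = n" "dim_col \<phi> = 1" using \<phi> by auto
  have Fd: "dim_row F = n" "dim_col F = n" using F by auto
  \<comment> \<open>The transpose of \<open>b\<close>, rather than the adjoint, keeps the map linear
    instead of conjugate linear.\<close>
  define M where "M b k = (V k * \<phi>) * (transpose_mat b * (S k)\<^sup>\<dagger>)" for b k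
  define f where "f b = matrix_sum n d (M b) (carrier G)" for b
  have Mc: "M b k \<in> carrier_mat n d" if "k \<in> carrier G" for b k
    using that by (auto simp: M_def Vd Sd intro!: carrier_matI)
  have "linear_on_columns d n d f"
    unfolding linear_on_columns_def
  proof (intro conjI ballI allI)
    fix a b :: "complex mat" and t assume a: "a \<in> carrier_mat d 1"
    have "M (t \<cdot>\<^sub>m a) k = t \<cdot>\<^sub>m M a k" if k: "k \<in> carrier G" for k
    proof -
      have "transpose_mat (t \<cdot>\<^sub>m a) = t \<cdot>\<^sub>m transpose_mat a" by (rule eq_matI) auto
      then show ?thesis
        using a k \<phi>d by (simp add: M_def mat_dim_simps Vd Sd)
    qed
    then have "M (t \<cdot>\<^sub>m a) k $$ ij = t * M a k $$ ij"
      if "k \<in> carrier G" "fst ij < n" "snd ij < d" for k ij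
      using that Mc[OF that(1), of a] by (cases ij) simp
    then have "(\<Sum>k\<in>carrier G. M (t \<cdot>\<^sub>m a) k $$ ij) = t * (\<Sum>k\<in>carrier G. M a k $$ ij)"
      if "fst ij < n" "snd ij < d" for ij
      using that unfolding sum_distrib_left by (intro sum.cong) auto
    then show "f (t \<cdot>\<^sub>m a) = t \<cdot>\<^sub>m f a"
      by (intro eq_matI) (simp_all add: f_def matrix_sum_def)
    assume b: "b \<in> carrier_mat d 1"
    have "M (a + b) k = M a k + M b k" if k: "k \<in> carrier G" for k
    proof -
      have "transpose_mat (a + b) = transpose_mat a + transpose_mat b" 
        using a b by (intro eq_matI) auto
      then show ?thesis
        using a b k \<phi>d by (simp add: M_def mat_dim_simps Vd Sd)
    qed
    then have "M (a + b) k $$ ij = M a k $$ ij + M b k $$ ij"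
      if "k \<in> carrier G" "fst ij < n" "snd ij < d" for k ij
      using that Mc[OF that(1), of b] by (cases ij) simp
    then have "(\<Sum>k\<in>carrier G. M (a + b) k $$ ij) = (\<Sum>k\<in>carrier G. M a k $$ ij) + (\<Sum>k\<in>carrier G. M b k $$ ij)"
      if "fst ij < n" "snd ij < d" for ij
      using that unfolding sum.distrib[symmetric] by (intro sum.cong) auto
    then show "f (a + b) = f a + f b"
      by (intro eq_matI) (simp_all add: f_def matrix_sum_def)
  qed (simp add: f_def)
  moreover have "kernel_free d n d f"
    unfolding kernel_free_def
  proof (intro ballI impI)
    fix b assume b: "b \<in> carrier_mat d 1" and fb: "f b = 0\<^sub>m n d"
    have FM: "F * M b k = (F * (V k * \<phi>)) * (transpose_mat b * (S k)\<^sup>\<dagger>)" if "k \<in> carrier G" for k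
      using b that \<phi>d Fd by (simp add: M_def mat_mult_assoc_dim Vd Sd)
    define w where "w = F * (V g * \<phi>)"
    define r where "r = transpose_mat b * (S g)\<^sup>\<dagger>"
    have w: "w \<in> carrier_mat n 1" using g \<phi>d Fd by (auto simp: w_def Vd intro!: carrier_matI)
    have r: "r \<in> carrier_mat 1 d" using g b by (auto simp: r_def Sd intro!: carrier_matI)
    \<comment> \<open>Applying \<open>F\<close> leaves only the term of \<open>g\<close>, a column
      \<open>w\<close> times a row \<open>r\<close>. As \<open>w\<close> is nonzero, the product
      vanishes only if \<open>r\<close> does, and then \<open>b\<close> is zero since
      \<open>S g\<close> is invertible.\<close>
    have "F * f b = matrix_sum n d (\<lambda>k. F * M b k) (carrier G)"
      unfolding f_def using F Mc by (rule mult_matrix_sum)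
    also have "\<dots> = F * M b g"
    proof (rule matrix_sum_single[OF fin g])
      show "F * M b g \<in> carrier_mat n d" using F Mc[OF g] by auto
      fix k assume k: "k \<in> carrier G" "k \<noteq> g"
      show "F * M b k = 0\<^sub>m n d"
        unfolding FM[OF k(1)] Fh[OF k] using b k by (simp add: mat_mult_zero_dim Sd)
    qed
    finally have "w * r = F * f b" using FM[OF g] by (simp add: w_def r_def)
    then have wr: "w * r = 0\<^sub>m n d" unfolding fb using Fd by (simp add: mat_mult_zero_dim)
    obtain i where i: "i < n" "w $$ (i, 0) \<noteq> 0"
      using Fg w unfolding w_def[symmetric] by (metis (no_types, lifting) carrier_matD eq_matI
          index_zero_mat less_one)
    have "r = 0\<^sub>m 1 d"
    proof (rule eq_matI)
      fix i' j assume "i' < dim_row (0\<^sub>m 1 d :: complex mat)" "j < dim_col (0\<^sub>m 1 d :: complex mat)"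
      then have j: "i' = 0" "j < d" by auto
      have "(w * r) $$ (i, j) = w $$ (i, 0) * r $$ (0, j)"
        using i(1) j w r by (simp add: scalar_prod_def)
      then show "r $$ (i', j) = 0\<^sub>m 1 d $$ (i', j)"
        using i j by (simp add: wr)
    qed (use r in auto)
    moreover have "transpose_mat b = r * S g"
      using b g unitary_mat_simps[OF S_un[OF g]] by (simp add: r_def mat_mult_assoc_dim mat_mult_one_dim)
    ultimately have "transpose_mat b = 0\<^sub>m 1 d"
      using g by (simp add: mat_mult_zero_dim Sd)
    then have "transpose_mat (transpose_mat b) = transpose_mat (0\<^sub>m 1 d)" by simp
    then show "b = 0\<^sub>m d 1" by simp
  qed
  moreover have "intertwiner G d S n V (f b)" if b: "b \<in> carrier_mat d 1" for b
  proof (rule intertwinerI[OF proj_rep_carrier[OF S_rep] proj_rep_carrier[OF V]])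
    show "f b \<in> carrier_mat n d" by (simp add: f_def)
    fix h assume h: "h \<in> carrier G"
    note s = unitary_mat_simps[OF V_un[OF h]] unitary_mat_simps[OF S_un[OF h]]
    \<comment> \<open>Translation by \<open>h\<close> produces the phase \<open>c h k\<close> from
      \<open>V\<close> and its conjugate from \<open>S\<close>; they cancel because both have the
      same factor set.\<close>
    have step: "V h * M b k * (S h)\<^sup>\<dagger> = M b (h \<otimes>\<^bsub>G\<^esub> k)" if k: "k \<in> carrier G" for k
    proof -
      have hk: "h \<otimes>\<^bsub>G\<^esub> k \<in> carrier G" using h k by simp
      have "(S k)\<^sup>\<dagger> * (S h)\<^sup>\<dagger> = (S h * S k)\<^sup>\<dagger>"
        using h k by (simp add: Sd)
      also have "\<dots> = cnj (c h k) \<cdot>\<^sub>m (S (h \<otimes>\<^bsub>G\<^esub> k))\<^sup>\<dagger>"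
        using h k by (simp add: S_mult)
      finally have SS: "(S k)\<^sup>\<dagger> * (S h)\<^sup>\<dagger> = cnj (c h k) \<cdot>\<^sub>m (S (h \<otimes>\<^bsub>G\<^esub> k))\<^sup>\<dagger>" .
      have "V h * M b k * (S h)\<^sup>\<dagger> = ((V h * V k) * \<phi>) * (transpose_mat b * ((S k)\<^sup>\<dagger> * (S h)\<^sup>\<dagger>))"
        using b h k \<phi>d by (simp add: M_def mat_mult_assoc_dim Vd Sd)
      also have "\<dots> = (cnj (c h k) * c h k) \<cdot>\<^sub>m M b (h \<otimes>\<^bsub>G\<^esub> k)"
        unfolding SS V_mult[OF h k] using b hk \<phi>d
        by (simp add: M_def mat_smult_left_dim mat_smult_right_dim Vd Sd)
      also have "cnj (c h k) * c h k = 1"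
        using c1[OF h k] complex_norm_square[of "c h k"] by (simp add: mult.commute)
      finally show ?thesis by simp
    qed
    have VM: "V h * M b k \<in> carrier_mat n d" if "k \<in> carrier G" for k
      using s Mc[OF that] by auto
    have "V h * f b * (S h)\<^sup>\<dagger> = matrix_sum n d (\<lambda>k. V h * M b k) (carrier G) * (S h)\<^sup>\<dagger>"
      unfolding f_def using s Mc by (subst mult_matrix_sum[where k = n]) auto
    also have "\<dots> = matrix_sum n d (\<lambda>k. V h * M b k * (S h)\<^sup>\<dagger>) (carrier G)"
      using s VM by (intro matrix_sum_mult) auto
    also have "\<dots> = matrix_sum n d (\<lambda>k. M b (h \<otimes>\<^bsub>G\<^esub> k)) (carrier G)"
      by (rule matrix_sum_cong) (rule step)
    also have "\<dots> = f b"
    proof -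
      have "(\<Sum>k\<in>carrier G. M b (h \<otimes>\<^bsub>G\<^esub> k) $$ ij) = (\<Sum>k\<in>carrier G. M b k $$ ij)" for ij
        by (rule sum.reindex_bij_witness[of _ "\<lambda>k. inv\<^bsub>G\<^esub> h \<otimes>\<^bsub>G\<^esub> k" "\<lambda>k. h \<otimes>\<^bsub>G\<^esub> k"])
          (use h in \<open>auto simp: m_assoc[symmetric]\<close>)
      then show ?thesis by (simp add: f_def matrix_sum_def)
    qed
    finally have "V h * f b * (S h)\<^sup>\<dagger> * S h = f b * S h" by simp
    then show "V h * f b = f b * S h"
      using s by (simp add: mat_mult_assoc_dim f_def mat_mult_one_dim)
  qed
  ultimately show ?thesis by (rule that)
qed

section \<open>From strategies to separated orbits, and the two extreme values\<close>

lemma conjugate_density_psd: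
  assumes "density_mat n \<rho>" "unitary_mat n A"
  shows "psd_mat n (A * \<rho> * A\<^sup>\<dagger>)" "mat_trace (A * \<rho> * A\<^sup>\<dagger>) = 1"
proof -
  note s = unitary_mat_simps[OF assms(2)]
  have \<rho>: "\<rho> \<in> carrier_mat n n" using assms by (simp add: density_mat_def psd_mat_def)
  show "psd_mat n (A * \<rho> * A\<^sup>\<dagger>)"
    using assms(1) s(1) unfolding density_mat_def by (blast intro: psd_congruence)
  have "mat_trace (A * \<rho> * A\<^sup>\<dagger>) = mat_trace (A\<^sup>\<dagger> * (A * \<rho>))"
    using s \<rho> by (intro mat_trace_comm) auto
  also have "\<dots> = 1"
    using s \<rho> assms(1) by (simp add: density_mat_def)
  finally show "mat_trace (A * \<rho> * A\<^sup>\<dagger>) = 1" .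
qed

text \<open>All terms of the error sum are nonnegative, so each vanishes, and a vanishing trace
  upgrades to \<open>E g * (V h * \<rho>) = 0\<^sub>m n n\<close>. Positive success leaves one
  \<open>g\<close> whose own term is nonzero, and \<open>E g\<close> serves as
  \<open>F\<close>.\<close>

lemma success_separates:
  assumes G: "group G" and fin: "finite (carrier G)" and V: "proj_rep G c n V"
    and adm: "admissible G n V 0 \<rho> E0 E" and pos: "P_success G V \<rho> E > 0"
  obtains g \<phi> F where "g \<in> carrier G" "\<phi> \<in> carrier_mat n 1" "F \<in> carrier_mat n n"
    "F * (V g * \<phi>) \<noteq> 0\<^sub>m n 1" "\<And>h. h \<in> carrier G \<Longrightarrow> h \<noteq> g \<Longrightarrow> F * (V h * \<phi>) = 0\<^sub>m n 1"
proof -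
  interpret group G by fact
  have card: "card (carrier G) > 0" using fin one_closed by (auto simp: card_gt_0_iff)
  have dens: "density_mat n \<rho>" and Epsd: "\<And>g. g \<in> carrier G \<Longrightarrow> psd_mat n (E g)"
    and err: "P_error G V \<rho> E \<le> 0"
    using adm by (auto simp: admissible_def povm_def)
  have \<rho>: "\<rho> \<in> carrier_mat n n" using dens by (simp add: density_mat_def psd_mat_def)
  have V_un: "\<And>k. k \<in> carrier G \<Longrightarrow> unitary_mat n (V k)"
    using V by (auto simp: proj_rep_def)
  define t where "t g h = Re (mat_trace (E g * (V h * \<rho> * (V h)\<^sup>\<dagger>)))" for g h
  have t0: "0 \<le> t g h" if "g \<in> carrier G" "h \<in> carrier G" for g h
    unfolding t_def using psd_trace_mult(1)[OF Epsd conjugate_density_psd(1)[OF dens V_un]] that by blast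
  have EV: "E g * (V h * \<rho>) = 0\<^sub>m n n" if g: "g \<in> carrier G" and h: "h \<in> carrier G" and 0: "t g h = 0" for g h
  proof -
    note s = unitary_mat_simps[OF V_un[OF h]]
    have Eg: "dim_row (E g) = n" "dim_col (E g) = n"
      using Epsd[OF g] by (auto simp: psd_mat_def)
    have "E g * (V h * \<rho> * (V h)\<^sup>\<dagger>) = 0\<^sub>m n n"
      using psd_trace_mult(2)[OF Epsd[OF g] conjugate_density_psd(1)[OF dens V_un[OF h]]] 0
      by (simp add: t_def)
    then have "E g * (V h * \<rho> * (V h)\<^sup>\<dagger>) * V h = 0\<^sub>m n n"
      using s by (simp add: mat_mult_zero_dim)
    then show ?thesis
      using s \<rho> Eg by (simp add: mat_mult_assoc_dim)
  qed
  have "(\<Sum>g \<in> carrier G. \<Sum>h \<in> carrier G - {g}. t g h) \<le> 0"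
    using err card by (simp add: P_error_def t_def divide_le_0_iff)
  moreover have "0 \<le> (\<Sum>h \<in> carrier G - {g}. t g h)" if "g \<in> carrier G" for g
    using t0 that by (intro sum_nonneg) auto
  ultimately have sums0: "(\<Sum>h \<in> carrier G - {g}. t g h) = 0" if "g \<in> carrier G" for g
    using that fin by (metis (no_types, lifting) dual_order.antisym sum_nonneg sum_nonneg_eq_0_iff)
  have zero: "t g h = 0" if "g \<in> carrier G" "h \<in> carrier G" "h \<noteq> g" for g h
  proof -
    have "\<forall>x \<in> carrier G - {g}. t g x = 0"
      using sums0[OF that(1)] t0 that(1) fin by (subst sum_nonneg_eq_0_iff[symmetric]) auto
    with that show ?thesis by blast
  qed
  have "(\<Sum>g \<in> carrier G. t g g) > 0"
    using pos card by (simp add: P_success_def t_def zero_less_divide_iff)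
  then have "(\<Sum>g \<in> carrier G. t g g) \<noteq> 0" by simp
  then obtain g where g: "g \<in> carrier G" "t g g \<noteq> 0"
    by (rule sum.not_neutral_contains_not_neutral)
  have Eg: "E g \<in> carrier_mat n n" using Epsd[OF g(1)] by (simp add: psd_mat_def)
  have Vc: "V h \<in> carrier_mat n n" if "h \<in> carrier G" for h
    using unitary_mat_simps(1)[OF V_un[OF that]] .
  have "E g * (V g * \<rho>) \<noteq> 0\<^sub>m n n"
  proof
    assume "E g * (V g * \<rho>) = 0\<^sub>m n n"
    then have "E g * (V g * \<rho>) * (V g)\<^sup>\<dagger> = 0\<^sub>m n n"
      using Vc[OF g(1)] by (simp add: mat_mult_zero_dim)
    then have "E g * (V g * \<rho> * (V g)\<^sup>\<dagger>) = 0\<^sub>m n n"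
      using Vc[OF g(1)] \<rho> Eg by (simp add: mat_mult_assoc_dim)
    with g(2) show False by (simp add: t_def mat_trace_def)
  qed
  moreover have "E g * (V g * \<rho>) \<in> carrier_mat n n" "(0\<^sub>m n n :: complex mat) \<in> carrier_mat n n"
    using Eg Vc[OF g(1)] \<rho> by auto
  \<comment> \<open>A column on which the product is nonzero gives the separated vector
    \<open>\<rho> * v\<close>; mixed inputs need no diagonalisation.\<close>
  ultimately obtain v where v: "v \<in> carrier_mat n 1" "E g * (V g * \<rho>) * v \<noteq> 0\<^sub>m n n * v"
    using mat_eq_by_columns by blast
  have assoc: "E g * (V h * \<rho>) * v = E g * (V h * (\<rho> * v))" if "h \<in> carrier G" for h
    using v(1) Eg Vc[OF that] \<rho> by (simp add: mat_mult_assoc_dim)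
  have 0: "0\<^sub>m n n * v = 0\<^sub>m n 1" using v(1) by (simp add: mat_mult_zero_dim)
  show ?thesis
  proof (rule that[OF g(1) _ Eg])
    show "\<rho> * v \<in> carrier_mat n 1" using \<rho> v by auto
    show "E g * (V g * (\<rho> * v)) \<noteq> 0\<^sub>m n 1" using v(2) unfolding assoc[OF g(1)] 0 .
    show "E g * (V h * (\<rho> * v)) = 0\<^sub>m n 1" if h: "h \<in> carrier G" "h \<noteq> g" for h
      using assoc[OF h(1)] EV[OF g(1) h(1) zero[OF g(1) h]] by (simp add: 0)
  qed
qed

lemma pure_density:
  assumes "isometry n 1 v"
  shows "density_mat n (v * v\<^sup>\<dagger>)"
proof -
  have v: "v \<in> carrier_mat n 1" "v\<^sup>\<dagger> * v = 1\<^sub>m 1" using assms by (auto simp: isometry_def)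
  have "psd_mat n (v * v\<^sup>\<dagger>)"
    using psd_matI_gram[of "v\<^sup>\<dagger>" 1 n] v(1) by simp
  moreover have "mat_trace (v * v\<^sup>\<dagger>) = mat_trace (v\<^sup>\<dagger> * v)"
    using v(1) by (intro mat_trace_comm) auto
  ultimately show ?thesis
    using v(2) by (simp add: density_mat_def mat_trace_def)
qed

text \<open>A maximum has to be attained. The strategy that always declares the result inconclusive
  never errs and never succeeds.\<close>

lemma is_P_max_zero:
  assumes n: "n > 0" and V: "\<And>g. g \<in> carrier G \<Longrightarrow> unitary_mat n (V g)"
    and le: "\<And>\<rho> E0 E. admissible G n V 0 \<rho> E0 E \<Longrightarrow> P_success G V \<rho> E \<le> 0"
  shows "is_P_max G n V 0 0"
proof -
  define v where "v = inj1 1 (n - 1)"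
  have v: "isometry n 1 v"
    using isometry_inj(1)[of 1 "n - 1"] n by (simp add: v_def)
  define E where "E g = (0\<^sub>m n n :: complex mat)" for g :: 'a
  have vd: "dim_row v = n" using v by (auto simp: isometry_def)
  have zero: "E g * (V h * (v * v\<^sup>\<dagger>) * (V h)\<^sup>\<dagger>) = 0\<^sub>m n n" if "h \<in> carrier G" for g h
    using unitary_mat_simps(2)[OF V[OF that]] by (simp add: E_def mat_mult_zero_dim)
  have "psd_mat n (0\<^sub>m n n)" "psd_mat n (1\<^sub>m n)"
    using psd_matI_gram[of "0\<^sub>m n n" n n] psd_matI_gram[of "1\<^sub>m n" n n] by (simp_all add: mat_mult_zero_dim)
  moreover have "1\<^sub>m n + mat_sum n E (carrier G) = 1\<^sub>m n"
    by (auto simp: mat_sum_def E_def intro!: eq_matI)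
  ultimately have "povm G n (1\<^sub>m n) E"
    by (simp add: povm_def E_def)
  moreover have "P_error G V (v * v\<^sup>\<dagger>) E = 0" "P_success G V (v * v\<^sup>\<dagger>) E = 0"
    by (simp_all add: P_error_def P_success_def zero mat_trace_def)
  ultimately have "admissible G n V 0 (v * v\<^sup>\<dagger>) (1\<^sub>m n) E \<and> P_success G V (v * v\<^sup>\<dagger>) E = 0"
    using pure_density[OF v] by (simp add: admissible_def)
  with le show ?thesis by (auto simp: is_P_max_def)
qed

text \<open>The contrapositive of the averaging argument: a single irreducible lacking a
  \<open>d\<close>-dimensional family of intertwiners blocks every error-free success.\<close>

lemma is_P_max_zero_of_hom:
  assumes G: "group G" and fin: "finite (carrier G)" and V: "proj_rep G c n V" and n: "n > 0"
    and S: "irreducible_rep G c d S"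
    and no_hom: "\<And>f. linear_on_columns d n d f \<Longrightarrow> kernel_free d n d f \<Longrightarrow>
      \<exists>a \<in> carrier_mat d 1. \<not> intertwiner G d S n V (f a)"
  shows "is_P_max G n V 0 0"
proof (rule is_P_max_zero[OF n])
  show "unitary_mat n (V g)" if "g \<in> carrier G" for g
    using V that by (auto simp: proj_rep_def)
  fix \<rho> E0 E assume adm: "admissible G n V 0 \<rho> E0 E"
  show "P_success G V \<rho> E \<le> 0"
  proof (rule ccontr)
    assume "\<not> P_success G V \<rho> E \<le> 0"
    then have "P_success G V \<rho> E > 0" by simp
    from success_separates[OF G fin V adm this] obtain g \<phi> F where sep:
      "g \<in> carrier G" "\<phi> \<in> carrier_mat n 1" "F \<in> carrier_mat n n" "F * (V g * \<phi>) \<noteq> 0\<^sub>m n 1"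
      "\<And>h. h \<in> carrier G \<Longrightarrow> h \<noteq> g \<Longrightarrow> F * (V h * \<phi>) = 0\<^sub>m n 1"
      by blast
    obtain f where "linear_on_columns d n d f" "kernel_free d n d f"
      "\<And>a. a \<in> carrier_mat d 1 \<Longrightarrow> intertwiner G d S n V (f a)"
      using separated_orbit_hom[OF G fin V S sep] by blast
    with no_hom show False by blast
  qed
qed

text \<open>For a fixed state the outcome probabilities are nonnegative and sum to one, so each of
  the averaged terms is at most one.\<close>

lemma P_success_le_one:
  assumes G: "group G" and fin: "finite (carrier G)" and V: "proj_rep G c n V"
    and adm: "admissible G n V m \<rho> E0 E"
  shows "P_success G V \<rho> E \<le> 1"
proof -
  interpret group G by fact
  have card: "card (carrier G) > 0" using fin one_closed by (auto simp: card_gt_0_iff)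
  have dens: "density_mat n \<rho>" and Epsd: "\<And>g. g \<in> carrier G \<Longrightarrow> psd_mat n (E g)"
    and E0: "psd_mat n E0" and sum: "E0 + mat_sum n E (carrier G) = 1\<^sub>m n"
    using adm by (auto simp: admissible_def povm_def)
  have Ec: "\<And>g. g \<in> carrier G \<Longrightarrow> E g \<in> carrier_mat n n" and E0c: "E0 \<in> carrier_mat n n"
    using Epsd E0 by (auto simp: psd_mat_def)
  have "Re (mat_trace (E g * (V g * \<rho> * (V g)\<^sup>\<dagger>))) \<le> 1" if g: "g \<in> carrier G" for g
  proof -
    define B where "B = V g * \<rho> * (V g)\<^sup>\<dagger>"
    have B: "psd_mat n B" "mat_trace B = 1"
      using conjugate_density_psd[OF dens] V g by (auto simp: B_def proj_rep_def)
    have Bc: "B \<in> carrier_mat n n" using B by (simp add: psd_mat_def)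
    have "mat_trace (mat_sum n E (carrier G) * B) = (\<Sum>h\<in>carrier G. mat_trace (E h * B))"
    proof -
      have "mat_trace (mat_sum n E (carrier G) * B) =
          (\<Sum>i<n. \<Sum>j<n. \<Sum>h\<in>carrier G. E h $$ (i, j) * B $$ (j, i))"
        using Bc by (subst mat_trace_mult[where n = n and m = n]) (auto simp: mat_sum_def sum_distrib_right)
      also have "\<dots> = (\<Sum>i<n. \<Sum>h\<in>carrier G. \<Sum>j<n. E h $$ (i, j) * B $$ (j, i))"
        by (rule sum.cong[OF refl], rule sum.swap)
      also have "\<dots> = (\<Sum>h\<in>carrier G. \<Sum>i<n. \<Sum>j<n. E h $$ (i, j) * B $$ (j, i))"
        by (rule sum.swap)
      also have "\<dots> = (\<Sum>h\<in>carrier G. mat_trace (E h * B))"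
        using Ec Bc by (intro sum.cong[OF refl]) (simp add: mat_trace_mult[where n = n and m = n])
      finally show ?thesis .
    qed
    moreover have "mat_trace ((E0 + mat_sum n E (carrier G)) * B) =
        mat_trace (E0 * B) + mat_trace (mat_sum n E (carrier G) * B)"
      using E0c Bc
      by (subst mat_trace_add[symmetric, where n = n]) (auto simp: mat_sum_eq_matrix_sum mat_distrib_right_dim)
    moreover have "(E0 + mat_sum n E (carrier G)) * B = B"
      unfolding sum using Bc by simp
    ultimately have "1 = Re (mat_trace (E0 * B)) + (\<Sum>h\<in>carrier G. Re (mat_trace (E h * B)))"
      using B(2) by (metis Re_sum one_complex.sel(1) plus_complex.sel(1))
    moreover have "Re (mat_trace (E g * B)) \<le> (\<Sum>h\<in>carrier G. Re (mat_trace (E h * B)))"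
      using psd_trace_mult(1)[OF Epsd B(1)] by (intro member_le_sum[OF g _ fin]) auto
    ultimately show ?thesis
      using psd_trace_mult(1)[OF E0 B(1)] by (simp add: B_def)
  qed
  then have "(\<Sum>g \<in> carrier G. Re (mat_trace (E g * (V g * \<rho> * (V g)\<^sup>\<dagger>)))) \<le> (\<Sum>g \<in> carrier G. 1)"
    by (rule sum_mono)
  then show ?thesis
    using card by (simp add: P_success_def)
qed

lemma is_P_max_one:
  assumes G: "group G" and fin: "finite (carrier G)" and V: "proj_rep G c n V"
    and R: "regular_rep_basis G c R e" and emb: "embeds G (card (carrier G)) R n V"
  shows "is_P_max G n V 0 1"
proof -
  interpret group G by fact
  define N where "N = card (carrier G)"
  have card: "N > 0" using fin one_closed by (auto simp: card_gt_0_iff N_def)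
  have e: "\<And>g. g \<in> carrier G \<Longrightarrow> e g \<in> carrier_mat N 1"
    and ee: "\<And>g h. g \<in> carrier G \<Longrightarrow> h \<in> carrier G \<Longrightarrow> (e g)\<^sup>\<dagger> * e h = (if g = h then 1\<^sub>m 1 else 0\<^sub>m 1 1)"
    and Re: "\<And>g h. g \<in> carrier G \<Longrightarrow> h \<in> carrier G \<Longrightarrow> R g * e h = c g h \<cdot>\<^sub>m e (g \<otimes>\<^bsub>G\<^esub> h)"
    and sep: "\<And>k X. X \<in> carrier_mat N k \<Longrightarrow> (\<And>g. g \<in> carrier G \<Longrightarrow> (e g)\<^sup>\<dagger> * X = 0\<^sub>m 1 k) \<Longrightarrow> X = 0\<^sub>m N k"
    and R_rep: "proj_rep G c N R"
    using R by (auto simp: regular_rep_basis_def N_def)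
  obtain J where J: "isometry n N J" "intertwiner G N R n V J"
    using emb by (auto simp: embeds_def N_def)
  have Jd: "dim_row J = n" "dim_col J = N" and JJ: "J\<^sup>\<dagger> * J = 1\<^sub>m N"
    using J by (auto simp: isometry_def)
  have V_un: "\<And>k. k \<in> carrier G \<Longrightarrow> unitary_mat n (V k)"
    using V by (auto simp: proj_rep_def)
  have c1: "c g h * cnj (c g h) = 1" if "g \<in> carrier G" "h \<in> carrier G" for g h
    using V that complex_norm_square[of "c g h"] by (auto simp: proj_rep_def factor_set_def)
  define u where "u g = J * e g" for g
  have u: "u g \<in> carrier_mat n 1" "dim_row (u g) = n" "dim_col (u g) = 1" if "g \<in> carrier G" for g
    using e[OF that] Jd by (auto simp: u_def intro!: carrier_matI)
  have uu: "(u g)\<^sup>\<dagger> * u h = (if g = h then 1\<^sub>m 1 else 0\<^sub>m 1 1)" if "g \<in> carrier G" "h \<in> carrier G" for g h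
  proof -
    have "(u g)\<^sup>\<dagger> * u h = (e g)\<^sup>\<dagger> * e h"
      using e[OF that(1)] e[OF that(2)] Jd
      by (simp add: u_def mat_mult_assoc_dim mat_mult_cancel_dim[OF JJ] mat_mult_one_dim)
    then show ?thesis using ee[OF that] by simp
  qed
  define E where "E g = u g * (u g)\<^sup>\<dagger>" for g
  \<comment> \<open>The projection onto the embedded regular representation. The measurement
    projects onto the orbit vectors \<open>u g\<close> inside it, and the inconclusive outcome takes
    the orthogonal complement.\<close>
  define P where "P = J * J\<^sup>\<dagger>"
  define \<rho> where "\<rho> = u \<one>\<^bsub>G\<^esub> * (u \<one>\<^bsub>G\<^esub>)\<^sup>\<dagger>"
  have Pd: "dim_row P = n" "dim_col P = n" by (simp_all add: P_def Jd)
  have PP: "P * P = P" and Padj: "P\<^sup>\<dagger> = P"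
    using Jd by (simp_all add: P_def mat_mult_assoc_dim mat_mult_cancel_dim[OF JJ] mat_mult_one_dim)
  define E0 where "E0 = 1\<^sub>m n + (-1) \<cdot>\<^sub>m P"
  have "E0\<^sup>\<dagger> * E0 = E0"
    using Pd by (simp add: E0_def Padj mat_dim_simps PP) (auto intro!: eq_matI)
  moreover have "E0 \<in> carrier_mat n n" using Pd by (auto simp: E0_def)
  ultimately have E0: "psd_mat n E0"
    using psd_matI_gram[of E0 n n] by simp
  \<comment> \<open>The resolution of the identity is obtained from completeness of the basis, by
    testing the difference against each \<open>e h\<close>.\<close>
  have "matrix_sum N N (\<lambda>g. e g * (e g)\<^sup>\<dagger>) (carrier G) + (-1) \<cdot>\<^sub>m 1\<^sub>m N = 0\<^sub>m N N"
  proof (rule sep)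
    fix h assume h: "h \<in> carrier G"
    note eh = e[OF h]
    have "(e h)\<^sup>\<dagger> * matrix_sum N N (\<lambda>g. e g * (e g)\<^sup>\<dagger>) (carrier G)
        = matrix_sum 1 N (\<lambda>g. (e h)\<^sup>\<dagger> * (e g * (e g)\<^sup>\<dagger>)) (carrier G)"
    proof (rule mult_matrix_sum)
      show "e g * (e g)\<^sup>\<dagger> \<in> carrier_mat N N" if "g \<in> carrier G" for g
        using e[OF that] by auto
    qed (use eh in auto)
    also have "\<dots> = (e h)\<^sup>\<dagger> * (e h * (e h)\<^sup>\<dagger>)"
    proof (rule matrix_sum_single[OF fin h])
      show "(e h)\<^sup>\<dagger> * (e h * (e h)\<^sup>\<dagger>) \<in> carrier_mat 1 N" using eh by auto
      fix g assume g: "g \<in> carrier G" "g \<noteq> h"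
      show "(e h)\<^sup>\<dagger> * (e g * (e g)\<^sup>\<dagger>) = 0\<^sub>m 1 N"
        using e[OF g(1)] eh ee[OF h g(1)] g(2)
        by (subst mat_mult_cancel_dim[of _ _ "0\<^sub>m 1 1"]) (auto simp: mat_mult_zero_dim)
    qed
    also have "\<dots> = (e h)\<^sup>\<dagger>"
      using eh ee[OF h h] by (subst mat_mult_cancel_dim[of _ _ "1\<^sub>m 1"]) (auto simp: mat_mult_one_dim)
    finally have "(e h)\<^sup>\<dagger> * matrix_sum N N (\<lambda>g. e g * (e g)\<^sup>\<dagger>) (carrier G) = (e h)\<^sup>\<dagger>" .
    then show "(e h)\<^sup>\<dagger> * (matrix_sum N N (\<lambda>g. e g * (e g)\<^sup>\<dagger>) (carrier G) + (-1) \<cdot>\<^sub>m 1\<^sub>m N) = 0\<^sub>m 1 N"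
      using eh by (simp add: mat_dim_simps) (auto intro!: eq_matI)
  qed simp
  then have sum_e: "matrix_sum N N (\<lambda>g. e g * (e g)\<^sup>\<dagger>) (carrier G) = 1\<^sub>m N"
    by (auto simp: mat_eq_iff)
  have "P = J * matrix_sum N N (\<lambda>g. e g * (e g)\<^sup>\<dagger>) (carrier G) * J\<^sup>\<dagger>"
    unfolding sum_e using Jd by (simp add: P_def mat_mult_one_dim)
  also have "J * matrix_sum N N (\<lambda>g. e g * (e g)\<^sup>\<dagger>) (carrier G)
      = matrix_sum n N (\<lambda>g. J * (e g * (e g)\<^sup>\<dagger>)) (carrier G)"
  proof (rule mult_matrix_sum)
    show "e g * (e g)\<^sup>\<dagger> \<in> carrier_mat N N" if "g \<in> carrier G" for g
      using e[OF that] by auto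
  qed (use Jd in auto)
  also have "\<dots> * J\<^sup>\<dagger> = matrix_sum n n (\<lambda>g. J * (e g * (e g)\<^sup>\<dagger>) * J\<^sup>\<dagger>) (carrier G)"
  proof (rule matrix_sum_mult)
    show "J * (e g * (e g)\<^sup>\<dagger>) \<in> carrier_mat n N" if "g \<in> carrier G" for g
      using e[OF that] Jd by (auto intro!: carrier_matI)
  qed (use Jd in auto)
  also have "\<dots> = matrix_sum n n E (carrier G)"
  proof (rule matrix_sum_cong)
    fix g assume "g \<in> carrier G"
    then show "J * (e g * (e g)\<^sup>\<dagger>) * J\<^sup>\<dagger> = E g"
      using e[of g] Jd by (simp add: E_def u_def mat_mult_assoc_dim)
  qed
  finally have "mat_sum n E (carrier G) = P"
    by (simp add: mat_sum_eq_matrix_sum)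
  then have "E0 + mat_sum n E (carrier G) = 1\<^sub>m n"
    using Pd by (auto simp: E0_def intro!: eq_matI)
  moreover have "psd_mat n (E g)" if "g \<in> carrier G" for g
    using psd_matI_gram[of "(u g)\<^sup>\<dagger>" 1 n] u(1)[OF that] by (simp add: E_def)
  ultimately have povm: "povm G n E0 E"
    using E0 by (simp add: povm_def)
  have "isometry n 1 (u \<one>\<^bsub>G\<^esub>)"
    using u(1)[OF one_closed] uu[OF one_closed one_closed] by (simp add: isometry_def)
  then have dens: "density_mat n \<rho>"
    unfolding \<rho>_def by (rule pure_density)
  have V\<rho>: "V h * \<rho> * (V h)\<^sup>\<dagger> = u h * (u h)\<^sup>\<dagger>" if h: "h \<in> carrier G" for h
  proof -
    note s = unitary_mat_simps[OF V_un[OF h]] u[OF h] u[OF one_closed]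
    have "V h * u \<one>\<^bsub>G\<^esub> = (V h * J) * e \<one>\<^bsub>G\<^esub>"
      using e[OF one_closed] s Jd by (simp add: u_def mat_mult_assoc_dim)
    also have "\<dots> = J * (R h * e \<one>\<^bsub>G\<^esub>)"
      unfolding intertwinerD[OF J(2) h]
      using e[OF one_closed] rep_carrier_dim[OF proj_rep_carrier[OF R_rep] h] Jd by (simp add: mat_mult_assoc_dim)
    also have "\<dots> = c h \<one>\<^bsub>G\<^esub> \<cdot>\<^sub>m u h"
      unfolding Re[OF h one_closed] using e[OF h] h Jd by (simp add: u_def mat_smult_right_dim)
    finally have Vu: "V h * u \<one>\<^bsub>G\<^esub> = c h \<one>\<^bsub>G\<^esub> \<cdot>\<^sub>m u h" .
    have "V h * \<rho> * (V h)\<^sup>\<dagger> = (V h * u \<one>\<^bsub>G\<^esub>) * (V h * u \<one>\<^bsub>G\<^esub>)\<^sup>\<dagger>"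
      using s by (simp add: \<rho>_def mat_mult_assoc_dim)
    also have "\<dots> = (c h \<one>\<^bsub>G\<^esub> * cnj (c h \<one>\<^bsub>G\<^esub>)) \<cdot>\<^sub>m (u h * (u h)\<^sup>\<dagger>)"
      unfolding Vu using s by (simp add: mat_smult_left_dim mat_smult_right_dim mult.commute)
    finally show ?thesis by (simp add: c1[OF h one_closed])
  qed
  have tr: "mat_trace (E g * (V h * \<rho> * (V h)\<^sup>\<dagger>)) = (if g = h then 1 else 0)"
    if g: "g \<in> carrier G" and h: "h \<in> carrier G" for g h
  proof -
    note s = u[OF g] u[OF h]
    have Eg: "E g \<in> carrier_mat n n" using s by (auto simp: E_def)
    have "mat_trace (E g * (V h * \<rho> * (V h)\<^sup>\<dagger>)) = form (E g) (u h) (u h)"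
      unfolding V\<rho>[OF h] using Eg u(1)[OF h] by (rule mat_trace_rank_one)
    also have "\<dots> = (((u h)\<^sup>\<dagger> * u g) * ((u g)\<^sup>\<dagger> * u h)) $$ (0, 0)"
      using s by (simp add: form_def E_def mat_mult_assoc_dim)
    also have "\<dots> = (if g = h then 1 else 0)"
      unfolding uu[OF h g] uu[OF g h] by auto
    finally show ?thesis .
  qed
  have "P_error G V \<rho> E = 0"
  proof -
    have "(\<Sum>h \<in> carrier G - {g}. Re (mat_trace (E g * (V h * \<rho> * (V h)\<^sup>\<dagger>)))) = 0" if "g \<in> carrier G" for g
      using that by (intro sum.neutral) (auto simp: tr)
    then show ?thesis by (simp add: P_error_def)
  qed
  moreover have "P_success G V \<rho> E = 1"
    using card unfolding P_success_def by (simp add: tr N_def)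
  ultimately have "admissible G n V 0 \<rho> E0 E \<and> P_success G V \<rho> E = 1"
    using dens povm by (simp add: admissible_def)
  with P_success_le_one[OF G fin V] show ?thesis
    unfolding is_P_max_def by blast
qed

theorem mainTheorem4:
  fixes G :: "('g, 'x) monoid_scheme"
    and c :: "'g \<Rightarrow> 'g \<Rightarrow> complex"
    and n :: nat
    and U :: "'g \<Rightarrow> complex mat"
  assumes "group G" and "finite (carrier G)" and "n > 0" and "proj_rep G c n U"
  shows
    "is_P_max G n U 0
       (if \<forall>d S. irreducible_rep G c d S \<longrightarrow> multiplicity_rep G c n U d S \<ge> d then 1 else 0)
     \<and>
     ((\<exists>d S. irreducible_rep G c d S \<and> multiplicity_rep G c n U d S = 0) \<longrightarrow>
        (\<forall>r>0. is_P_max G (n * r) (with_ancilla r U) 0 0))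
     \<and>
     ((\<forall>d S. irreducible_rep G c d S \<longrightarrow> multiplicity_rep G c n U d S \<ge> 1) \<and>
      (\<exists>d S. irreducible_rep G c d S \<and> multiplicity_rep G c n U d S < d) \<longrightarrow>
        is_P_max G n U 0 0 \<and>
        (\<exists>r0. \<forall>r\<ge>r0. is_P_max G (n * r) (with_ancilla r U) 0 1))"
proof -
  note G = assms(1) and fin = assms(2) and n = assms(3) and U = assms(4)
  obtain R e where R: "regular_rep_basis G c R e"
    using regular_rep_exists[OF G fin U n] by blast
  have one: "is_P_max G n U 0 1" if "\<forall>d S. irreducible_rep G c d S \<longrightarrow> multiplicity_rep G c n U d S \<ge> d"
    using that by (intro is_P_max_one[OF G fin U R] regular_rep_embeds[OF G R U]) blast
  \<comment> \<open>A \<open>d\<close>-dimensional family of intertwiners would exceed the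
    multiplicity, which is the dimension of the whole intertwiner space.\<close>
  have zero: "is_P_max G n U 0 0"
    if S: "irreducible_rep G c d S" and less: "multiplicity_rep G c n U d S < d" for d S
  proof (rule is_P_max_zero_of_hom[OF G fin U n S], rule ccontr)
    fix f assume f: "linear_on_columns d n d f" "kernel_free d n d f"
      and "\<not> (\<exists>a \<in> carrier_mat d 1. \<not> intertwiner G d S n U (f a))"
    then have hom: "\<And>a. a \<in> carrier_mat d 1 \<Longrightarrow> intertwiner G d S n U (f a)" by blast
    obtain h where "hom_coordinates G d S n U (multiplicity_rep G c n U d S) h"
      using multiplicity_rep_hom[OF G S U] by blast
    from hom_dim_ge[OF this f hom] less show False by simp
  qed
  have ancilla_zero: "is_P_max G (n * r) (with_ancilla r U) 0 0"
    if S: "irreducible_rep G c d S" and m: "multiplicity_rep G c n U d S = 0" and r: "r > 0" for d S r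
  proof (rule is_P_max_zero_of_hom[OF G fin proj_rep_with_ancilla[OF U G] _ S], use n r in simp, rule ccontr)
    fix f assume f: "linear_on_columns d (n * r) d f" "kernel_free d (n * r) d f"
      and "\<not> (\<exists>a \<in> carrier_mat d 1. \<not> intertwiner G d S (n * r) (with_ancilla r U) (f a))"
    then have hom: "\<And>a. a \<in> carrier_mat d 1 \<Longrightarrow> intertwiner G d S (n * r) (with_ancilla r U) (f a)" by blast
    obtain h where h: "hom_coordinates G d S n U 0 h"
      using multiplicity_rep_hom[OF G S U] m by metis
    have "X = 0\<^sub>m n d" if X: "intertwiner G d S n U X" for X
    proof -
      have lin: "linear_on_columns 0 n d h" and im: "h ` carrier_mat 0 1 = {X. intertwiner G d S n U X}"
        using h unfolding hom_coordinates_def by blast+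
      from im X obtain a where a: "a \<in> carrier_mat 0 1" "X = h a" by blast
      \<comment> \<open>A column without rows equals any multiple of itself, so homogeneity of
        \<open>h\<close> makes its only value zero.\<close>
      have "a = 0 \<cdot>\<^sub>m a" using a(1) by (intro eq_matI) auto
      then have "h a = 0 \<cdot>\<^sub>m h a"
        using linear_on_columnsD(5)[OF lin a(1), of 0] by simp
      then show ?thesis
        using a(2) linear_on_columnsD(2,3)[OF lin a(1)] by (simp add: mat_zero_smult)
    qed
    then have "f a = 0\<^sub>m (n * r) d" if "a \<in> carrier_mat d 1" for a
      using ancilla_intertwiner_zero[OF proj_rep_carrier[OF U] _ hom[OF that]] by blast
    \<comment> \<open>All values of \<open>f\<close> are zero, yet its kernel is trivial; this is
      impossible because \<open>d\<close> is positive.\<close>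
    then have "basis_col d 0 = 0\<^sub>m d 1"
      using f(2) basis_col_carrier(1)[of d 0] unfolding kernel_free_def by blast
    then have "basis_col d 0 $$ (0, 0) = (0\<^sub>m d 1 :: complex mat) $$ (0, 0)" by simp
    moreover have "d > 0" using S by (simp add: irreducible_rep_def)
    ultimately show False by (simp add: basis_col_def)
  qed
  have ancilla_one: "\<exists>r0. \<forall>r\<ge>r0. is_P_max G (n * r) (with_ancilla r U) 0 1"
    if mult: "\<forall>d S. irreducible_rep G c d S \<longrightarrow> multiplicity_rep G c n U d S \<ge> 1"
  proof -
    obtain r0 where "\<And>r. r0 \<le> r \<Longrightarrow> embeds G (card (carrier G)) R (n * r) (with_ancilla r U)"
      using regular_rep_embeds_ancilla[OF G R U] mult by metis
    then show ?thesis
      using is_P_max_one[OF G fin proj_rep_with_ancilla[OF U G] R] by blast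
  qed
  show ?thesis
    using one zero ancilla_zero ancilla_one by (auto simp: not_le)
qed

end
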